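(* Let $p$ be a prime, let $G$ be a finite group of parabolic characteristic $p$ with $p$ dividing $|G|$, and let $T$ be a $p$-subgroup of $G$. Put $C = T\cdot C_G(T)$ and $O_C = O_p(C)$. Assume: (N1) $O_C$ contains no $p$-central element of $G$. (N2) $C$ has the form $C = O_C.H.K$, that is, there is a normal subgroup $L$ of $C$ with $O_C\le L$, $H = L/O_C$ and $K = C/L$; moreover the group $H$ has parabolic characteristic $p$, and $L$ is a normal subgroup of $N_G(T)$. (N3) There exist $S_C\in \mathrm{Syl}_p(C)$ and $S\in\mathrm{Syl}_p(G)$ with $S_C\le S$ such that, setting $S_L = S_C\cap L$ (a Sylow $p$-subgroup of $L$), one has $Z(S)\cap S_L\neq 1$. Then there is an $N_G(T)$-equivariant homotopy equivalence between $\mathcal{D}(G)^T$ and $\mathcal{D}(H)$.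
   Context: For a finite group $X$, $O_p(X)$ is the largest normal $p$-subgroup of $X$. $X$ has characteristic $p$ if $C_X(O_p(X)) \le O_p(X)$. A $p$-local subgroup of $X$ is the normalizer in $X$ of a nontrivial $p$-subgroup; a parabolic subgroup of $X$ is a subgroup containing a Sylow $p$-subgroup of $X$. $X$ has parabolic characteristic $p$ if every $p$-local subgroup of $X$ that is also parabolic has characteristic $p$. An element of order $p$ in $G$ is $p$-central (in $G$) if it lies in the center of some Sylow $p$-subgroup of $G$. A $p$-subgroup $R$ of $X$ is $p$-radical if $R = O_p(N_X(R))$, and $p$-centric if $Z(R)$ is a Sylow $p$-subgroup of $C_X(R)$. $\mathcal{D}(X)$ is the poset (under inclusion) of nontrivial $p$-subgroups of $X$ that are both $p$-centric and $p$-radical in $X$; topological statements about a poset refer to (the geometric realization of) its order complex. $\mathcal{D}(G)^T=\{Q\in\mathcal{D}(G) : T\le N_G(Q)\}$, on which $N_G(T)$ acts by conjugation. $N_G(T)$ acts on $H=L/O_C$ by conjugation and hence on $\mathcal{D}(H)$, with $O_C$ acting trivially on $\mathcal{D}(H)$. *)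

theory Defs
  imports "HOL-Algebra.Algebra" "HOL-Analysis.Analysis"
begin

section \<open>Finite groups and the prime p\<close>

text \<open>A subgroup \<open>X\<close> of \<open>G\<close> is regarded as a group in its own right via \<open>G\<lparr>carrier := X\<rparr>\<close>.\<close>

definition centralizer :: "('a, 'b) monoid_scheme \<Rightarrow> 'a set \<Rightarrow> 'a set" where
  "centralizer G A = {g \<in> carrier G. \<forall>a\<in>A. g \<otimes>\<^bsub>G\<^esub> a = a \<otimes>\<^bsub>G\<^esub> g}"

definition group_center :: "('a, 'b) monoid_scheme \<Rightarrow> 'a set" where
  "group_center G = centralizer G (carrier G)"

definition p_subgroup :: "nat \<Rightarrow> ('a, 'b) monoid_scheme \<Rightarrow> 'a set \<Rightarrow> bool" where
  "p_subgroup p G P \<longleftrightarrow> subgroup P G \<and> (\<exists>n. card P = p ^ n)"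

definition sylow_subgroup :: "nat \<Rightarrow> ('a, 'b) monoid_scheme \<Rightarrow> 'a set \<Rightarrow> bool" where
  "sylow_subgroup p G P \<longleftrightarrow> subgroup P G \<and> card P = p ^ multiplicity p (Coset.order G)"

text \<open>\<open>O\<^sub>p(G)\<close>; the greatest element is taken with respect to inclusion, and it exists for every
  finite group because the product of two normal \<open>p\<close>-subgroups is again one.\<close>

definition p_core :: "nat \<Rightarrow> ('a, 'b) monoid_scheme \<Rightarrow> 'a set" where
  "p_core p G = (GREATEST N. N \<lhd> G \<and> p_subgroup p G N)"

definition characteristic_p :: "nat \<Rightarrow> ('a, 'b) monoid_scheme \<Rightarrow> bool" where
  "characteristic_p p G \<longleftrightarrow> centralizer G (p_core p G) \<subseteq> p_core p G"

definition p_local :: "nat \<Rightarrow> ('a, 'b) monoid_scheme \<Rightarrow> 'a set \<Rightarrow> bool" where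
  "p_local p G M \<longleftrightarrow> (\<exists>R. p_subgroup p G R \<and> R \<noteq> {\<one>\<^bsub>G\<^esub>} \<and> M = normalizer G R)"

definition parabolic :: "nat \<Rightarrow> ('a, 'b) monoid_scheme \<Rightarrow> 'a set \<Rightarrow> bool" where
  "parabolic p G M \<longleftrightarrow> subgroup M G \<and> (\<exists>S. sylow_subgroup p G S \<and> S \<subseteq> M)"

definition parabolic_characteristic_p :: "nat \<Rightarrow> ('a, 'b) monoid_scheme \<Rightarrow> bool" where
  "parabolic_characteristic_p p G \<longleftrightarrow>
     (\<forall>M. p_local p G M \<and> parabolic p G M \<longrightarrow> characteristic_p p (G\<lparr>carrier := M\<rparr>))"

definition p_central :: "nat \<Rightarrow> ('a, 'b) monoid_scheme \<Rightarrow> 'a \<Rightarrow> bool" where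
  "p_central p G x \<longleftrightarrow> x \<in> carrier G \<and> group.ord G x = p \<and>
     (\<exists>S. sylow_subgroup p G S \<and> x \<in> group_center (G\<lparr>carrier := S\<rparr>))"

definition p_radical :: "nat \<Rightarrow> ('a, 'b) monoid_scheme \<Rightarrow> 'a set \<Rightarrow> bool" where
  "p_radical p G R \<longleftrightarrow> p_subgroup p G R \<and> R = p_core p (G\<lparr>carrier := normalizer G R\<rparr>)"

definition p_centric :: "nat \<Rightarrow> ('a, 'b) monoid_scheme \<Rightarrow> 'a set \<Rightarrow> bool" where
  "p_centric p G R \<longleftrightarrow> p_subgroup p G R \<and>
     sylow_subgroup p (G\<lparr>carrier := centralizer G R\<rparr>) (group_center (G\<lparr>carrier := R\<rparr>))"

text \<open>\<open>\<D>(G)\<close>, ordered by inclusion\<close>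

definition centric_radicals :: "nat \<Rightarrow> ('a, 'b) monoid_scheme \<Rightarrow> 'a set set" where
  "centric_radicals p G = {R. p_subgroup p G R \<and> R \<noteq> {\<one>\<^bsub>G\<^esub>} \<and> p_centric p G R \<and> p_radical p G R}"

text \<open>\<open>\<D>(G)\<^sup>T\<close>\<close>

definition centric_radicals_fixed :: "nat \<Rightarrow> ('a, 'b) monoid_scheme \<Rightarrow> 'a set \<Rightarrow> 'a set set" where
  "centric_radicals_fixed p G T = {Q \<in> centric_radicals p G. T \<subseteq> normalizer G Q}"

text \<open>Conjugation \<open>A \<mapsto> g A g\<^sup>-\<^sup>1\<close>. Elements of a quotient \<open>L/N\<close> are cosets, hence subsets of \<open>G\<close>, and
  subgroups of \<open>L/N\<close> are sets of cosets; conjugation by \<open>g\<close> acts on the latter elementwise.\<close>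

definition conj_set :: "('a, 'b) monoid_scheme \<Rightarrow> 'a \<Rightarrow> 'a set \<Rightarrow> 'a set" where
  "conj_set G g A = g <#\<^bsub>G\<^esub> A #>\<^bsub>G\<^esub> inv\<^bsub>G\<^esub> g"

definition conj_cosets :: "('a, 'b) monoid_scheme \<Rightarrow> 'a \<Rightarrow> 'a set set \<Rightarrow> 'a set set" where
  "conj_cosets G g Q = conj_set G g ` Q"


section \<open>Order complexes and equivariant homotopy equivalence\<close>

definition order_complex :: "'v::order set \<Rightarrow> 'v set set" where
  "order_complex P = {\<sigma>. finite \<sigma> \<and> \<sigma> \<noteq> {} \<and> \<sigma> \<subseteq> P \<and> Complete_Partial_Order.chain (\<le>) \<sigma>}"

text \<open>Points of the realization of an abstract simplicial complex \<open>K\<close> are given by barycentric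
  coordinates. The topology of pointwise convergence is the usual one for finite \<open>K\<close>; for infinite
  \<open>K\<close> it would in general be coarser than the coherent topology.\<close>

definition realization :: "'v set set \<Rightarrow> ('v \<Rightarrow> real) topology" where
  "realization K = subtopology (powertop_real UNIV)
     {x. (\<forall>v. 0 \<le> x v) \<and> {v. x v \<noteq> 0} \<in> K \<and> (\<Sum>v | x v \<noteq> 0. x v) = 1}"

text \<open>The map of realizations (affine on every simplex) induced by a vertex map \<open>f\<close>\<close>

definition realization_map :: "('v \<Rightarrow> 'w) \<Rightarrow> ('v \<Rightarrow> real) \<Rightarrow> 'w \<Rightarrow> real" where
  "realization_map f x = (\<lambda>w. \<Sum>v | x v \<noteq> 0 \<and> f v = w. x v)"

definition equivariant_map ::
  "'g set \<Rightarrow> ('g \<Rightarrow> 'x \<Rightarrow> 'x) \<Rightarrow> ('g \<Rightarrow> 'y \<Rightarrow> 'y) \<Rightarrow> 'x topology \<Rightarrow> ('x \<Rightarrow> 'y) \<Rightarrow> bool" where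
  "equivariant_map N a b Y f \<longleftrightarrow> (\<forall>n\<in>N. \<forall>x\<in>topspace Y. f (a n x) = b n (f x))"

text \<open>Both homotopies run through equivariant maps, i.e. they are equivariant for the trivial action
  on the interval. Here \<open>a\<close> and \<open>b\<close> are actions of \<open>N\<close> on \<open>Y\<close> and \<open>Z\<close>.\<close>

definition equivariant_homotopy_equivalent ::
  "'g set \<Rightarrow> ('g \<Rightarrow> 'x \<Rightarrow> 'x) \<Rightarrow> 'x topology \<Rightarrow> ('g \<Rightarrow> 'y \<Rightarrow> 'y) \<Rightarrow> 'y topology \<Rightarrow> bool" where
  "equivariant_homotopy_equivalent N a Y b Z \<longleftrightarrow>
     (\<exists>f g. continuous_map Y Z f \<and> equivariant_map N a b Y f \<and>
            continuous_map Z Y g \<and> equivariant_map N b a Z g \<and>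
            homotopic_with (equivariant_map N a a Y) Y Y (g \<circ> f) id \<and>
            homotopic_with (equivariant_map N b b Z) Z Z (f \<circ> g) id)"

end

theory Submission
  imports Defs
begin

text \<open>
  Call a \<open>p\<close>-subgroup \<^emph>\<open>distinguished\<close> if its centre contains a \<open>p\<close>-central element. All comparisons
  take place along the zigzag of \<open>N\<^sub>G(T)\<close>-stable posets of \<open>p\<close>-subgroups
  \<open>\<D>(G)\<^sup>T \<subseteq> Y0 \<supseteq> Y1 \<supseteq> Y2 \<supseteq> Y3 \<supseteq> Y4 \<cong> Y5 \<supseteq> \<D>(H)\<close>, where \<open>Y0\<close> consists of the distinguished subgroups
  normalized by \<open>T\<close>, \<open>Y1\<close> of those containing \<open>T\<close>, and \<open>Y2\<close> of those which moreover lie in \<open>C\<close>; the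
  members of \<open>Y3\<close> lie between \<open>O\<^sub>C\<close> and \<open>C\<close> and contain in their centre a \<open>p\<close>-central element provided by
  (N3), \<open>Y4\<close> is the part of \<open>Y3\<close> inside \<open>L\<close>, and \<open>Y5\<close> is its image in \<open>H\<close>. The maps \<open>Q \<mapsto> Q \<inter> C\<close> and
  \<open>Q \<mapsto> Q \<inter> L\<close> retract \<open>Y1\<close> to \<open>Y2\<close> and \<open>Y3\<close> to \<open>Y4\<close>. In the other inclusions, the poset above an element
  \<open>Q\<close> of the difference contracts conically along \<open>R \<ge> N\<^sub>R(Q) \<le> W N\<^sub>R(Q) \<ge> W\<close>, for instance with
  \<open>W = O\<^sub>p(N\<^sub>G(Q))\<close>. That \<open>W\<close> contains its centralizer, so that everything above it is distinguished
  again, is where parabolic characteristic \<open>p\<close> and Thompson's \<open>A \<times> B\<close>-lemma enter. Equivariance is kept by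
  removing a whole antichain at a time with an explicit deformation of the realization.
\<close>

section \<open>Points of order complexes\<close>

text \<open>\<open>\<D>(G)\<^sup>T\<close> is not closed under passing to \<open>N_R(Q)\<close> or
  under products, and a conical contraction needs both. A \<open>p\<close>-central element in the
  centre is a weaker property that survives: it passes to every subgroup of R containing Z(R), and
  it holds automatically above any \<open>p\<close>-subgroup that contains its own centralizer.
  Quillen's fibre lemma by itself gives only an ordinary homotopy equivalence. Equivariance is read
  off from explicit formulas in barycentric coordinates in which nothing is chosen for an individual
  vertex. Vertices are removed from the bottom up, so everything above a vertex y being removed is
  still present; contracting that upper part is enough, because a chain through y may keep its lower
  part unchanged. The shrinking of the marking set at \<open>Y3\<close> is forced by the two ends of
  the zigzag: the marks must be plentiful in C and visible in H. (N3) gives the first, since every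
  \<open>p\<close>-subgroup of C is centralized by such an element; (N1) gives the second, since it
  keeps their images in H from being trivial.\<close>

definition chain_points :: "'v::order set \<Rightarrow> ('v \<Rightarrow> real) set" where
  "chain_points P = {x. (\<forall>v. 0 \<le> x v) \<and> (\<forall>v. x v \<noteq> 0 \<longrightarrow> v \<in> P) \<and>
     (\<forall>u v. x u \<noteq> 0 \<and> x v \<noteq> 0 \<longrightarrow> u \<le> v \<or> v \<le> u) \<and> sum x P = 1}"

text \<open>On \<open>chain_points P\<close> this is \<open>realization_map f\<close>, but the fixed index set makes continuity evident.\<close>

definition push :: "'v set \<Rightarrow> ('v \<Rightarrow> 'w) \<Rightarrow> ('v \<Rightarrow> real) \<Rightarrow> 'w \<Rightarrow> real" where
  "push P f x w = (\<Sum>v\<in>P. if f v = w then x v else 0)"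

lemma chain_pointsD:
  assumes "x \<in> chain_points P"
  shows "0 \<le> x v" "x v \<noteq> 0 \<Longrightarrow> v \<in> P" "x u \<noteq> 0 \<Longrightarrow> x v \<noteq> 0 \<Longrightarrow> u \<le> v \<or> v \<le> u" "sum x P = 1"
  using assms by (auto simp: chain_points_def)

text \<open>Points are functions on the whole vertex type, so the realization of a subposet is
  literally a subset and its inclusion map is \<open>id\<close>.\<close>

lemma chain_points_mono: "P \<subseteq> Q \<Longrightarrow> finite Q \<Longrightarrow> chain_points P \<subseteq> chain_points Q"
proof
  fix x assume PQ: "P \<subseteq> Q" "finite Q" and x: "x \<in> chain_points P"
  have "sum x Q = sum x P"
    using PQ chain_pointsD(2)[OF x] by (intro sum.mono_neutral_right) auto
  then show "x \<in> chain_points Q"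
    using x PQ by (auto simp: chain_points_def)
qed

lemma realization_order_complex:
  assumes "finite P"
  shows "realization (order_complex P) = top_of_set (chain_points P)"
proof -
  have "{x. (\<forall>v. 0 \<le> x v) \<and> {v. x v \<noteq> 0} \<in> order_complex P \<and> (\<Sum>v | x v \<noteq> 0. x v) = 1} = chain_points P"
    (is "?A = _")
  proof (intro equalityI subsetI)
    fix x :: "'a \<Rightarrow> real"
    assume x: "x \<in> ?A"
    then have "{v. x v \<noteq> 0} \<subseteq> P"
      by (auto simp: order_complex_def)
    then have "sum x P = sum x {v. x v \<noteq> 0}"
      using assms by (intro sum.mono_neutral_right) auto
    with x show "x \<in> chain_points P"
      by (auto simp: chain_points_def order_complex_def Complete_Partial_Order.chain_def)
  next
    fix x :: "'a \<Rightarrow> real"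
    assume x: "x \<in> chain_points P"
    then have sub: "{v. x v \<noteq> 0} \<subseteq> P"
      by (auto simp: chain_points_def)
    then have "sum x P = sum x {v. x v \<noteq> 0}"
      using assms by (intro sum.mono_neutral_right) auto
    moreover have "{v. x v \<noteq> 0} \<noteq> {}"
      using chain_pointsD(4)[OF x] by (auto intro: ccontr)
    ultimately show "x \<in> ?A"
      using x sub finite_subset[OF sub assms]
      by (auto simp: chain_points_def order_complex_def Complete_Partial_Order.chain_def)
  qed
  then show ?thesis
    by (simp add: realization_def euclidean_product_topology)
qed

lemma realization_map_eq_push:
  assumes "finite P" "x \<in> chain_points P"
  shows "realization_map f x = push P f x"
proof
  fix w
  have "{v. x v \<noteq> 0 \<and> f v = w} \<subseteq> P"
    using chain_pointsD(2)[OF assms(2)] by auto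
  then have "sum x {v. x v \<noteq> 0 \<and> f v = w} = (\<Sum>v\<in>P. if v \<in> {v. x v \<noteq> 0 \<and> f v = w} then x v else 0)"
    using assms(1) by (simp add: sum.If_cases Int_absorb1)
  also have "\<dots> = push P f x w"
    unfolding push_def by (intro sum.cong) auto
  finally show "realization_map f x w = push P f x w"
    by (simp add: realization_map_def)
qed

lemma push_nonneg: "x \<in> chain_points P \<Longrightarrow> 0 \<le> push P f x w"
  unfolding push_def by (intro sum_nonneg) (auto dest: chain_pointsD(1))

lemma push_supportE:
  assumes "push P f x w \<noteq> 0"
  obtains v where "v \<in> P" "x v \<noteq> 0" "f v = w"
proof -
  obtain v where "v \<in> P" "(if f v = w then x v else 0) \<noteq> 0"
    using assms unfolding push_def by (rule sum.not_neutral_contains_not_neutral)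
  then show ?thesis
    by (intro that[of v]) (auto split: if_splits)
qed

lemma sum_push:
  assumes "finite P" "finite Q" "\<And>v. v \<in> P \<Longrightarrow> x v \<noteq> 0 \<Longrightarrow> f v \<in> Q"
  shows "sum (push P f x) Q = sum x P"
proof -
  have "sum (push P f x) Q = (\<Sum>v\<in>P. \<Sum>w\<in>Q. if f v = w then x v else 0)"
    unfolding push_def by (rule sum.swap)
  also have "\<dots> = sum x P"
  proof (intro sum.cong refl)
    fix v assume "v \<in> P"
    then show "(\<Sum>w\<in>Q. if f v = w then x v else 0) = x v"
      using assms(2) assms(3)[of v] by (cases "x v = 0") simp_all
  qed
  finally show ?thesis .
qed

text \<open>Only the support of the one point \<open>x\<close> has to be carried to a chain: the
  maps used around an antichain are controlled on a star, not on all of \<open>P\<close>.\<close>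

lemma push_in_chain_points:
  assumes "finite P" "finite Q" and x: "x \<in> chain_points P"
    and "\<And>v. v \<in> P \<Longrightarrow> x v \<noteq> 0 \<Longrightarrow> f v \<in> Q"
    and "\<And>u v. x u \<noteq> 0 \<Longrightarrow> x v \<noteq> 0 \<Longrightarrow> f u \<le> f v \<or> f v \<le> f u"
  shows "push P f x \<in> chain_points Q"
  unfolding chain_points_def
proof (intro CollectI conjI allI impI)
  show "sum (push P f x) Q = 1"
    using sum_push[OF assms(1,2,4)] chain_pointsD(4)[OF x] by simp
  show "0 \<le> push P f x v" for v
    using push_nonneg[OF x] .
  show "v \<in> Q" if "push P f x v \<noteq> 0" for v
    using that assms(4) by (elim push_supportE) auto
  show "u \<le> v \<or> v \<le> u" if "push P f x u \<noteq> 0 \<and> push P f x v \<noteq> 0" for u v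
    using that assms(5) by (elim conjE push_supportE) auto
qed

lemma continuous_on_push [continuous_intros]:
  assumes "\<And>v. v \<in> P \<Longrightarrow> continuous_on S (\<lambda>z. x z v)"
  shows "continuous_on S (\<lambda>z. push P f (x z) w)"
  unfolding push_def
proof (intro continuous_on_sum)
  fix v assume "v \<in> P"
  then show "continuous_on S (\<lambda>z. if f v = w then x z v else 0)"
    using assms by (cases "f v = w") auto
qed

lemma push_id:
  assumes "finite P" "x \<in> chain_points P" "\<And>v. v \<in> P \<Longrightarrow> x v \<noteq> 0 \<Longrightarrow> f v = v"
  shows "push P f x = x"
proof
  fix w
  have "push P f x w = (\<Sum>v\<in>P. if v = w then x v else 0)"
    unfolding push_def by (intro sum.cong refl) (use assms(3) in force)
  then show "push P f x w = x w"
    using assms(1) chain_pointsD(2)[OF assms(2)] by (auto simp: sum.delta)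
qed

lemma push_inj:
  assumes "finite P" "inj_on f P" "v \<in> P"
  shows "push P f x (f v) = x v"
proof -
  have "push P f x (f v) = (\<Sum>u\<in>P. if u = v then x u else 0)"
    unfolding push_def using assms by (intro sum.cong) (auto dest: inj_onD)
  then show ?thesis
    using assms by (simp add: sum.delta)
qed


section \<open>Equivariant homotopy equivalences\<close>

text \<open>No composition law is imposed: \<open>N\<close> acts as a mere index set of order
  automorphisms, since equivariance is a condition on each \<open>n\<close> separately.\<close>

definition poset_auts :: "'g set \<Rightarrow> ('g \<Rightarrow> 'v \<Rightarrow> 'v) \<Rightarrow> 'v::order set \<Rightarrow> bool" where
  "poset_auts N act P \<longleftrightarrow> finite P \<and>
     (\<forall>n\<in>N. bij_betw (act n) P P \<and> (\<forall>x\<in>P. \<forall>y\<in>P. act n x \<le> act n y \<longleftrightarrow> x \<le> y))"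

abbreviation (input) chain_action :: "('g \<Rightarrow> 'v \<Rightarrow> 'v) \<Rightarrow> 'g \<Rightarrow> ('v \<Rightarrow> real) \<Rightarrow> 'v \<Rightarrow> real" where
  "chain_action \<equiv> \<lambda>act n. realization_map (act n)"

abbreviation (input) complexes_equivalent ::
  "'g set \<Rightarrow> ('g \<Rightarrow> 'v \<Rightarrow> 'v) \<Rightarrow> 'v::order set \<Rightarrow> ('g \<Rightarrow> 'w \<Rightarrow> 'w) \<Rightarrow> 'w::order set \<Rightarrow> bool" where
  "complexes_equivalent N a P b Q \<equiv> equivariant_homotopy_equivalent N
     (chain_action a) (realization (order_complex P)) (chain_action b) (realization (order_complex Q))"

abbreviation (input) equivariant_self_map where
  "equivariant_self_map N act P \<equiv>
     equivariant_map N (chain_action act) (chain_action act) (realization (order_complex P))"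

lemma equivariant_homotopy_equivalent_sym:
  "equivariant_homotopy_equivalent N a Y b Z \<Longrightarrow> equivariant_homotopy_equivalent N b Z a Y"
  unfolding equivariant_homotopy_equivalent_def by blast

lemma equivariant_homotopy_equivalent_trans:
  assumes XY: "equivariant_homotopy_equivalent N a W b Y"
    and YZ: "equivariant_homotopy_equivalent N b Y c Z"
  shows "equivariant_homotopy_equivalent N a W c Z"
proof -
  obtain f g where f: "continuous_map W Y f" "equivariant_map N a b W f"
    and g: "continuous_map Y W g" "equivariant_map N b a Y g"
    and gf: "homotopic_with (equivariant_map N a a W) W W (g \<circ> f) id"
    and fg: "homotopic_with (equivariant_map N b b Y) Y Y (f \<circ> g) id"
    using XY unfolding equivariant_homotopy_equivalent_def by blast
  obtain f' g' where f': "continuous_map Y Z f'" "equivariant_map N b c Y f'"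
    and g': "continuous_map Z Y g'" "equivariant_map N c b Z g'"
    and gf': "homotopic_with (equivariant_map N b b Y) Y Y (g' \<circ> f') id"
    and fg': "homotopic_with (equivariant_map N c c Z) Z Z (f' \<circ> g') id"
    using YZ unfolding equivariant_homotopy_equivalent_def by blast
  have comp: "equivariant_map N a c W (k \<circ> h)"
    if "continuous_map W Y h" "equivariant_map N a b W h" "equivariant_map N b c Y k"
    for a b c h k and W :: "'z topology" and Y :: "'y topology"
    using that unfolding equivariant_map_def continuous_map_def by (auto simp: Pi_iff)
  \<comment> \<open>Composition preserves equivariance only if the inner map lands in the space
    where the outer one is equivariant, so continuity is added to the property carried along the
    homotopy.\<close>
  have strengthen: "homotopic_with (\<lambda>h. continuous_map W W h \<and> equivariant_map N a a W h) W W k l"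
    if "homotopic_with (equivariant_map N a a W) W W k l" for a k l and W :: "'z topology"
    using that by (rule homotopic_with_mono) auto
  have "homotopic_with (equivariant_map N a a W) W W (g \<circ> ((g' \<circ> f') \<circ> f)) (g \<circ> (id \<circ> f))"
    by (rule homotopic_with_compose_continuous_map_left
          [OF homotopic_with_compose_continuous_map_right
            [OF strengthen[OF gf'] f(1),
             where q = "\<lambda>h. continuous_map W Y h \<and> equivariant_map N a b W h"] g(1)])
       (use f g in \<open>auto intro!: comp intro: continuous_map_compose\<close>)
  then have 1: "homotopic_with (equivariant_map N a a W) W W ((g \<circ> g') \<circ> (f' \<circ> f)) id"
    using gf by (auto simp: comp_assoc intro: homotopic_with_trans)
  have "homotopic_with (equivariant_map N c c Z) Z Z (f' \<circ> ((f \<circ> g) \<circ> g')) (f' \<circ> (id \<circ> g'))"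
    by (rule homotopic_with_compose_continuous_map_left
          [OF homotopic_with_compose_continuous_map_right
            [OF strengthen[OF fg] g'(1),
             where q = "\<lambda>h. continuous_map Z Y h \<and> equivariant_map N c b Z h"] f'(1)])
       (use f' g' in \<open>auto intro!: comp intro: continuous_map_compose\<close>)
  then have 2: "homotopic_with (equivariant_map N c c Z) Z Z ((f' \<circ> f) \<circ> (g \<circ> g')) id"
    using fg' by (auto simp: comp_assoc intro: homotopic_with_trans)
  show ?thesis
    unfolding equivariant_homotopy_equivalent_def
    using 1 2 f g f' g' by (blast intro: comp continuous_map_compose)
qed

context
  fixes N :: "'g set" and act :: "'g \<Rightarrow> 'v::order \<Rightarrow> 'v"
begin

text \<open>A coordinatewise form of commuting with the action, equivalent to it by
  \<open>eqv_iff\<close> for maps preserving \<open>chain_points P\<close>. It avoids the sums in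
  the action and visibly passes to affine combinations.\<close>

definition eqv :: "'v set \<Rightarrow> (('v \<Rightarrow> real) \<Rightarrow> 'v \<Rightarrow> real) \<Rightarrow> bool" where
  "eqv P \<alpha> \<longleftrightarrow> (\<forall>n\<in>N. \<forall>u\<in>chain_points P. \<forall>v\<in>P. \<alpha> (push P (act n) u) (act n v) = \<alpha> u v)"

lemma poset_autsD:
  assumes "poset_auts N act P"
  shows "finite P" "n \<in> N \<Longrightarrow> bij_betw (act n) P P" "n \<in> N \<Longrightarrow> inj_on (act n) P"
    "n \<in> N \<Longrightarrow> v \<in> P \<Longrightarrow> act n v \<in> P"
    "n \<in> N \<Longrightarrow> v \<in> P \<Longrightarrow> w \<in> P \<Longrightarrow> act n v \<le> act n w \<longleftrightarrow> v \<le> w"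
    "n \<in> N \<Longrightarrow> v \<in> P \<Longrightarrow> w \<in> P \<Longrightarrow> act n v < act n w \<longleftrightarrow> v < w"
  using assms unfolding poset_auts_def bij_betw_def by (auto simp: less_le_not_le)

lemma poset_auts_stable:
  assumes P: "poset_auts N act P" and B: "B \<subseteq> P" "\<And>y. y \<in> B \<Longrightarrow> act n y \<in> B" and n: "n \<in> N"
  shows "act n ` B = B" "v \<in> P \<Longrightarrow> act n v \<in> B \<longleftrightarrow> v \<in> B"
proof -
  show eq: "act n ` B = B"
    using B finite_subset[OF B(1) poset_autsD(1)[OF P]] inj_on_subset[OF poset_autsD(3)[OF P n] B(1)]
    by (intro endo_inj_surj) auto
  show "act n v \<in> B \<longleftrightarrow> v \<in> B" if "v \<in> P"
    using inj_on_image_mem_iff[OF poset_autsD(3)[OF P n] that B(1)] eq by simp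
qed

lemma action_in_chain_points:
  assumes "poset_auts N act P" "n \<in> N" "x \<in> chain_points P"
  shows "push P (act n) x \<in> chain_points P"
  using poset_autsD[OF assms(1)] assms
  by (intro push_in_chain_points) (meson chain_pointsD)+

lemma eq_action_iff:
  assumes P: "poset_auts N act P" and n: "n \<in> N"
    and x: "x \<in> chain_points P" and x': "x' \<in> chain_points P"
  shows "x' = push P (act n) x \<longleftrightarrow> (\<forall>v\<in>P. x' (act n v) = x v)"
proof
  assume "x' = push P (act n) x"
  then show "\<forall>v\<in>P. x' (act n v) = x v"
    using poset_autsD[OF P] n by (auto intro: push_inj)
next
  assume *: "\<forall>v\<in>P. x' (act n v) = x v"
  show "x' = push P (act n) x"
  proof
    fix w
    have nx: "push P (act n) x \<in> chain_points P"
      using action_in_chain_points[OF P n x] .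
    show "x' w = push P (act n) x w"
    proof (cases "w \<in> P")
      case True
      then obtain v where "v \<in> P" "w = act n v"
        using poset_autsD(2)[OF P n] by (auto simp: bij_betw_def)
      then show ?thesis
        using * push_inj[OF poset_autsD(1)[OF P] poset_autsD(3)[OF P n]] by simp
    next
      case False
      then show ?thesis
        using chain_pointsD(2)[OF x'] chain_pointsD(2)[OF nx] by metis
    qed
  qed
qed

lemma eqv_iff:
  assumes P: "poset_auts N act P" and m: "\<And>u. u \<in> chain_points P \<Longrightarrow> \<alpha> u \<in> chain_points P"
  shows "equivariant_self_map N act P \<alpha> \<longleftrightarrow> eqv P \<alpha>"
proof -
  have "\<alpha> (realization_map (act n) u) = realization_map (act n) (\<alpha> u) \<longleftrightarrow>
      (\<forall>v\<in>P. \<alpha> (push P (act n) u) (act n v) = \<alpha> u v)"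
    if "n \<in> N" "u \<in> chain_points P" for n u
    using eq_action_iff[OF P that(1) m[OF that(2)] m[OF action_in_chain_points[OF P that]]] that m
    by (simp add: realization_map_eq_push[OF poset_autsD(1)[OF P]])
  then show ?thesis
    unfolding equivariant_map_def eqv_def
    by (simp add: realization_order_complex[OF poset_autsD(1)[OF P]])
qed

abbreviation homotopic_maps where
  "homotopic_maps P \<equiv> homotopic_with (equivariant_self_map N act P)
     (realization (order_complex P)) (realization (order_complex P))"

text \<open>The supports of \<open>\<alpha> u\<close> and \<open>\<beta> u\<close> together form a
  chain, so the segment between the two points stays inside one closed simplex.\<close>

lemma straight_line_homotopic:
  assumes P: "poset_auts N act P"
    and c\<alpha>: "continuous_on (chain_points P) \<alpha>" and c\<beta>: "continuous_on (chain_points P) \<beta>"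
    and m\<alpha>: "\<And>u. u \<in> chain_points P \<Longrightarrow> \<alpha> u \<in> chain_points P"
    and m\<beta>: "\<And>u. u \<in> chain_points P \<Longrightarrow> \<beta> u \<in> chain_points P"
    and e\<alpha>: "eqv P \<alpha>" and e\<beta>: "eqv P \<beta>"
    and chain: "\<And>u v w. u \<in> chain_points P \<Longrightarrow> \<alpha> u v \<noteq> 0 \<Longrightarrow> \<beta> u w \<noteq> 0 \<Longrightarrow> v \<le> w \<or> w \<le> v"
  shows "homotopic_maps P \<alpha> \<beta>"
proof -
  define h where "h = (\<lambda>(s::real, u) v. (1 - s) * \<alpha> u v + s * \<beta> u v)"
  have m: "h (s, u) \<in> chain_points P" if "s \<in> {0..1}" "u \<in> chain_points P" for s u
    unfolding chain_points_def
  proof (intro CollectI conjI allI impI)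
    have a: "\<alpha> u \<in> chain_points P" and b: "\<beta> u \<in> chain_points P"
      using m\<alpha> m\<beta> that by auto
    show "0 \<le> h (s, u) v" for v
      using that chain_pointsD(1)[OF a] chain_pointsD(1)[OF b] by (simp add: h_def)
    have supp: "\<alpha> u v \<noteq> 0 \<or> \<beta> u v \<noteq> 0" if "h (s, u) v \<noteq> 0" for v
      using that by (auto simp: h_def)
    show "v \<in> P" if "h (s, u) v \<noteq> 0" for v
      using supp[OF that] chain_pointsD(2)[OF a] chain_pointsD(2)[OF b] by auto
    show "v \<le> w \<or> w \<le> v" if "h (s, u) v \<noteq> 0 \<and> h (s, u) w \<noteq> 0" for v w
      using supp[of v] supp[of w] that chain_pointsD(3)[OF a] chain_pointsD(3)[OF b]
        chain[OF \<open>u \<in> chain_points P\<close>] by blast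
    show "sum (h (s, u)) P = 1"
      using chain_pointsD(4)[OF a] chain_pointsD(4)[OF b]
      by (simp add: h_def sum.distrib flip: sum_distrib_left)
  qed
  have coord: "continuous_on ({0..1} \<times> chain_points P) (\<lambda>z. \<gamma> (snd z) v)"
    if "continuous_on (chain_points P) \<gamma>" for \<gamma> :: "('v \<Rightarrow> real) \<Rightarrow> 'v \<Rightarrow> real" and v
  proof -
    have "continuous_on (chain_points P) (\<lambda>u. \<gamma> u v)"
      using continuous_on_product_then_coordinatewise[OF that] .
    then show ?thesis
      by (rule continuous_on_compose2) (auto intro: continuous_on_snd continuous_on_id)
  qed
  have "continuous_on ({0..1} \<times> chain_points P) h"
    unfolding h_def case_prod_beta
    by (intro continuous_intros coord c\<alpha> c\<beta>)
  moreover have "equivariant_self_map N act P (\<lambda>u. h (s, u))"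
    if "s \<in> {0..1}" for s
  proof -
    have "eqv P (\<lambda>u. h (s, u))"
      using e\<alpha> e\<beta> by (simp add: eqv_def h_def)
    then show ?thesis
      using eqv_iff[OF P m[OF that]] by simp
  qed
  moreover have "h (0, u) = \<alpha> u" "h (1, u) = \<beta> u" for u
    by (auto simp: h_def)
  ultimately show ?thesis
    unfolding homotopic_with_def realization_order_complex[OF poset_autsD(1)[OF P]]
    using m by (intro exI[of _ h]) (auto simp: prod_topology_subtopology_eu)
qed

end


section \<open>Removing an antichain\<close>

definition star :: "'v::order set \<Rightarrow> 'v \<Rightarrow> 'v set" where
  "star P y = {z \<in> P. z \<le> y \<or> y \<le> z}"

lemma chain_points_star:
  assumes "u \<in> chain_points P" "u y \<noteq> 0" "u z \<noteq> 0"
  shows "z \<in> star P y"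
  using assms chain_pointsD(2,3)[OF assms(1)] by (auto simp: star_def)

text \<open>A chain meets an antichain at most once. Hence deformations around different members of
  \<open>A\<close> never interact, and all of \<open>A\<close> can be treated at once without
  choosing orbit representatives.\<close>

locale antichain_removal =
  fixes N :: "'g set" and act :: "'g \<Rightarrow> 'v::order \<Rightarrow> 'v" and P A :: "'v set"
  assumes auts: "poset_auts N act P"
    and A_subset: "A \<subseteq> P"
    and antichain: "\<And>y z. y \<in> A \<Longrightarrow> z \<in> A \<Longrightarrow> y \<le> z \<Longrightarrow> y = z"
    and A_stable: "\<And>n y. n \<in> N \<Longrightarrow> y \<in> A \<Longrightarrow> act n y \<in> A"
begin

lemma finP: "finite P" and finA: "finite A"
  using poset_autsD(1)[OF auts] A_subset finite_subset by auto

lemma A_unique: "y \<in> A \<Longrightarrow> z \<in> A \<Longrightarrow> z \<in> star P y \<Longrightarrow> z = y"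
  using antichain by (auto simp: star_def)

text \<open>\<open>F y\<close> is the vertex map to be applied near \<open>y\<close>. The clause
  about \<open>A\<close> lets a vertex of \<open>A\<close> receive weight only from itself, so
  weight on \<open>A\<close> never grows.\<close>

definition admissible :: "('v \<Rightarrow> 'v \<Rightarrow> 'v) \<Rightarrow> bool" where
  "admissible F \<longleftrightarrow> (\<forall>y\<in>A. \<forall>z\<in>star P y. F y z \<in> P \<and> (F y z \<in> A \<longrightarrow> F y z = z) \<and>
     (\<forall>n\<in>N. F (act n y) (act n z) = act n (F y z)))"

text \<open>Contiguity in the sense of simplicial maps: on a simplex in the star of
  \<open>y\<close>, the images under \<open>F y\<close> and \<open>F' y\<close> are mutually
  comparable. For \<open>F' = F\<close> it says that \<open>F y\<close> is simplicial on the
  star.\<close>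

definition contiguous :: "('v \<Rightarrow> 'v \<Rightarrow> 'v) \<Rightarrow> ('v \<Rightarrow> 'v \<Rightarrow> 'v) \<Rightarrow> bool" where
  "contiguous F F' \<longleftrightarrow> (\<forall>y\<in>A. \<forall>z\<in>star P y. \<forall>w\<in>star P y. z \<le> w \<or> w \<le> z \<longrightarrow>
     F y z \<le> F' y w \<or> F' y w \<le> F y z)"

definition connected_families :: "('v \<Rightarrow> 'v \<Rightarrow> 'v) \<Rightarrow> ('v \<Rightarrow> 'v \<Rightarrow> 'v) \<Rightarrow> bool" where
  "connected_families = (\<lambda>F F'. admissible F \<and> admissible F' \<and> contiguous F F \<and> contiguous F F' \<and> contiguous F' F')\<^sup>*\<^sup>*"

lemma push_family:
  assumes F: "admissible F" "contiguous F F" and u: "u \<in> chain_points P" and y: "y \<in> A" "u y \<noteq> 0"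
  shows "push P (F y) u \<in> chain_points P"
    and "y' \<in> A \<Longrightarrow> push P (F y) u y' \<le> u y'"
    and "n \<in> N \<Longrightarrow> w \<in> P \<Longrightarrow> push P (F (act n y)) (push P (act n) u) (act n w) = push P (F y) u w"
proof -
  have st: "z \<in> star P y" if "u z \<noteq> 0" for z
    using chain_points_star[OF u y(2) that] .
  show "push P (F y) u \<in> chain_points P"
  proof (intro push_in_chain_points finP u)
    show "F y v \<in> P" if "u v \<noteq> 0" for v
      using F y st[OF that] by (auto simp: admissible_def)
    show "F y v \<le> F y w \<or> F y w \<le> F y v" if "u v \<noteq> 0" "u w \<noteq> 0" for v w
      using F(2) y(1) st[OF that(1)] st[OF that(2)] chain_pointsD(3)[OF u that]
      unfolding contiguous_def by blast
  qed
  show "push P (F y) u y' \<le> u y'" if y': "y' \<in> A"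
  proof -
    have "push P (F y) u y' \<le> (\<Sum>v\<in>P. if v = y' then u v else 0)"
      unfolding push_def
    proof (intro sum_mono)
      fix v assume "v \<in> P"
      show "(if F y v = y' then u v else 0) \<le> (if v = y' then u v else 0)"
      proof (cases "u v = 0")
        case False
        then have "F y v = y' \<Longrightarrow> v = y'"
          using F(1) y(1) st[of v] y' unfolding admissible_def by metis
        then show ?thesis
          using chain_pointsD(1)[OF u] by auto
      qed auto
    qed
    also have "\<dots> = u y'"
      using y' A_subset finP by (auto simp: sum.delta)
    finally show ?thesis .
  qed
  show "push P (F (act n y)) (push P (act n) u) (act n w) = push P (F y) u w"
    if n: "n \<in> N" and w: "w \<in> P"
  proof -
    have "push P (F (act n y)) (push P (act n) u) (act n w) =
        (\<Sum>v\<in>P. if F (act n y) (act n v) = act n w then push P (act n) u (act n v) else 0)"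
      unfolding push_def[of P "F (act n y)"]
      using sum.reindex_bij_betw[OF poset_autsD(2)[OF auts n], symmetric] .
    also have "\<dots> = (\<Sum>v\<in>P. if F y v = w then u v else 0)"
    proof (intro sum.cong refl)
      fix v assume v: "v \<in> P"
      have pv: "push P (act n) u (act n v) = u v"
        using push_inj[OF finP poset_autsD(3)[OF auts n] v] .
      show "(if F (act n y) (act n v) = act n w then push P (act n) u (act n v) else 0) =
          (if F y v = w then u v else 0)"
      proof (cases "u v = 0")
        case False
        then have "F (act n y) (act n v) = act n (F y v)" "F y v \<in> P"
          using F y n st by (auto simp: admissible_def)
        then show ?thesis
          using pv inj_on_eq_iff[OF poset_autsD(3)[OF auts n]] w by simp
      qed (simp add: pv)
    qed
    finally show ?thesis
      by (simp add: push_def)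
  qed
qed

text \<open>\<tau> is the weight at \<open>y\<close> from which the move to \<open>F y\<close> is
  complete. The bound \<open>\<alpha> u y \<le> u y\<close> is for the points below the threshold:
  it keeps their weight on \<open>A\<close> small in the final projection.\<close>

definition realizes :: "real \<Rightarrow> ('v \<Rightarrow> 'v \<Rightarrow> 'v) \<Rightarrow> (('v \<Rightarrow> real) \<Rightarrow> 'v \<Rightarrow> real) \<Rightarrow> bool" where
  "realizes \<tau> F \<alpha> \<longleftrightarrow> continuous_on (chain_points P) \<alpha> \<and> eqv N act P \<alpha> \<and>
     homotopic_maps N act P id \<alpha> \<and>
     (\<forall>u\<in>chain_points P. \<alpha> u \<in> chain_points P \<and> ((\<forall>y\<in>A. u y = 0) \<longrightarrow> \<alpha> u = u) \<and>
        (\<forall>y\<in>A. \<alpha> u y \<le> u y \<and> (u y \<ge> \<tau> \<longrightarrow> \<alpha> u = push P (F y) u)))"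

text \<open>The closer a point is to a vertex \<open>y\<close> of the antichain, the further it is moved along the
  sequence of families; points without \<open>y\<close> in their support stay put.\<close>

lemma realizes_exists:
  assumes "connected_families (\<lambda>y z. z) F" "\<tau> > 0"
  shows "\<exists>\<alpha>. realizes \<tau> F \<alpha>"
  using assms unfolding connected_families_def
proof (induction arbitrary: \<tau> rule: rtranclp_induct)
  case base
  have "eqv N act P id"
    using push_inj[OF finP poset_autsD(3)[OF auts]] by (auto simp: eqv_def)
  then have "realizes \<tau> (\<lambda>y z. z) id"
    unfolding realizes_def using eqv_iff[OF auts, of id] by (auto simp: push_id finP)
  then show ?case
    by blast
next
  case (step F F' \<tau>)
  then have F: "admissible F" "contiguous F F" and F': "admissible F'" "contiguous F' F'"
    and FF': "contiguous F F'"
    by auto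
  \<comment> \<open>With the earlier moves completed at weight \<tau>/2, the interval from \<tau>/2
    to \<tau> is free for the passage from \<open>F\<close> to \<open>F'\<close>; \<open>c\<close>
    is the ramp over this interval.\<close>
  obtain \<alpha> where \<alpha>: "realizes (\<tau> / 2) F \<alpha>"
    using step.IH[of "\<tau> / 2"] step.prems by auto
  define c where "c = (\<lambda>t. max 0 (min 1 (2 * t / \<tau> - 1)))"
  have c: "0 \<le> c t" "c t \<le> 1" "t \<le> \<tau> / 2 \<Longrightarrow> c t = 0" "t \<ge> \<tau> \<Longrightarrow> c t = 1" for t
    using step.prems by (auto simp: c_def field_simps)
  \<comment> \<open>At most one summand is nonzero at a given point. Below weight \<tau>/2 the ramp
    vanishes and \<beta> is \<alpha>; above it \<alpha> already equals \<open>push P (F y)\<close>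
    and the summand interpolates to \<open>push P (F' y)\<close>. One global formula makes
    continuity immediate.\<close>
  define \<beta> where "\<beta> = (\<lambda>u w. \<alpha> u w + (\<Sum>y\<in>A. c (u y) * (push P (F' y) u w - push P (F y) u w)))"
  have \<alpha>P: "\<alpha> u \<in> chain_points P" "(\<forall>y\<in>A. u y = 0) \<Longrightarrow> \<alpha> u = u" "y \<in> A \<Longrightarrow> \<alpha> u y \<le> u y"
    "y \<in> A \<Longrightarrow> u y \<ge> \<tau> / 2 \<Longrightarrow> \<alpha> u = push P (F y) u" if "u \<in> chain_points P" for u y
    using \<alpha> that by (auto simp: realizes_def)
  have only: "u y' = 0" if "u \<in> chain_points P" "y \<in> A" "u y \<noteq> 0" "y' \<in> A" "y' \<noteq> y" for u y y'
    using A_unique[OF that(2,4)] chain_points_star[OF that(1,3), of y'] that(5) by blast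
  have \<beta>_at: "\<beta> u = (\<lambda>w. \<alpha> u w + c (u y) * (push P (F' y) u w - push P (F y) u w))"
    if "u \<in> chain_points P" "y \<in> A" "u y \<noteq> 0" for u y
  proof
    fix w
    have "(\<Sum>y'\<in>A. c (u y') * (push P (F' y') u w - push P (F y') u w)) =
        (\<Sum>y'\<in>{y}. c (u y') * (push P (F' y') u w - push P (F y') u w))"
      using that only[OF that] c(3)[of 0] step.prems finA by (intro sum.mono_neutral_right) auto
    then show "\<beta> u w = \<alpha> u w + c (u y) * (push P (F' y) u w - push P (F y) u w)"
      by (simp add: \<beta>_def)
  qed
  have \<beta>_off: "\<beta> u = \<alpha> u" if "u \<in> chain_points P" "\<And>y. y \<in> A \<Longrightarrow> u y < \<tau> / 2" for u
    using that c(3) by (auto simp: \<beta>_def fun_eq_iff less_imp_le intro!: sum.neutral)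
  have \<beta>_near: "\<beta> u = (\<lambda>w. (1 - c (u y)) * push P (F y) u w + c (u y) * push P (F' y) u w)"
    if "u \<in> chain_points P" "y \<in> A" "u y \<ge> \<tau> / 2" for u y
    using \<beta>_at[OF that(1,2)] \<alpha>P(4)[OF that] that(3) step.prems by (auto simp: algebra_simps)
  have cases: "(\<forall>y\<in>A. u y < \<tau> / 2) \<or> (\<exists>y\<in>A. u y \<ge> \<tau> / 2)" for u :: "'v \<Rightarrow> real"
    by fastforce
  have nz: "u y \<noteq> 0" if "u y \<ge> \<tau> / 2" for u :: "'v \<Rightarrow> real" and y
    using that step.prems by auto
  have supp: "v \<le> w \<or> w \<le> v"
    if u: "u \<in> chain_points P" "y \<in> A" "u y \<noteq> 0" and
      v: "push P (F y) u v \<noteq> 0 \<or> push P (F' y) u v \<noteq> 0" and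
      w: "push P (F y) u w \<noteq> 0 \<or> push P (F' y) u w \<noteq> 0" for u y v w
  proof -
    obtain a where a: "u a \<noteq> 0" "v = F y a \<or> v = F' y a"
      using v by (auto elim!: push_supportE)
    obtain b where b: "u b \<noteq> 0" "w = F y b \<or> w = F' y b"
      using w by (auto elim!: push_supportE)
    have "a \<in> star P y" "b \<in> star P y" "a \<le> b \<or> b \<le> a"
      using a b u chain_points_star chain_pointsD(3) by metis+
    then show ?thesis
      using a(2) b(2) F(2) F'(2) FF' u(2) unfolding contiguous_def by blast
  qed
  have \<beta>P: "\<beta> u \<in> chain_points P" if u: "u \<in> chain_points P" for u
    using cases[of u]
  proof
    assume "\<exists>y\<in>A. u y \<ge> \<tau> / 2"
    then obtain y where y: "y \<in> A" "u y \<ge> \<tau> / 2"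
      by auto
    note nz = nz[of u y, OF y(2)]
    note p = push_family(1)[OF F u y(1) nz] and p' = push_family(1)[OF F' u y(1) nz]
    show ?thesis
      unfolding chain_points_def \<beta>_near[OF u y]
    proof (intro CollectI conjI allI impI)
      show "0 \<le> (1 - c (u y)) * push P (F y) u v + c (u y) * push P (F' y) u v" for v
        using c(1,2) chain_pointsD(1)[OF p] chain_pointsD(1)[OF p'] by simp
      show "v \<in> P" if "(1 - c (u y)) * push P (F y) u v + c (u y) * push P (F' y) u v \<noteq> 0" for v
        using that chain_pointsD(2)[OF p, of v] chain_pointsD(2)[OF p', of v]
        by (metis add_0 mult_zero_right)
      show "v \<le> w \<or> w \<le> v"
        if "(1 - c (u y)) * push P (F y) u v + c (u y) * push P (F' y) u v \<noteq> 0 \<and>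
          (1 - c (u y)) * push P (F y) u w + c (u y) * push P (F' y) u w \<noteq> 0" for v w
        using supp[OF u y(1) nz, of v w] that by fastforce
      show "(\<Sum>v\<in>P. (1 - c (u y)) * push P (F y) u v + c (u y) * push P (F' y) u v) = 1"
        using chain_pointsD(4)[OF p] chain_pointsD(4)[OF p']
        by (simp add: sum.distrib flip: sum_distrib_left)
    qed
  qed (use \<beta>_off \<alpha>P u in auto)
  have c\<beta>: "continuous_on (chain_points P) \<beta>"
  proof (rule continuous_on_coordinatewise_then_product)
    fix w
    have "continuous_on (chain_points P) (\<lambda>u. \<alpha> u w)"
      using \<alpha> by (auto simp: realizes_def dest: continuous_on_product_then_coordinatewise)
    moreover have "continuous_on (chain_points P) (\<lambda>u::'v \<Rightarrow> real. u v)" for v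
      by (rule continuous_on_subset[OF continuous_on_product_coordinates]) simp
    ultimately show "continuous_on (chain_points P) (\<lambda>u. \<beta> u w)"
      unfolding \<beta>_def c_def using step.prems by (intro continuous_intros) auto
  qed
  have e\<alpha>: "eqv N act P \<alpha>"
    using \<alpha> by (simp add: realizes_def)
  have e\<beta>: "eqv N act P \<beta>"
    unfolding eqv_def
  proof (intro ballI)
    fix n u v assume n: "n \<in> N" and u: "u \<in> chain_points P" and v: "v \<in> P"
    let ?u = "push P (act n) u"
    have nu: "?u \<in> chain_points P"
      using action_in_chain_points[OF auts n u] .
    have u_eq: "?u (act n y) = u y" if "y \<in> P" for y
      using push_inj[OF finP poset_autsD(3)[OF auts n] that] .
    show "\<beta> ?u (act n v) = \<beta> u v"
    proof (cases "\<exists>y\<in>A. u y \<noteq> 0")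
      case True
      then obtain y where y: "y \<in> A" "u y \<noteq> 0"
        by auto
      have "y \<in> P"
        using y A_subset by auto
      have ny: "act n y \<in> A" "?u (act n y) \<noteq> 0"
        using A_stable[OF n y(1)] u_eq[OF \<open>y \<in> P\<close>] y by auto
      show ?thesis
        using e\<alpha> n u v push_family(3)[OF F u y n v] push_family(3)[OF F' u y n v]
        by (simp add: \<beta>_at[OF u y] \<beta>_at[OF nu ny] eqv_def u_eq[OF \<open>y \<in> P\<close>])
    next
      case False
      have "?u y = 0" if "y \<in> A" for y
      proof (rule ccontr)
        assume "?u y \<noteq> 0"
        then obtain z where z: "z \<in> P" "u z \<noteq> 0" "act n z = y"
          by (rule push_supportE)
        then show False
          using False \<open>y \<in> A\<close> poset_auts_stable(2)[OF auts A_subset A_stable[OF n] n z(1)] by auto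
      qed
      then show ?thesis
        using False e\<alpha> n u v nu step.prems by (simp add: \<beta>_off eqv_def)
    qed
  qed
  have "homotopic_maps N act P \<alpha> \<beta>"
  proof (rule straight_line_homotopic[OF auts _ c\<beta> \<alpha>P(1) \<beta>P e\<alpha> e\<beta>])
    show "continuous_on (chain_points P) \<alpha>"
      using \<alpha> by (simp add: realizes_def)
    fix u v w assume u: "u \<in> chain_points P" and vw: "\<alpha> u v \<noteq> 0" "\<beta> u w \<noteq> 0"
    from cases[of u] show "v \<le> w \<or> w \<le> v"
    proof
      assume "\<exists>y\<in>A. u y \<ge> \<tau> / 2"
      then obtain y where y: "y \<in> A" "u y \<ge> \<tau> / 2"
        by auto
      have "push P (F y) u w \<noteq> 0 \<or> push P (F' y) u w \<noteq> 0"
        using vw(2) unfolding \<beta>_near[OF u y] by auto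
      then show ?thesis
        using vw(1) supp[OF u y(1) nz[of u y, OF y(2)], of v w] \<alpha>P(4)[OF u y] by simp
    qed (use \<beta>_off[OF u] vw chain_pointsD(3)[OF \<alpha>P(1)[OF u]] in auto)
  qed
  then have h: "homotopic_maps N act P id \<beta>"
    using \<alpha> homotopic_with_trans unfolding realizes_def by blast
  have fixed: "\<beta> u = u" if "u \<in> chain_points P" "\<forall>y\<in>A. u y = 0" for u
    using \<beta>_off[OF that(1)] \<alpha>P(2)[OF that] that step.prems by simp
  have le: "\<beta> u y \<le> u y" if u: "u \<in> chain_points P" and y: "y \<in> A" for u y
    using cases[of u]
  proof
    assume "\<exists>y\<in>A. u y \<ge> \<tau> / 2"
    then obtain y' where y': "y' \<in> A" "u y' \<ge> \<tau> / 2"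
      by auto
    have "(1 - c (u y')) * push P (F y') u y + c (u y') * push P (F' y') u y \<le>
        (1 - c (u y')) * u y + c (u y') * u y"
      using c(1,2) push_family(2)[OF F u y'(1) nz[of u y', OF y'(2)] y] push_family(2)[OF F' u y'(1) nz[of u y', OF y'(2)] y]
      by (intro add_mono mult_left_mono) auto
    then show ?thesis
      by (simp add: \<beta>_near[OF u y'] algebra_simps)
  qed (use \<beta>_off[OF u] \<alpha>P(3)[OF u y] in auto)
  have far: "\<beta> u = push P (F' y) u" if "u \<in> chain_points P" "y \<in> A" "u y \<ge> \<tau>" for u y
    using \<beta>_near[OF that(1,2)] that c(4)[OF that(3)] step.prems by auto
  show ?case
    unfolding realizes_def using c\<beta> e\<beta> h \<beta>P fixed le far by blast
qed

lemma poset_auts_remove: "poset_auts N act (P - A)"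
proof -
  have "bij_betw (act n) (P - A) (P - A)" if n: "n \<in> N" for n
  proof -
    have "act n ` (P - A) = P - A"
      using poset_auts_stable(2)[OF auts A_subset A_stable[OF n] n] poset_autsD(4)[OF auts n]
      by (intro poset_auts_stable(1)[OF auts Diff_subset _ n]) auto
    then show ?thesis
      using inj_on_subset[OF poset_autsD(3)[OF auts n] Diff_subset] by (simp add: bij_betw_def)
  qed
  then show ?thesis
    using poset_autsD[OF auts] unfolding poset_auts_def by auto
qed

proposition remove_antichain:
  assumes F: "connected_families (\<lambda>y z. z) F"
    and out: "\<And>y z. y \<in> A \<Longrightarrow> z \<in> star P y \<Longrightarrow> F y z \<notin> A"
  shows "complexes_equivalent N act P act (P - A)"
proof -
  obtain \<alpha> where \<alpha>: "realizes (1/2) F \<alpha>"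
    \<comment> \<open>Any threshold strictly between 0 and 1 would leave positive weight outside
      \<open>A\<close>.\<close>
    using realizes_exists[OF F, of "1/2"] by auto
  let ?Q = "P - A"
  have finQ: "finite ?Q"
    using finP by simp
  have \<alpha>P: "\<alpha> u \<in> chain_points P" "(\<forall>y\<in>A. u y = 0) \<Longrightarrow> \<alpha> u = u" "y \<in> A \<Longrightarrow> \<alpha> u y \<le> u y"
    "y \<in> A \<Longrightarrow> u y \<ge> 1/2 \<Longrightarrow> \<alpha> u = push P (F y) u" if "u \<in> chain_points P" for u y
    using \<alpha> that by (auto simp: realizes_def)
  have small: "\<alpha> u y \<le> 1/2" if u: "u \<in> chain_points P" and y: "y \<in> A" for u y
  proof (cases "u y \<ge> 1/2")
    case True
    have "push P (F y) u y = 0"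
    proof (rule ccontr)
      assume "push P (F y) u y \<noteq> 0"
      then obtain z where "z \<in> P" "u z \<noteq> 0" "F y z = y"
        by (rule push_supportE)
      then show False
        using out[OF y chain_points_star[OF u, of y z]] True y by auto
    qed
    then show ?thesis
      using \<alpha>P(4)[OF u y True] by simp
  qed (use \<alpha>P(3)[OF u y] in auto)
  define m where "m = (\<lambda>u. sum (\<alpha> u) ?Q)"
  have m: "m u \<ge> 1/2" if u: "u \<in> chain_points P" for u
  proof -
    have "sum (\<alpha> u) A \<le> 1/2"
    proof (cases "\<exists>y\<in>A. \<alpha> u y \<noteq> 0")
      case True
      then obtain y where y: "y \<in> A" "\<alpha> u y \<noteq> 0"
        by auto
      have "\<alpha> u y' = 0" if "y' \<in> A - {y}" for y'
        using A_unique[OF y(1)] chain_points_star[OF \<alpha>P(1)[OF u] y(2)] that by auto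
      then have "sum (\<alpha> u) A = sum (\<alpha> u) {y}"
        using y finA by (intro sum.mono_neutral_right) auto
      then show ?thesis
        using small[OF u y(1)] by simp
    qed (use sum.neutral[of A "\<alpha> u"] in auto)
    moreover have "sum (\<alpha> u) P = m u + sum (\<alpha> u) A"
      unfolding m_def using A_subset finP by (rule sum.subset_diff)
    ultimately show ?thesis
      using chain_pointsD(4)[OF \<alpha>P(1)[OF u]] by simp
  qed
  define \<rho> where "\<rho> = (\<lambda>u v. if v \<in> ?Q then \<alpha> u v / m u else 0)"
  have \<rho>Q: "\<rho> u \<in> chain_points ?Q" if u: "u \<in> chain_points P" for u
    unfolding chain_points_def
  proof (intro CollectI conjI allI impI)
    have mu: "m u > 0"
      using m[OF u] by simp
    show "0 \<le> \<rho> u v" for v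
      using mu chain_pointsD(1)[OF \<alpha>P(1)[OF u]] by (simp add: \<rho>_def)
    show "v \<in> ?Q" if "\<rho> u v \<noteq> 0" for v
      using that by (auto simp: \<rho>_def split: if_splits)
    show "v \<le> w \<or> w \<le> v" if "\<rho> u v \<noteq> 0 \<and> \<rho> u w \<noteq> 0" for v w
      using that chain_pointsD(3)[OF \<alpha>P(1)[OF u]] by (auto simp: \<rho>_def split: if_splits)
    show "sum (\<rho> u) ?Q = 1"
      using mu by (simp add: \<rho>_def m_def flip: sum_divide_distrib)
  qed
  have QP: "chain_points ?Q \<subseteq> chain_points P"
    using chain_points_mono[of ?Q P] finP by auto
  have fixQ: "\<rho> u = u" if u: "u \<in> chain_points ?Q" for u
  proof -
    have "\<alpha> u = u"
      using u QP chain_pointsD(2)[OF u] by (intro \<alpha>P(2)) auto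
    then show ?thesis
      using chain_pointsD(2,4)[OF u] by (auto simp: \<rho>_def m_def fun_eq_iff)
  qed
  have c\<rho>: "continuous_on (chain_points P) \<rho>"
  proof (rule continuous_on_coordinatewise_then_product)
    fix w
    have "continuous_on (chain_points P) (\<lambda>u. \<alpha> u v)" for v
      using \<alpha> by (auto simp: realizes_def dest: continuous_on_product_then_coordinatewise)
    then have *: "continuous_on (chain_points P) m"
      and **: "continuous_on (chain_points P) (\<lambda>u. \<alpha> u w)"
      unfolding m_def by (auto intro: continuous_on_sum)
    have "m u \<noteq> 0" if "u \<in> chain_points P" for u
      using m[OF that] by auto
    then have "continuous_on (chain_points P) (\<lambda>u. \<alpha> u w / m u)"
      using * ** by (intro continuous_on_divide) auto
    then show "continuous_on (chain_points P) (\<lambda>u. \<rho> u w)"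
      by (cases "w \<in> ?Q") (auto simp: \<rho>_def cong: if_cong)
  qed
  have e\<alpha>: "eqv N act P \<alpha>"
    using \<alpha> by (simp add: realizes_def)
  have actQ: "act n v \<in> ?Q \<longleftrightarrow> v \<in> ?Q" if "n \<in> N" "v \<in> P" for n v
    using poset_auts_stable(2)[OF auts A_subset A_stable[OF that(1)] that]
      poset_autsD(4)[OF auts that] that(2) by simp
  have e\<rho>: "eqv N act P \<rho>"
    unfolding eqv_def
  proof (intro ballI)
    fix n u v assume nuv: "n \<in> N" "u \<in> chain_points P" "v \<in> P"
    have "m (push P (act n) u) = (\<Sum>v\<in>?Q. \<alpha> (push P (act n) u) (act n v))"
      unfolding m_def
      using sum.reindex_bij_betw[OF poset_autsD(2)[OF poset_auts_remove nuv(1)], symmetric] .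
    also have "\<dots> = m u"
      unfolding m_def using e\<alpha> nuv by (intro sum.cong) (auto simp: eqv_def)
    finally show "\<rho> (push P (act n) u) (act n v) = \<rho> u v"
      using e\<alpha> nuv actQ[OF nuv(1,3)] by (simp add: \<rho>_def eqv_def)
  qed
  have \<rho>P: "\<rho> u \<in> chain_points P" if "u \<in> chain_points P" for u
    using \<rho>Q[OF that] QP by auto
  \<comment> \<open>Dropping coordinates does not enlarge the support, so the straight line from
    \<alpha> to \<rho> stays within a simplex.\<close>
  have "homotopic_maps N act P \<alpha> \<rho>"
    by (rule straight_line_homotopic[OF auts _ c\<rho> \<alpha>P(1) \<rho>P e\<alpha> e\<rho>])
       (use \<alpha> in \<open>auto simp: realizes_def \<rho>_def split: if_splits dest: chain_pointsD(3)[OF \<alpha>P(1)]\<close>)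
  then have h: "homotopic_maps N act P id \<rho>"
    using \<alpha> homotopic_with_trans unfolding realizes_def by blast
  have act_eq: "realization_map (act n) u = push P (act n) u" if "u \<in> chain_points ?Q" for n u
    using realization_map_eq_push[OF finP] QP that by auto
  have actQP: "push P (act n) u \<in> chain_points ?Q" if "n \<in> N" "u \<in> chain_points ?Q" for n u
    using action_in_chain_points[OF poset_auts_remove that]
      realization_map_eq_push[OF finQ that(2)] act_eq[OF that(2)] by metis
  have eqm: "equivariant_self_map N act P \<rho>"
    using eqv_iff[OF auts, of \<rho>] e\<rho> \<rho>P by blast
  show ?thesis
    unfolding equivariant_homotopy_equivalent_def
  proof (rule exI[of _ \<rho>], rule exI[of _ id], intro conjI)
    show "homotopic_maps N act P (id \<circ> \<rho>) id"
      using h homotopic_with_symD by simp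
    have "equivariant_self_map N act ?Q \<rho>"
      using fixQ act_eq actQP by (simp add: equivariant_map_def realization_order_complex finQ)
    then show "homotopic_maps N act ?Q (\<rho> \<circ> id) id"
      using continuous_on_subset[OF c\<rho> QP] fixQ
      by (intro homotopic_with_equal) (auto simp: realization_order_complex finQ equivariant_map_def)
    show "equivariant_self_map N act ?Q id"
      by (simp add: equivariant_map_def)
    show "continuous_map (realization (order_complex ?Q)) (realization (order_complex P)) id"
      using QP by (auto simp: realization_order_complex finP)
    show "continuous_map (realization (order_complex P)) (realization (order_complex ?Q)) \<rho>"
      using c\<rho> \<rho>Q by (auto simp: realization_order_complex finP)
    show "equivariant_self_map N act P \<rho>"
      using eqm .
  qed
qed

lemma contiguous_sym: "contiguous F F' \<Longrightarrow> contiguous F' F"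
  unfolding contiguous_def by blast

lemma connected_families_sym: "connected_families F F' \<Longrightarrow> connected_families F' F"
  unfolding connected_families_def
proof (induction rule: rtranclp_induct)
  case (step F' F'')
  then show ?case
    using contiguous_sym by (intro converse_rtranclp_into_rtranclp[of _ F'' F']) auto
qed simp

lemma connected_families_trans:
  "connected_families F F' \<Longrightarrow> connected_families F' F'' \<Longrightarrow> connected_families F F''"
  unfolding connected_families_def by (rule rtranclp_trans)

text \<open>All that matters is a strictly monotone function to the naturals that is invariant under
  the action; counting strict predecessors is a canonical one.\<close>

definition rank :: "'v \<Rightarrow> nat" where
  "rank z = card {w \<in> P. w < z}"

lemma rank_less: "z \<in> P \<Longrightarrow> z < w \<Longrightarrow> rank z < rank w"
  unfolding rank_def using finP by (intro psubset_card_mono) auto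

lemma rank_action:
  assumes "n \<in> N" "z \<in> P"
  shows "rank (act n z) = rank z"
proof -
  have "{w \<in> P. w < act n z} = act n ` {w \<in> P. w < z}"
  proof (intro equalityI subsetI)
    fix w assume w: "w \<in> {w \<in> P. w < act n z}"
    then obtain v where "v \<in> P" "w = act n v"
      using poset_autsD(2)[OF auts assms(1)] by (auto simp: bij_betw_def)
    then show "w \<in> act n ` {w \<in> P. w < z}"
      using w poset_autsD(6)[OF auts assms(1)] assms(2) by auto
  qed (use poset_autsD(4,6)[OF auts assms(1)] assms(2) in auto)
  moreover have "inj_on (act n) {w \<in> P. w < z}"
    using poset_autsD(3)[OF auts assms(1)] by (rule inj_on_subset) auto
  ultimately show ?thesis
    by (simp add: rank_def card_image)
qed

text \<open>Switching from \<open>F\<close> to \<open>F'\<close> one rank at a time, from the top, keeps the union of the images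
  of a chain a chain.\<close>

lemma connected_families_le:
  assumes adm: "admissible F" "admissible F'"
    and mono: "\<And>y z w. y \<in> A \<Longrightarrow> z \<in> star P y \<Longrightarrow> w \<in> star P y \<Longrightarrow> z \<le> w \<Longrightarrow> F y z \<le> F y w"
      "\<And>y z w. y \<in> A \<Longrightarrow> z \<in> star P y \<Longrightarrow> w \<in> star P y \<Longrightarrow> z \<le> w \<Longrightarrow> F' y z \<le> F' y w"
    and le: "\<And>y z. y \<in> A \<Longrightarrow> z \<in> star P y \<Longrightarrow> F y z \<le> F' y z"
  shows "connected_families F F'"
proof -
  \<comment> \<open>\<open>k\<close> is the threshold from which vertices have been switched:
    \<open>H 0\<close> is \<open>F'\<close>, and \<open>H (Suc (card P))\<close> is \<open>F\<close>
    because ranks are at most \<open>card P\<close>.\<close>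
  define H where "H = (\<lambda>k y z. if k \<le> rank z then F' y z else F y z)"
  have starP: "z \<in> P" if "z \<in> star P y" for z y
    using that by (auto simp: star_def)
  have adm_H: "admissible (H k)" for k
    using adm rank_action starP unfolding admissible_def H_def by simp
  \<comment> \<open>The only harmful pair is z < w with \<open>F'\<close> applied to z and
    \<open>F\<close> to w. It would need thresholds at least two apart, hence the restriction to
    equal or neighbouring ones.\<close>
  have cont: "contiguous (H i) (H j)" if "i \<le> Suc j" "j \<le> Suc i" for i j
    unfolding contiguous_def
  proof (intro ballI impI)
    fix y z w assume y: "y \<in> A" and z: "z \<in> star P y" and w: "w \<in> star P y" and "z \<le> w \<or> w \<le> z"
    then consider "z = w" | "z < w" | "w < z"
      by fastforce
    then show "H i y z \<le> H j y w \<or> H j y w \<le> H i y z"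
    proof cases
      case 1
      then show ?thesis
        using le[OF y z] by (auto simp: H_def)
    next
      case 2
      then have "rank z < rank w" "F y z \<le> F y w" "F' y z \<le> F' y w"
        using rank_less starP[OF z] mono[OF y z w] by auto
      then show ?thesis
        using le[OF y w] that by (auto simp: H_def intro: order_trans)
    next
      case 3
      then have "rank w < rank z" "F y w \<le> F y z" "F' y w \<le> F' y z"
        using rank_less starP[OF w] mono[OF y w z] by auto
      then show ?thesis
        using le[OF y z] that by (auto simp: H_def intro: order_trans)
    qed
  qed
  have conn: "connected_families (H k) (H 0)" for k
  proof (induction k)
    case 0
    then show ?case
      by (simp add: connected_families_def)
  next
    case (Suc k)
    then show ?case
      unfolding connected_families_def
      by (intro converse_rtranclp_into_rtranclp[of _ "H (Suc k)" "H k"]) (auto simp: adm_H cont)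
  qed
  have "rank z \<le> card P" for z
    unfolding rank_def using finP by (simp add: card_mono)
  then have "\<not> Suc (card P) \<le> rank z" for z
    by (simp add: not_less_eq_eq)
  then have "H (Suc (card P)) = F"
    by (simp add: H_def)
  moreover have "H 0 = F'"
    by (simp add: H_def)
  ultimately show ?thesis
    using conn[of "Suc (card P)"] by simp
qed

end


section \<open>Subposets with the same equivariant homotopy type\<close>

lemma equivariant_homotopy_equivalent_refl: "equivariant_homotopy_equivalent N a Y a Y"
  unfolding equivariant_homotopy_equivalent_def
  by (rule exI[of _ id], rule exI[of _ id]) (simp add: equivariant_map_def)

text \<open>Taking the minimal elements of \<open>P' - Q\<close> first leaves two facts at every
  stage, one for each of the two uses below: whatever lies in \<open>P\<close> above a remaining
  element is still in \<open>P'\<close>, and whatever lies in \<open>P'\<close> below a removed one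
  is in \<open>Q\<close>.\<close>

lemma remove_minimal_elements:
  fixes act :: "'g \<Rightarrow> 'v::order \<Rightarrow> 'v"
  assumes "poset_auts N act P" "Q \<subseteq> P" "\<And>n y. n \<in> N \<Longrightarrow> y \<in> Q \<Longrightarrow> act n y \<in> Q"
    and "\<And>P' A. \<lbrakk>antichain_removal N act P' A; Q \<subseteq> P'; P' \<subseteq> P; A \<subseteq> P' - Q;
          \<And>y w. y \<in> P' - Q \<Longrightarrow> w \<in> P \<Longrightarrow> y < w \<Longrightarrow> w \<in> P';
          \<And>y w. y \<in> A \<Longrightarrow> w \<in> P' \<Longrightarrow> w < y \<Longrightarrow> w \<in> Q\<rbrakk>
        \<Longrightarrow> complexes_equivalent N act P' act (P' - A)"
  shows "complexes_equivalent N act P act Q"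
proof -
  have "complexes_equivalent N act P' act Q"
    if "poset_auts N act P'" "Q \<subseteq> P'" "P' \<subseteq> P" "\<And>y w. y \<in> P' - Q \<Longrightarrow> w \<in> P \<Longrightarrow> y < w \<Longrightarrow> w \<in> P'"
    for P'
    using that
  proof (induction "card (P' - Q)" arbitrary: P' rule: less_induct)
    case less
    note finP' = poset_autsD(1)[OF less.prems(1)]
    show ?case
    proof (cases "P' = Q")
      case True
      then show ?thesis
        by (simp add: equivariant_homotopy_equivalent_refl)
    next
      case False
      define A where "A = {y \<in> P' - Q. \<forall>w\<in>P' - Q. \<not> w < y}"
      interpret antichain_removal N act P' A
      proof
        show "poset_auts N act P'" "A \<subseteq> P'"
          using less.prems(1) by (auto simp: A_def)
        show "y = z" if "y \<in> A" "z \<in> A" "y \<le> z" for y z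
          using that by (auto simp: A_def order.order_iff_strict)
        show "act n y \<in> A" if n: "n \<in> N" and y: "y \<in> A" for n y
        proof -
          have Q_iff: "act n v \<in> Q \<longleftrightarrow> v \<in> Q" if "v \<in> P'" for v
            using poset_auts_stable(2)[OF less.prems(1,2) assms(3)[OF n] n that] .
          have "\<not> w < act n y" if w: "w \<in> P' - Q" for w
          proof
            assume "w < act n y"
            obtain v where v: "v \<in> P'" "w = act n v"
              using w poset_autsD(2)[OF less.prems(1) n] by (auto simp: bij_betw_def)
            then have "v \<in> P' - Q" "v < y"
              using w Q_iff \<open>w < act n y\<close> poset_autsD(6)[OF less.prems(1) n v(1)] y
              by (auto simp: A_def)
            then show False
              using y by (auto simp: A_def)
          qed
          then show ?thesis
            using y Q_iff poset_autsD(4)[OF less.prems(1) n] by (auto simp: A_def)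
        qed
      qed
      have "A \<noteq> {}"
      proof -
        have "finite (P' - Q)" "P' - Q \<noteq> {}"
          using False less.prems(2) finP' by auto
        then obtain y where "y \<in> P' - Q" "\<And>w. w \<in> P' - Q \<Longrightarrow> w \<le> y \<Longrightarrow> y = w"
          using finite_has_minimal[of "P' - Q"] by metis
        then show ?thesis
          unfolding A_def by fastforce
      qed
      moreover have sub: "A \<subseteq> P' - Q"
        by (auto simp: A_def)
      ultimately have "(P' - A) - Q \<subset> P' - Q"
        by blast
      then have "card ((P' - A) - Q) < card (P' - Q)"
        using finP' by (intro psubset_card_mono) auto
      then have "complexes_equivalent N act (P' - A) act Q"
      proof (rule less.hyps)
        show "poset_auts N act (P' - A)"
          by (rule poset_auts_remove)
        show "Q \<subseteq> P' - A" "P' - A \<subseteq> P"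
          using sub less.prems(2,3) by auto
        show "w \<in> P' - A" if "y \<in> P' - A - Q" "w \<in> P" "y < w" for y w
          using that less.prems(4)[of y w] by (auto simp: A_def)
      qed
      moreover have "complexes_equivalent N act P' act (P' - A)"
        using less.prems sub antichain_removal_axioms
        by (intro assms(4)) (auto simp: A_def)
      ultimately show ?thesis
        by (meson equivariant_homotopy_equivalent_trans)
    qed
  qed
  then show ?thesis
    using assms(1,2) by blast
qed

text \<open>When \<open>y\<close> is minimal outside \<open>Q\<close>, everything strictly below it
  is in \<open>Q\<close>, hence fixed by \<open>r\<close> and below \<open>r y\<close>. So
  \<open>r y\<close> is the greatest element under \<open>y\<close>, and \<open>y\<close> can slide
  down to it while all other vertices stay put.\<close>

proposition complexes_equivalent_retract:
  fixes act :: "'g \<Rightarrow> 'v::order \<Rightarrow> 'v"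
  assumes P: "poset_auts N act P" and Q: "Q \<subseteq> P" "\<And>n y. n \<in> N \<Longrightarrow> y \<in> Q \<Longrightarrow> act n y \<in> Q"
    and r: "\<And>y. y \<in> P \<Longrightarrow> r y \<in> Q" "\<And>y. y \<in> P \<Longrightarrow> r y \<le> y" "\<And>y. y \<in> Q \<Longrightarrow> r y = y"
      "\<And>y z. y \<in> P \<Longrightarrow> z \<in> P \<Longrightarrow> y \<le> z \<Longrightarrow> r y \<le> r z"
      "\<And>n y. n \<in> N \<Longrightarrow> y \<in> P \<Longrightarrow> r (act n y) = act n (r y)"
  shows "complexes_equivalent N act P act Q"
proof (rule remove_minimal_elements[OF P Q])
  fix P' A
  assume rem: "antichain_removal N act P' A" and P': "Q \<subseteq> P'" "P' \<subseteq> P" and A: "A \<subseteq> P' - Q"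
    and min: "\<And>y w. y \<in> A \<Longrightarrow> w \<in> P' \<Longrightarrow> w < y \<Longrightarrow> w \<in> Q"
  interpret antichain_removal N act P' A
    by (rule rem)
  have below: "r y < y" "\<And>z. z \<in> P' \<Longrightarrow> z < y \<Longrightarrow> z \<le> r y" if "y \<in> A" for y
  proof -
    have "y \<in> P" "y \<notin> Q"
      using that A P' by auto
    then show "r y < y"
      using r(1,2)[of y] by (auto simp: order.order_iff_strict)
    show "z \<le> r y" if "z \<in> P'" "z < y" for z
      using min[OF \<open>y \<in> A\<close> that] r(3)[of z] r(4)[of z y] that P' \<open>y \<in> P\<close> by auto
  qed
  define F where "F = (\<lambda>y z. if z = y then r y else z)"
  have F_out: "F y z \<in> A \<longrightarrow> z \<in> A \<and> F y z = z" if "y \<in> A" "z \<in> P'" for y z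
    using that A r(1)[of y] P' by (auto simp: F_def)
  have F_eqv: "F (act n y) (act n z) = act n (F y z)" if "n \<in> N" "y \<in> A" "z \<in> P'" for n y z
    using that A P' r(5)[OF that(1)] inj_on_eq_iff[OF poset_autsD(3)[OF auts that(1)]]
    by (auto simp: F_def)
  have adm: "admissible F"
    unfolding admissible_def
  proof (intro ballI conjI)
    fix y z assume y: "y \<in> A" and "z \<in> star P' y"
    then have z: "z \<in> P'"
      by (auto simp: star_def)
    have "r y \<in> P'"
      using r(1)[of y] y A P' by auto
    then show "F y z \<in> P'"
      using z by (simp add: F_def)
    show "F y z \<in> A \<longrightarrow> F y z = z"
      using F_out[OF y z] by blast
    show "F (act n y) (act n z) = act n (F y z)" if "n \<in> N" for n
      using F_eqv[OF that y z] .
  qed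
  have adm_id: "admissible (\<lambda>y z. z)"
    unfolding admissible_def by (auto simp: star_def)
  have "connected_families F (\<lambda>y z. z)"
  proof (rule connected_families_le[OF adm adm_id])
    fix y z w assume y: "y \<in> A" and z: "z \<in> star P' y" and w: "w \<in> star P' y" and "z \<le> w"
    then show "F y z \<le> F y w"
      using below[OF y] by (auto simp: F_def star_def order.order_iff_strict)
  next
    fix y z assume "y \<in> A"
    then show "F y z \<le> z"
      using below by (auto simp: F_def intro: less_imp_le)
  qed
  then have "connected_families (\<lambda>y z. z) F"
    by (rule connected_families_sym)
  moreover have "F y z \<notin> A" if "y \<in> A" "z \<in> star P' y" for y z
  proof
    assume "F y z \<in> A"
    then have "z \<in> A" "F y z = z"
      using F_out[OF that(1)] that(2) by (auto simp: star_def)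
    then have "z = y"
      using A_unique[OF that(1) \<open>z \<in> A\<close> that(2)] by simp
    then show False
      using \<open>F y z = z\<close> below(1)[OF that(1)] by (simp add: F_def)
  qed
  ultimately show "complexes_equivalent N act P' act (P' - A)"
    by (rule remove_antichain)
qed

text \<open>An equivariant form of Quillen's fibre lemma for the inclusion of \<open>Q\<close> in \<open>P\<close>.\<close>

proposition complexes_equivalent_conical:
  fixes act :: "'g \<Rightarrow> 'v::order \<Rightarrow> 'v"
  assumes P: "poset_auts N act P" and Q: "Q \<subseteq> P" "\<And>n y. n \<in> N \<Longrightarrow> y \<in> Q \<Longrightarrow> act n y \<in> Q"
    and c: "\<And>y. y \<in> P - Q \<Longrightarrow> c y \<in> P" "\<And>y. y \<in> P - Q \<Longrightarrow> y < c y"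
    and f: "\<And>y z. y \<in> P - Q \<Longrightarrow> z \<in> P \<Longrightarrow> y < z \<Longrightarrow> f y z \<in> P"
      "\<And>y z. y \<in> P - Q \<Longrightarrow> z \<in> P \<Longrightarrow> y < z \<Longrightarrow> y < f y z"
      "\<And>y z. y \<in> P - Q \<Longrightarrow> z \<in> P \<Longrightarrow> y < z \<Longrightarrow> f y z \<le> z"
    and g: "\<And>y z. y \<in> P - Q \<Longrightarrow> z \<in> P \<Longrightarrow> y < z \<Longrightarrow> g y z \<in> P"
      "\<And>y z. y \<in> P - Q \<Longrightarrow> z \<in> P \<Longrightarrow> y < z \<Longrightarrow> f y z \<le> g y z"
      "\<And>y z. y \<in> P - Q \<Longrightarrow> z \<in> P \<Longrightarrow> y < z \<Longrightarrow> c y \<le> g y z"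
    and mono: "\<And>y z w. y \<in> P - Q \<Longrightarrow> z \<in> P \<Longrightarrow> w \<in> P \<Longrightarrow> y < z \<Longrightarrow> z \<le> w \<Longrightarrow> f y z \<le> f y w"
      "\<And>y z w. y \<in> P - Q \<Longrightarrow> z \<in> P \<Longrightarrow> w \<in> P \<Longrightarrow> y < z \<Longrightarrow> z \<le> w \<Longrightarrow> g y z \<le> g y w"
    and eqv: "\<And>n y. n \<in> N \<Longrightarrow> y \<in> P - Q \<Longrightarrow> c (act n y) = act n (c y)"
      "\<And>n y z. n \<in> N \<Longrightarrow> y \<in> P - Q \<Longrightarrow> z \<in> P \<Longrightarrow> y < z \<Longrightarrow> f (act n y) (act n z) = act n (f y z)"
      "\<And>n y z. n \<in> N \<Longrightarrow> y \<in> P - Q \<Longrightarrow> z \<in> P \<Longrightarrow> y < z \<Longrightarrow> g (act n y) (act n z) = act n (g y z)"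
  shows "complexes_equivalent N act P act Q"
proof (rule remove_minimal_elements[OF P Q])
  fix P' A
  assume rem: "antichain_removal N act P' A" and P': "Q \<subseteq> P'" "P' \<subseteq> P" and A: "A \<subseteq> P' - Q"
    and up: "\<And>y w. y \<in> P' - Q \<Longrightarrow> w \<in> P \<Longrightarrow> y < w \<Longrightarrow> w \<in> P'"
  interpret antichain_removal N act P' A
    by (rule rem)
  have APQ: "y \<in> P - Q" "y \<in> P' - Q" if "y \<in> A" for y
    using that A P' by auto
  \<comment> \<open>Only vertices strictly above \<open>y\<close> are moved; \<open>y\<close> and
    everything below remain, and stay below the images because \<open>h\<close> has values above
    \<open>y\<close>.\<close>
  define F where "F = (\<lambda>(h :: 'v \<Rightarrow> 'v \<Rightarrow> 'v) y z. if y < z then h y z else z)"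
  have out: "w \<in> P' - A" if "y \<in> A" "w \<in> P" "y < w" for y w
    using up[OF APQ(2)[OF that(1)] that(2,3)] antichain[OF that(1) _ less_imp_le[OF that(3)]] that(3)
    by blast
  have adm: "admissible (F h)"
    if h: "\<And>y z. y \<in> A \<Longrightarrow> z \<in> P \<Longrightarrow> y < z \<Longrightarrow> h y z \<in> P \<and> y < h y z"
      and e: "\<And>n y z. n \<in> N \<Longrightarrow> y \<in> A \<Longrightarrow> z \<in> P \<Longrightarrow> y < z \<Longrightarrow> h (act n y) (act n z) = act n (h y z)"
    for h
    unfolding admissible_def
  proof (intro ballI conjI impI)
    fix y z assume y: "y \<in> A" and "z \<in> star P' y"
    then have z: "z \<in> P'" "z \<in> P"
      using P' by (auto simp: star_def)
    have *: "y < z \<Longrightarrow> F h y z \<in> P' - A"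
      using h[OF y z(2)] out[OF y] by (auto simp: F_def)
    then show "F h y z \<in> P'"
      using z by (cases "y < z") (auto simp: F_def)
    show "F h y z = z" if "F h y z \<in> A"
      using that * by (cases "y < z") (auto simp: F_def)
    fix n assume n: "n \<in> N"
    show "F h (act n y) (act n z) = act n (F h y z)"
      using poset_autsD(6)[OF auts n, of y z] e[OF n y z(2)] z y A by (auto simp: F_def)
  qed
  have mono_F: "F h y z \<le> F h y w"
    if h: "\<And>z. z \<in> P \<Longrightarrow> y < z \<Longrightarrow> y < h y z"
      and m: "\<And>z w. z \<in> P \<Longrightarrow> w \<in> P \<Longrightarrow> y < z \<Longrightarrow> z \<le> w \<Longrightarrow> h y z \<le> h y w"
      and "y \<in> A" "z \<in> star P' y" "w \<in> star P' y" "z \<le> w" for h y z w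
  proof -
    have "z \<in> P" "w \<in> P" "z \<le> y \<or> y < z"
      using that P' by (auto simp: star_def order.order_iff_strict)
    then consider "y < z" "y < w" | "z \<le> y" "\<not> y < z" "y < w" | "\<not> y < z" "\<not> y < w"
      using \<open>z \<le> w\<close> by (auto dest: order.strict_trans2)
    then show ?thesis
    proof cases
      case 2
      then have "z \<le> h y w"
        using h[OF \<open>w \<in> P\<close>] by (meson order.trans less_imp_le)
      then show ?thesis
        using 2 by (simp add: F_def)
    qed (use m \<open>z \<in> P\<close> \<open>w \<in> P\<close> \<open>z \<le> w\<close> in \<open>simp_all add: F_def\<close>)
  qed
  let ?c = "\<lambda>y z. c y" and ?id = "\<lambda>y z. z"
  \<comment> \<open>The only family in the sequence that moves \<open>y\<close> itself: by then the
    strict upper part has been collected at \<open>c y\<close>, and \<open>y\<close> can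
    follow.\<close>
  define F_c where "F_c = (\<lambda>y z. if y \<le> z then c y else z)"
  have gt: "y < f y z" "y < g y z" "y < c y" if "y \<in> A" "z \<in> P" "y < z" for y z
    using less_le_trans[OF f(2) g(2)] f(2) c(2) APQ(1)[OF that(1)] that by auto
  have adms: "admissible (F f)" "admissible (F g)" "admissible (F ?c)" "admissible (F ?id)"
    using f(1) g(1) c(1) gt APQ(1) eqv by (auto intro!: adm)
  have F_id: "F ?id = (\<lambda>y z. z)"
    by (auto simp: F_def fun_eq_iff)
  have adm_c: "admissible F_c"
    unfolding admissible_def
  proof (intro ballI conjI impI)
    fix y z assume y: "y \<in> A" and "z \<in> star P' y"
    then have z: "z \<in> P'"
      by (auto simp: star_def)
    have *: "c y \<in> P' - A"
      using c[OF APQ(1)[OF y]] out[OF y] by auto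
    then show "F_c y z \<in> P'" "F_c y z \<in> A \<Longrightarrow> F_c y z = z"
      using z by (auto simp: F_c_def split: if_splits)
    fix n assume n: "n \<in> N"
    show "F_c (act n y) (act n z) = act n (F_c y z)"
      using poset_autsD(5)[OF auts n, of y z] eqv(1)[OF n APQ(1)[OF y]] z y A by (auto simp: F_c_def)
  qed
  have mono_all: "F h y z \<le> F h y w"
    if "h = f \<or> h = g \<or> h = ?c \<or> h = ?id" "y \<in> A" "z \<in> star P' y" "w \<in> star P' y" "z \<le> w" for h y z w
    using mono_F[OF _ _ that(2-5), of h] mono APQ(1)[OF that(2)] gt[OF that(2)] that(1) by auto
  have starP: "z \<in> P" if "z \<in> star P' y" for y z
    using that P' by (auto simp: star_def)
  \<comment> \<open>The four comparisons realize z \<ge> \<open>f y z\<close> \<le>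
    \<open>g y z\<close> \<ge> \<open>c y\<close> above \<open>y\<close>, followed by sliding
    \<open>y\<close> up to \<open>c y\<close>.\<close>
  have 1: "connected_families (F f) (F ?id)"
    using f(3) APQ(1) starP by (intro connected_families_le adms mono_all) (auto simp: F_def)
  have 2: "connected_families (F f) (F g)"
    using g(2) APQ(1) starP by (intro connected_families_le adms mono_all) (auto simp: F_def)
  have 3: "connected_families (F ?c) (F g)"
    using g(3) APQ(1) starP by (intro connected_families_le adms mono_all) (auto simp: F_def)
  have 4: "connected_families (F ?c) F_c"
  proof (rule connected_families_le[OF adms(3) adm_c])
    show "F ?c y z \<le> F ?c y w" if "y \<in> A" "z \<in> star P' y" "w \<in> star P' y" "z \<le> w" for y z w
      using mono_all[OF _ that] by blast
    show "F_c y z \<le> F_c y w" if y: "y \<in> A" and zw: "z \<in> star P' y" "w \<in> star P' y" "z \<le> w" for y z w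
      using c(2)[OF APQ(1)[OF y]] zw by (auto simp: F_c_def star_def intro: order.trans less_imp_le)
    show "F ?c y z \<le> F_c y z" if "y \<in> A" for y z
      using c(2)[OF APQ(1)[OF that]] by (auto simp: F_def F_c_def order.order_iff_strict)
  qed
  have "connected_families (\<lambda>y z. z) F_c"
    using 1 2 3 4 connected_families_sym connected_families_trans unfolding F_id by meson
  moreover have "F_c y z \<notin> A" if y: "y \<in> A" and z: "z \<in> star P' y" for y z
  proof (cases "y \<le> z")
    case True
    then show ?thesis
      using c[OF APQ(1)[OF y]] out[OF y] by (auto simp: F_c_def)
  next
    case False
    then show ?thesis
      using A_unique[OF y _ z] by (auto simp: F_c_def)
  qed
  ultimately show "complexes_equivalent N act P' act (P' - A)"
    by (rule remove_antichain)
qed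

section \<open>Isomorphic posets with actions\<close>

lemma push_push:
  assumes "finite P" "finite Q" "\<And>v. v \<in> P \<Longrightarrow> f v \<in> Q"
  shows "push Q g (push P f x) = push P (\<lambda>v. g (f v)) x"
proof
  fix w
  have "push Q g (push P f x) w = (\<Sum>u\<in>Q. \<Sum>v\<in>P. if g u = w then if f v = u then x v else 0 else 0)"
    unfolding push_def by (intro sum.cong) auto
  also have "\<dots> = (\<Sum>v\<in>P. \<Sum>u\<in>Q. if g u = w then if f v = u then x v else 0 else 0)"
    by (rule sum.swap)
  also have "\<dots> = push P (\<lambda>v. g (f v)) x w"
    unfolding push_def
  proof (intro sum.cong refl)
    fix v assume v: "v \<in> P"
    have "(\<Sum>u\<in>Q. if g u = w then if f v = u then x v else 0 else 0) =
        (\<Sum>u\<in>Q. if f v = u then if g (f v) = w then x v else 0 else 0)"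
      by (intro sum.cong) auto
    then show "(\<Sum>u\<in>Q. if g u = w then if f v = u then x v else 0 else 0) = (if g (f v) = w then x v else 0)"
      using assms(2) assms(3)[OF v] by simp
  qed
  finally show "push Q g (push P f x) w = push P (\<lambda>v. g (f v)) x w" .
qed

text \<open>Needed for the one change of vertex type, from subgroups of \<open>G\<close> to sets of
  cosets. The two vertex maps are mutually inverse, so both homotopies are constant.\<close>

proposition complexes_equivalent_iso:
  fixes a :: "'g \<Rightarrow> 'v::order \<Rightarrow> 'v" and b :: "'g \<Rightarrow> 'w::order \<Rightarrow> 'w"
  assumes P: "poset_auts N a P" and \<phi>: "bij_betw \<phi> P Q"
    "\<And>x y. x \<in> P \<Longrightarrow> y \<in> P \<Longrightarrow> \<phi> x \<le> \<phi> y \<longleftrightarrow> x \<le> y"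
    "\<And>n x. n \<in> N \<Longrightarrow> x \<in> P \<Longrightarrow> \<phi> (a n x) = b n (\<phi> x)"
  shows "complexes_equivalent N a P b Q"
proof -
  note fin = poset_autsD(1)[OF P]
  have finQ: "finite Q" and inj: "inj_on \<phi> P" and im: "\<phi> ` P = Q"
    using \<phi>(1) fin bij_betw_finite[OF \<phi>(1)] by (simp_all add: bij_betw_def)
  define \<psi> where "\<psi> = inv_into P \<phi>"
  have \<psi>: "\<psi> (\<phi> v) = v" if "v \<in> P" for v
    unfolding \<psi>_def using inj that by simp
  have \<psi>': "\<phi> (\<psi> w) = w" "\<psi> w \<in> P" if "w \<in> Q" for w
    using that \<psi> im by auto
  have \<psi>_eqv: "\<psi> (b n w) = a n (\<psi> w)" if "n \<in> N" "w \<in> Q" for n w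
    using \<psi>[OF poset_autsD(4)[OF P that(1) \<psi>'(2)[OF that(2)]]] \<phi>(3)[OF that(1) \<psi>'(2)[OF that(2)]]
      \<psi>'(1)[OF that(2)] by simp
  have bQ: "b n w \<in> Q" if "n \<in> N" "w \<in> Q" for n w
    using im poset_autsD(4)[OF P that(1) \<psi>'(2)[OF that(2)]] \<phi>(3)[OF that(1) \<psi>'(2)[OF that(2)]]
      \<psi>'(1)[OF that(2)] by (metis image_eqI)
  have f: "push P \<phi> u \<in> chain_points Q" if u: "u \<in> chain_points P" for u
    using im chain_pointsD(2)[OF u] chain_pointsD(3)[OF u] \<phi>(2)
    by (intro push_in_chain_points fin finQ u) auto
  have g: "push Q \<psi> u \<in> chain_points P" if u: "u \<in> chain_points Q" for u
  proof (intro push_in_chain_points fin finQ u \<psi>')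
    fix v w assume "u v \<noteq> 0" "u w \<noteq> 0"
    then have "v \<in> Q" "w \<in> Q" "v \<le> w \<or> w \<le> v"
      using chain_pointsD(2,3)[OF u] by auto
    then show "\<psi> v \<le> \<psi> w \<or> \<psi> w \<le> \<psi> v"
      using \<phi>(2)[OF \<psi>'(2) \<psi>'(2), of v w] \<phi>(2)[OF \<psi>'(2) \<psi>'(2), of w v] \<psi>'(1) by auto
  qed auto
  have gf: "push Q \<psi> (push P \<phi> u) = u" if u: "u \<in> chain_points P" for u
  proof -
    have "push Q \<psi> (push P \<phi> u) = push P (\<lambda>v. \<psi> (\<phi> v)) u"
      using im by (intro push_push fin finQ) auto
    then show ?thesis
      using push_id[OF fin u, of "\<lambda>v. \<psi> (\<phi> v)"] \<psi> by simp
  qed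
  have fg: "push P \<phi> (push Q \<psi> u) = u" if u: "u \<in> chain_points Q" for u
  proof -
    have "push P \<phi> (push Q \<psi> u) = push Q (\<lambda>v. \<phi> (\<psi> v)) u"
      using \<psi>' by (intro push_push fin finQ) auto
    then show ?thesis
      using push_id[OF finQ u, of "\<lambda>v. \<phi> (\<psi> v)"] \<psi>' by simp
  qed
  have f_eqv: "push P \<phi> (push P (a n) u) = push Q (b n) (push P \<phi> u)" if "n \<in> N" for n u
  proof -
    have "push P \<phi> (push P (a n) u) = push P (\<lambda>v. \<phi> (a n v)) u"
      using poset_autsD(4)[OF P that] by (intro push_push fin)
    also have "\<dots> = push P (\<lambda>v. b n (\<phi> v)) u"
      unfolding push_def using \<phi>(3)[OF that] by (intro ext sum.cong) auto
    also have "\<dots> = push Q (b n) (push P \<phi> u)"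
      using im by (intro push_push[symmetric] fin finQ) auto
    finally show ?thesis .
  qed
  have g_eqv: "push Q \<psi> (push Q (b n) u) = push P (a n) (push Q \<psi> u)" if "n \<in> N" for n u
  proof -
    have "push Q \<psi> (push Q (b n) u) = push Q (\<lambda>v. \<psi> (b n v)) u"
      using bQ[OF that] by (intro push_push finQ)
    also have "\<dots> = push Q (\<lambda>v. a n (\<psi> v)) u"
      unfolding push_def using \<psi>_eqv[OF that] by (intro ext sum.cong) auto
    also have "\<dots> = push P (a n) (push Q \<psi> u)"
      using \<psi>' by (intro push_push[symmetric] fin finQ) auto
    finally show ?thesis .
  qed
  have actP: "realization_map (a n) u = push P (a n) u" "push P (a n) u \<in> chain_points P"
    if "n \<in> N" "u \<in> chain_points P" for n u
    using realization_map_eq_push[OF fin that(2)] action_in_chain_points[OF P that] by auto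
  have actQ: "realization_map (b n) u = push Q (b n) u" "push Q (b n) u \<in> chain_points Q"
    if "n \<in> N" "u \<in> chain_points Q" for n u
    using realization_map_eq_push[OF finQ that(2)]
      f[OF action_in_chain_points[OF P that(1) g[OF that(2)]]] f_eqv[OF that(1)] fg[OF that(2)] by auto
  have cont: "continuous_on S (push R h)"
    for R :: "'x set" and h :: "'x \<Rightarrow> 'y" and S
    by (rule continuous_on_coordinatewise_then_product, rule continuous_on_push)
       (rule continuous_on_subset[OF continuous_on_product_coordinates], simp)
  show ?thesis
    unfolding equivariant_homotopy_equivalent_def realization_order_complex[OF fin]
      realization_order_complex[OF finQ]
  proof (rule exI[of _ "push P \<phi>"], rule exI[of _ "push Q \<psi>"], intro conjI)
    show "homotopic_with (equivariant_map N (chain_action a) (chain_action a) (top_of_set (chain_points P)))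
        (top_of_set (chain_points P)) (top_of_set (chain_points P)) (push Q \<psi> \<circ> push P \<phi>) id"
    proof (rule homotopic_with_equal)
      show "continuous_map (top_of_set (chain_points P)) (top_of_set (chain_points P)) (push Q \<psi> \<circ> push P \<phi>)"
        by (rule continuous_map_eq[OF continuous_map_id]) (simp add: gf)
    qed (use gf actP in \<open>auto simp: equivariant_map_def\<close>)
    show "homotopic_with (equivariant_map N (chain_action b) (chain_action b) (top_of_set (chain_points Q)))
        (top_of_set (chain_points Q)) (top_of_set (chain_points Q)) (push P \<phi> \<circ> push Q \<psi>) id"
    proof (rule homotopic_with_equal)
      show "continuous_map (top_of_set (chain_points Q)) (top_of_set (chain_points Q)) (push P \<phi> \<circ> push Q \<psi>)"
        by (rule continuous_map_eq[OF continuous_map_id]) (simp add: fg)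
    qed (use fg actQ in \<open>auto simp: equivariant_map_def\<close>)
  qed (use f g cont f_eqv g_eqv actP actQ in \<open>auto simp: equivariant_map_def\<close>)
qed


section \<open>Finite groups and p-subgroups\<close>

definition conj_elt :: "('a, 'b) monoid_scheme \<Rightarrow> 'a \<Rightarrow> 'a \<Rightarrow> 'a" where
  "conj_elt G g x = g \<otimes>\<^bsub>G\<^esub> x \<otimes>\<^bsub>G\<^esub> inv\<^bsub>G\<^esub> g"

lemma conj_set_eq: "conj_set G g = (`) (conj_elt G g)"
  by (auto simp: conj_set_def conj_elt_def l_coset_def r_coset_def fun_eq_iff)

context group
begin

lemma conj_elt_closed [simp]: "g \<in> carrier G \<Longrightarrow> x \<in> carrier G \<Longrightarrow> conj_elt G g x \<in> carrier G"
  by (simp add: conj_elt_def)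

lemma conj_elt_mult:
  "g \<in> carrier G \<Longrightarrow> x \<in> carrier G \<Longrightarrow> y \<in> carrier G \<Longrightarrow>
    conj_elt G g (x \<otimes> y) = conj_elt G g x \<otimes> conj_elt G g y"
  by (simp add: conj_elt_def m_assoc) (simp flip: m_assoc)

lemma conj_elt_comp:
  "g \<in> carrier G \<Longrightarrow> h \<in> carrier G \<Longrightarrow> x \<in> carrier G \<Longrightarrow>
    conj_elt G (g \<otimes> h) x = conj_elt G g (conj_elt G h x)"
  by (simp add: conj_elt_def m_assoc inv_mult_group)

lemma conj_elt_one [simp]: "x \<in> carrier G \<Longrightarrow> conj_elt G \<one> x = x"
  by (simp add: conj_elt_def)

lemma conj_elt_of_one [simp]: "g \<in> carrier G \<Longrightarrow> conj_elt G g \<one> = \<one>"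
  by (simp add: conj_elt_def)

lemma conj_elt_inv_cancel [simp]:
  "g \<in> carrier G \<Longrightarrow> x \<in> carrier G \<Longrightarrow> conj_elt G (inv g) (conj_elt G g x) = x"
  "g \<in> carrier G \<Longrightarrow> x \<in> carrier G \<Longrightarrow> conj_elt G g (conj_elt G (inv g) x) = x"
  by (simp_all flip: conj_elt_comp)

lemma conj_elt_inv:
  "g \<in> carrier G \<Longrightarrow> x \<in> carrier G \<Longrightarrow> conj_elt G g (inv x) = inv (conj_elt G g x)"
  by (simp add: conj_elt_def m_assoc inv_mult_group)

lemma conj_elt_eq_iff:
  "g \<in> carrier G \<Longrightarrow> x \<in> carrier G \<Longrightarrow> conj_elt G g x = x \<longleftrightarrow> g \<otimes> x = x \<otimes> g"
  unfolding conj_elt_def by (metis inv_solve_right m_closed)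

lemma conj_elt_iso: "g \<in> carrier G \<Longrightarrow> conj_elt G g \<in> iso G G"
  by (auto simp: iso_def hom_def conj_elt_mult intro!: bij_betw_byWitness[where f' = "conj_elt G (inv g)"])

lemma inj_on_conj_elt: "g \<in> carrier G \<Longrightarrow> inj_on (conj_elt G g) (carrier G)"
  using conj_elt_iso by (auto simp: iso_def bij_betw_def)

lemma conj_image_inv:
  assumes "g \<in> carrier G" "A \<subseteq> carrier G"
  shows "conj_elt G (inv g) ` conj_elt G g ` A = A" "conj_elt G g ` conj_elt G (inv g) ` A = A"
  using assms by (auto simp: image_image subset_iff intro!: image_eqI[rotated])

section \<open>Normalizers and centralizers\<close>

lemma normalizer_eq:
  assumes "A \<subseteq> carrier G"
  shows "normalizer G A = {g \<in> carrier G. conj_elt G g ` A = A}"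
  using assms by (auto simp: normalizer_def stabilizer_def simp flip: conj_set_eq[THEN fun_cong] conj_set_def)

lemma normalizer_closed: "A \<subseteq> carrier G \<Longrightarrow> normalizer G A \<subseteq> carrier G"
  by (auto simp: normalizer_eq)

lemma normalizerI:
  assumes "finite A" "A \<subseteq> carrier G" "g \<in> carrier G" "\<And>a. a \<in> A \<Longrightarrow> conj_elt G g a \<in> A"
  shows "g \<in> normalizer G A"
proof -
  have "conj_elt G g ` A = A"
    using assms inj_on_subset[OF inj_on_conj_elt[OF assms(3)]] by (intro endo_inj_surj) auto
  then show ?thesis
    using assms by (simp add: normalizer_eq)
qed

lemma normalizerD:
  assumes "A \<subseteq> carrier G" "g \<in> normalizer G A"
  shows "g \<in> carrier G" "conj_elt G g ` A = A" "a \<in> A \<Longrightarrow> conj_elt G g a \<in> A"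
  using assms by (auto simp: normalizer_eq)

lemma subgroup_centralizer:
  assumes "A \<subseteq> carrier G"
  shows "subgroup (centralizer G A) G"
proof (rule subgroupI)
  show "centralizer G A \<subseteq> carrier G" "centralizer G A \<noteq> {}"
    using assms by (auto simp: centralizer_def intro!: exI[of _ \<one>])
  show "inv g \<in> centralizer G A" if g: "g \<in> centralizer G A" for g
  proof -
    have gc: "g \<in> carrier G" and comm: "\<And>a. a \<in> A \<Longrightarrow> g \<otimes> a = a \<otimes> g"
      using g by (auto simp: centralizer_def)
    have "inv g \<otimes> a = a \<otimes> inv g" if "a \<in> A" for a
    proof -
      have a: "a \<in> carrier G"
        using that assms by auto
      then have "conj_elt G (inv g) a = a"
        using conj_elt_eq_iff[OF gc a] comm[OF that] conj_elt_inv_cancel(1)[OF gc a] by simp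
      then show ?thesis
        using conj_elt_eq_iff[of "inv g" a] gc a by simp
    qed
    then show ?thesis
      using gc by (simp add: centralizer_def)
  qed
  show "g \<otimes> h \<in> centralizer G A" if "g \<in> centralizer G A" "h \<in> centralizer G A" for g h
  proof -
    have gh: "g \<in> carrier G" "h \<in> carrier G" "\<And>a. a \<in> A \<Longrightarrow> g \<otimes> a = a \<otimes> g" "\<And>a. a \<in> A \<Longrightarrow> h \<otimes> a = a \<otimes> h"
      using that by (auto simp: centralizer_def)
    have "g \<otimes> h \<otimes> a = a \<otimes> (g \<otimes> h)" if a: "a \<in> A" for a
    proof -
      have ac: "a \<in> carrier G"
        using a assms by auto
      have "g \<otimes> h \<otimes> a = g \<otimes> a \<otimes> h"
        using gh(1,2) gh(4)[OF a] ac by (simp add: m_assoc)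
      then show ?thesis
        using gh(1,2) gh(3)[OF a] ac by (simp add: m_assoc)
    qed
    then show ?thesis
      using gh by (simp add: centralizer_def)
  qed
qed

lemma centralizer_anti_mono: "A \<subseteq> B \<Longrightarrow> centralizer G B \<subseteq> centralizer G A"
  by (auto simp: centralizer_def)

lemma centralizer_subset_normalizer:
  assumes "A \<subseteq> carrier G"
  shows "centralizer G A \<subseteq> normalizer G A"
proof
  fix g assume g: "g \<in> centralizer G A"
  then have "g \<in> carrier G" "\<And>a. a \<in> A \<Longrightarrow> conj_elt G g a = a"
    using assms conj_elt_eq_iff by (auto simp: centralizer_def subset_iff)
  then have "conj_elt G g ` A = A"
    by auto
  then show "g \<in> normalizer G A"
    using \<open>g \<in> carrier G\<close> assms by (simp add: normalizer_eq)
qed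

lemma subgroup_subset_normalizer:
  assumes "subgroup H G"
  shows "H \<subseteq> normalizer G H"
  using subgroup_in_normalizer[OF assms] normal_imp_subgroup subgroup.subset by fastforce

lemma subgroup_conj_closed:
  assumes "subgroup H G" "g \<in> H" "h \<in> H"
  shows "conj_elt G g h \<in> H"
  using assms by (simp add: conj_elt_def subgroup.m_closed subgroup.m_inv_closed)

section \<open>Subgroups as groups in their own right, expressed in the ambient group\<close>

lemma mult_carrier_update: "(A <#>\<^bsub>G\<lparr>carrier := M\<rparr>\<^esub> B) = A <#> B"
  by (simp add: set_mult_def)

lemma subgroup_carrier_update_iff:
  assumes "subgroup M G"
  shows "subgroup A (G\<lparr>carrier := M\<rparr>) \<longleftrightarrow> subgroup A G \<and> A \<subseteq> M"
  using incl_subgroup[OF assms] subgroup_incl[OF _ assms] subgroup.subset[of A "G\<lparr>carrier := M\<rparr>"] by auto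

lemma normal_carrier_update_iff:
  assumes M: "subgroup M G"
  shows "A \<lhd> G\<lparr>carrier := M\<rparr> \<longleftrightarrow> subgroup A G \<and> A \<subseteq> M \<and> (\<forall>g\<in>M. \<forall>a\<in>A. conj_elt G g a \<in> A)"
  using group.normal_inv_iff[OF subgroup_imp_group[OF M], of A] m_inv_consistent[OF M]
  by (auto simp: subgroup_carrier_update_iff[OF M] conj_elt_def)

lemma centralizer_carrier_update:
  "M \<subseteq> carrier G \<Longrightarrow> centralizer (G\<lparr>carrier := M\<rparr>) A = centralizer G A \<inter> M"
  by (auto simp: centralizer_def)

lemma p_subgroup_carrier_update_iff:
  "subgroup M G \<Longrightarrow> p_subgroup p (G\<lparr>carrier := M\<rparr>) A \<longleftrightarrow> p_subgroup p G A \<and> A \<subseteq> M"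
  by (auto simp: p_subgroup_def subgroup_carrier_update_iff)

lemma group_center_carrier_update:
  "M \<subseteq> carrier G \<Longrightarrow> group_center (G\<lparr>carrier := M\<rparr>) = centralizer G M \<inter> M"
  by (auto simp: group_center_def centralizer_def)

lemma ord_dvd_card_subgroup:
  assumes "subgroup H G" "finite H" "x \<in> H"
  shows "ord x dvd card H"
proof -
  interpret H: group "G\<lparr>carrier := H\<rparr>"
    using assms(1) by (rule subgroup_imp_group)
  have "x [^]\<^bsub>G\<lparr>carrier := H\<rparr>\<^esub> card H = \<one>"
    using H.pow_order_eq_1[of x] assms by (simp add: Coset.order_def)
  then have "x [^] card H = \<one>"
    by (simp add: nat_pow_consistent[symmetric])
  then show ?thesis
    using pow_eq_id subgroup.mem_carrier[OF assms(1,3)] by simp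
qed

section \<open>Actions on finite sets, counted modulo \<open>p\<close>\<close>

lemma group_action_restrict:
  assumes "\<And>g x. g \<in> carrier G \<Longrightarrow> x \<in> E \<Longrightarrow> act g x \<in> E"
    and "\<And>x. x \<in> E \<Longrightarrow> act \<one> x = x"
    and "\<And>g h x. g \<in> carrier G \<Longrightarrow> h \<in> carrier G \<Longrightarrow> x \<in> E \<Longrightarrow> act (g \<otimes> h) x = act g (act h x)"
  shows "group_action G E (\<lambda>g. restrict (act g) E)"
proof -
  have bij: "bij_betw (act g) E E" if "g \<in> carrier G" for g
    by (rule bij_betw_byWitness[where f' = "act (inv g)"])
       (use that assms assms(3)[symmetric] in auto)
  have "restrict (act g) E \<in> Bij E" if "g \<in> carrier G" for g
    using bij[OF that] bij_betw_cong[of E "restrict (act g) E" "act g"] by (simp add: Bij_def)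
  then have "(\<lambda>g. restrict (act g) E) \<in> hom G (BijGroup E)"
    using assms(1,3) by (auto simp: hom_def BijGroup_def compose_def restrict_def fun_eq_iff)
  then show ?thesis
    by (simp add: group_action_def group_hom_def group_hom_axioms_def group_BijGroup)
qed

end

text \<open>The points that are not fixed form a union of orbits, and each such orbit has more than
  one element and \<open>p\<close>-power size, hence size divisible by \<open>p\<close>.\<close>

lemma card_fixed_points_cong:
  fixes G (structure)
  assumes "group G" "Factorial_Ring.prime (p::nat)" "card (carrier G) = p ^ n" "finite E"
    and act: "\<And>g x. g \<in> carrier G \<Longrightarrow> x \<in> E \<Longrightarrow> act g x \<in> E"
      "\<And>x. x \<in> E \<Longrightarrow> act \<one> x = x"
      "\<And>g h x. g \<in> carrier G \<Longrightarrow> h \<in> carrier G \<Longrightarrow> x \<in> E \<Longrightarrow> act (g \<otimes> h) x = act g (act h x)"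
  shows "card E mod p = card {x \<in> E. \<forall>g\<in>carrier G. act g x = x} mod p"
proof -
  interpret group G by fact
  define \<phi> where "\<phi> = (\<lambda>g. restrict (act g) E)"
  interpret group_action G E \<phi>
    unfolding \<phi>_def by (rule group_action_restrict) (use act in auto)
  let ?F = "{x \<in> E. \<forall>g\<in>carrier G. act g x = x}"
  have orb: "orbit G \<phi> x = {act g x |g. g \<in> carrier G}" if "x \<in> E" for x
    using that by (auto simp: orbit_def \<phi>_def)
  have dvd: "p dvd card (orbit G \<phi> x)" if x: "x \<in> E" "x \<notin> ?F" for x
  proof -
    have "card (orbit G \<phi> x) dvd p ^ n"
      using orbit_stabilizer_theorem[OF x(1)] assms(3) by (metis dvd_triv_left Coset.order_def)
    then obtain k where k: "card (orbit G \<phi> x) = p ^ k"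
      using \<open>Factorial_Ring.prime p\<close> by (auto simp: divides_primepow_nat)
    have "k \<noteq> 0"
    proof
      assume "k = 0"
      then obtain y where y: "orbit G \<phi> x = {y}"
        using k by (auto simp: card_1_singleton_iff)
      have "x \<in> orbit G \<phi> x"
        using orbit_refl[OF x(1)] .
      moreover have "act g x \<in> orbit G \<phi> x" if "g \<in> carrier G" for g
        using orb[OF x(1)] that by auto
      ultimately show False
        using x y by auto
    qed
    then show ?thesis
      by (simp add: k)
  qed
  have stable: "act g x \<in> E - ?F" if "g \<in> carrier G" "x \<in> E - ?F" for g x
  proof -
    have gx: "act g x \<in> E"
      using that act(1) by auto
    have x: "act (inv g) (act g x) = x"
      using that act(2) act(3)[of "inv g" g x] by simp
    have "act g x \<notin> ?F"
    proof
      assume F: "act g x \<in> ?F"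
      then have "act (inv g) (act g x) = act g x"
        using that(1) by blast
      then show False
        using F x that(2) by simp
    qed
    then show ?thesis
      using gx by blast
  qed
  have "p dvd card (E - ?F)"
  proof -
    have "orbit G \<phi> x \<inter> ?F = {}" if "x \<in> E - ?F" for x
    proof -
      have "z \<notin> ?F" if z: "z \<in> orbit G \<phi> x" for z
      proof -
        obtain g where "g \<in> carrier G" "z = act g x"
          using z orb[of x] \<open>x \<in> E - ?F\<close> by auto
        then show ?thesis
          using stable[of g x] \<open>x \<in> E - ?F\<close> by blast
      qed
      then show ?thesis
        by blast
    qed
    then have "E - ?F = \<Union> {orb \<in> orbits G E \<phi>. orb \<inter> ?F = {}}"
    proof (intro equalityI subsetI)
      fix x assume x: "x \<in> E - ?F"
      then show "x \<in> \<Union> {orb \<in> orbits G E \<phi>. orb \<inter> ?F = {}}"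
        using orbit_refl[of x] \<open>\<And>x. x \<in> E - ?F \<Longrightarrow> orbit G \<phi> x \<inter> ?F = {}\<close>[OF x]
        by (auto simp: orbits_def intro!: exI[of _ "orbit G \<phi> x"])
    next
      fix x assume "x \<in> \<Union> {orb \<in> orbits G E \<phi>. orb \<inter> ?F = {}}"
      then show "x \<in> E - ?F"
        using orbits_coverture by blast
    qed
    also have "p dvd card \<dots>"
    proof (rule dvd_partition)
      show "finite (\<Union> {orb \<in> orbits G E \<phi>. orb \<inter> ?F = {}})"
        using orbits_coverture by (intro finite_subset[OF _ \<open>finite E\<close>]) auto
      show "\<forall>c\<in>{orb \<in> orbits G E \<phi>. orb \<inter> ?F = {}}. p dvd card c"
      proof
        fix c assume c: "c \<in> {orb \<in> orbits G E \<phi>. orb \<inter> ?F = {}}"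
        then obtain x where x: "x \<in> E" "c = orbit G \<phi> x"
          by (auto simp: orbits_def)
        then show "p dvd card c"
          using dvd[of x] orbit_refl[OF x(1)] c by blast
      qed
      show "\<forall>c1\<in>{orb \<in> orbits G E \<phi>. orb \<inter> ?F = {}}. \<forall>c2\<in>{orb \<in> orbits G E \<phi>. orb \<inter> ?F = {}}.
          c1 \<noteq> c2 \<longrightarrow> c1 \<inter> c2 = {}"
        using disjoint_union by auto
    qed
    finally show ?thesis .
  qed
  moreover have "card E = card ?F + card (E - ?F)"
    using \<open>finite E\<close> card_Un_disjoint[of ?F "E - ?F"] by (simp add: Un_absorb1 Un_Diff_cancel)
  ultimately show ?thesis
    by (auto simp: mod_add_eq elim!: dvdE)
qed


section \<open>Sylow subgroups and the \<open>p\<close>-core\<close>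

locale finite_group_prime = group G for G (structure) +
  fixes p :: nat
  assumes prime_p: "Factorial_Ring.prime p" and fin: "finite (carrier G)"
begin

lemma subgroup_locale: "subgroup M G \<Longrightarrow> finite_group_prime (G\<lparr>carrier := M\<rparr>) p"
  unfolding finite_group_prime_def finite_group_prime_axioms_def
  using subgroup_imp_group prime_p fin by (auto intro: finite_subset[OF subgroup.subset])

lemma fin_subgroup: "subgroup H G \<Longrightarrow> finite H"
  using fin finite_subset subgroup.subset by metis

lemma p_subgroupD:
  assumes "p_subgroup p G P"
  shows "subgroup P G" "finite P" "P \<subseteq> carrier G" "\<one> \<in> P"
  using assms fin_subgroup subgroup.subset subgroup.one_closed by (auto simp: p_subgroup_def)

lemma p_gt_1: "1 < p"
  using prime_p by (rule prime_gt_1_nat)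

lemma card_subgroup_index:
  assumes "subgroup K G" "subgroup H G" "K \<subseteq> H"
  shows "card ((\<lambda>a. K #> a) ` H) * card K = card H"
proof -
  have "rcosets\<^bsub>G\<lparr>carrier := H\<rparr>\<^esub> K = (\<lambda>a. K #> a) ` H"
    by (auto simp: RCOSETS_def r_coset_def)
  then show ?thesis
    using group.lagrange[OF subgroup_imp_group[OF assms(2)] subgroup_incl[OF assms]]
    by (simp add: Coset.order_def)
qed

lemma p_subgroup_mono:
  assumes "p_subgroup p G S" "subgroup K G" "K \<subseteq> S"
  shows "p_subgroup p G K"
proof -
  obtain n where "card S = p ^ n"
    using assms(1) by (auto simp: p_subgroup_def)
  then have "card K dvd p ^ n"
    using card_subgroup_index[OF assms(2) p_subgroupD(1)[OF assms(1)] assms(3)] by (metis dvd_triv_right)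
  then show ?thesis
    using assms(2) prime_p by (auto simp: p_subgroup_def divides_primepow_nat)
qed

lemma p_dvd_index:
  assumes "p_subgroup p G F" "subgroup D G" "D \<subset> F"
  shows "p dvd card ((\<lambda>a. D #> a) ` F)"
proof -
  note F = p_subgroupD[OF assms(1)]
  have card: "card ((\<lambda>a. D #> a) ` F) * card D = card F"
    using card_subgroup_index[OF assms(2) F(1)] assms(3) by auto
  obtain n where "card F = p ^ n"
    using assms(1) by (auto simp: p_subgroup_def)
  then obtain k where k: "card ((\<lambda>a. D #> a) ` F) = p ^ k"
    using card prime_p by (metis divides_primepow_nat dvd_triv_left)
  have "card D < card F"
    using assms(3) F(2) by (rule psubset_card_mono[rotated])
  then have "k \<noteq> 0"
    using card k by (intro notI) simp
  then show ?thesis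
    using k by simp
qed

text \<open>The one fixed point lemma behind the growth of normalizers, the non-triviality of centres and
  the \<open>A \<times> B\<close>-lemma: \<open>P\<close> acts on the cosets of \<open>D\<close> in \<open>F\<close> and fixes \<open>D\<close>, hence a further one.\<close>

lemma fixed_coset:
  assumes P: "p_subgroup p G P" and F: "p_subgroup p G F" and D: "subgroup D G" "D \<subset> F"
    and nF: "\<And>u a. u \<in> P \<Longrightarrow> a \<in> F \<Longrightarrow> conj_elt G u a \<in> F"
    and nD: "\<And>u a. u \<in> P \<Longrightarrow> a \<in> D \<Longrightarrow> conj_elt G u a \<in> D"
  obtains a where "a \<in> F" "a \<notin> D" "\<And>u. u \<in> P \<Longrightarrow> conj_elt G u a \<otimes> inv a \<in> D"
proof -
  note Pc = p_subgroupD[OF P] and Fc = p_subgroupD[OF F]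
  define E where "E = (\<lambda>a. D #> a) ` F"
  have Dc: "D \<subseteq> carrier G"
    using D(2) Fc(3) by auto
  have conj_D: "conj_elt G u ` D = D" if "u \<in> P" for u
    using nD[OF that] Pc(3) that fin_subgroup[OF D(1)] inj_on_subset[OF inj_on_conj_elt Dc]
    by (intro endo_inj_surj) auto
  have conj_coset: "conj_elt G u ` (D #> a) = D #> conj_elt G u a" if "u \<in> P" "a \<in> F" for u a
  proof -
    have "conj_elt G u ` (D #> a) = (\<lambda>d. d \<otimes> conj_elt G u a) ` conj_elt G u ` D"
      using that Pc(3) Fc(3) Dc
      by (auto simp: r_coset_def image_image conj_elt_mult subset_iff intro!: image_eqI)
    also have "\<dots> = D #> conj_elt G u a"
      unfolding conj_D[OF that(1)] by (auto simp: r_coset_def)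
    finally show ?thesis .
  qed
  obtain n where n: "card P = p ^ n"
    using P by (auto simp: p_subgroup_def)
  let ?F = "{R \<in> E. \<forall>u\<in>P. conj_elt G u ` R = R}"
  have subE: "R \<subseteq> carrier G" if "R \<in> E" for R
    using that Fc(3) r_coset_subset_G[OF Dc] unfolding E_def by blast
  have "card E mod p = card {R \<in> E. \<forall>u\<in>carrier (G\<lparr>carrier := P\<rparr>). conj_elt G u ` R = R} mod p"
  proof (rule card_fixed_points_cong[OF subgroup_imp_group[OF Pc(1)] prime_p])
    show "card (carrier (G\<lparr>carrier := P\<rparr>)) = p ^ n"
      using n by simp
    show "finite E"
      using Fc(2) by (simp add: E_def)
    show "conj_elt G u ` R \<in> E" if "u \<in> carrier (G\<lparr>carrier := P\<rparr>)" "R \<in> E" for u R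
      using that nF conj_coset by (auto simp: E_def)
    show "conj_elt G \<one>\<^bsub>G\<lparr>carrier := P\<rparr>\<^esub> ` R = R" if "R \<in> E" for R
      using subE[OF that] by (force simp: subset_iff)
    show "conj_elt G (g \<otimes>\<^bsub>G\<lparr>carrier := P\<rparr>\<^esub> h) ` R = conj_elt G g ` conj_elt G h ` R"
      if "g \<in> carrier (G\<lparr>carrier := P\<rparr>)" "h \<in> carrier (G\<lparr>carrier := P\<rparr>)" "R \<in> E" for g h R
      using subE[OF that(3)] that(1,2) Pc(3) unfolding image_image
      by (intro image_cong refl) (auto simp: conj_elt_comp subset_iff)
  qed
  then have "p dvd card ?F"
    using p_dvd_index[OF F D] by (simp add: E_def mod_eq_0_iff_dvd flip: mod_0_imp_dvd) 
  have DF: "D \<in> ?F"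
  proof -
    have "D = D #> \<one>"
      using Dc by simp
    then show ?thesis
      using conj_D Fc(4) by (auto simp: E_def)
  qed
  have "?F \<noteq> {D}"
    using \<open>p dvd card ?F\<close> p_gt_1 by auto
  then obtain R where R: "R \<in> ?F" "R \<noteq> D"
    using DF by blast
  then obtain a where a: "a \<in> F" "R = D #> a"
    by (auto simp: E_def)
  show thesis
  proof (rule that[OF a(1)])
    show "a \<notin> D"
      using R(2) a coset_join2[OF _ D(1)] Fc(3) by auto
    show "conj_elt G u a \<otimes> inv a \<in> D" if u: "u \<in> P" for u
    proof -
      have "D #> conj_elt G u a = D #> a"
        using R(1) u conj_coset[OF u a(1)] a(2) by auto
      then have "conj_elt G u a \<in> D #> a"
        using rcos_self[OF _ D(1)] nF[OF u a(1)] Fc(3) by auto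
      then show ?thesis
        using subgroup.rcos_module_imp[OF D(1) is_group] a(1) Fc(3) by auto
    qed
  qed
qed

text \<open>The case of \<open>fixed_coset\<close> in which \<open>Q\<close> plays both the acting
  group and \<open>D\<close>: a coset Qa fixed under conjugation by \<open>Q\<close> consists of
  elements normalizing \<open>Q\<close>.\<close>

lemma normalizer_grows:
  assumes Q: "p_subgroup p G Q" and R: "p_subgroup p G R" and "Q \<subset> R"
  shows "Q \<subset> R \<inter> normalizer G Q"
proof -
  note Qc = p_subgroupD[OF Q] and Rc = p_subgroupD[OF R]
  obtain a where a: "a \<in> R" "a \<notin> Q" "\<And>u. u \<in> Q \<Longrightarrow> conj_elt G u a \<otimes> inv a \<in> Q"
  proof (rule fixed_coset[OF Q R Qc(1) assms(3)])
    show "conj_elt G u a \<in> R" if "u \<in> Q" "a \<in> R" for u a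
      using subgroup_conj_closed[OF Rc(1)] that assms(3) by blast
    show "conj_elt G u a \<in> Q" if "u \<in> Q" "a \<in> Q" for u a
      using subgroup_conj_closed[OF Qc(1) that] .
  qed blast
  have ac: "a \<in> carrier G"
    using a(1) Rc(3) by auto
  have "a \<in> normalizer G Q"
  proof (rule normalizerI[OF Qc(2,3) ac])
    fix u assume u: "u \<in> Q"
    have uc: "u \<in> carrier G"
      using u Qc(3) by auto
    have "inv u \<otimes> (conj_elt G u a \<otimes> inv a) \<in> Q"
      using a(3)[OF u] u Qc(1) by (simp add: subgroup.m_closed subgroup.m_inv_closed)
    \<comment> \<open>Multiplying the commutator of u and a by the inverse of u leaves the conjugate
      of that inverse by a.\<close>
    moreover have "inv u \<otimes> (conj_elt G u a \<otimes> inv a) = conj_elt G a (inv u)"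
      using ac uc by (simp add: conj_elt_def m_assoc) (simp flip: m_assoc)
    ultimately have "inv (conj_elt G a u) \<in> Q"
      using ac uc by (simp add: conj_elt_inv)
    then show "conj_elt G a u \<in> Q"
      using subgroup.m_inv_closed[OF Qc(1)] ac uc by fastforce
  qed
  then show ?thesis
    using a subgroup_subset_normalizer[OF Qc(1)] assms(3) by blast
qed

text \<open>The case of \<open>fixed_coset\<close> where \<open>S\<close> acts on itself and
  \<open>D\<close> is trivial: a second fixed coset is a nontrivial element fixed by all
  conjugations.\<close>

lemma center_nontrivial:
  assumes S: "p_subgroup p G S" and "S \<noteq> {\<one>}"
  obtains x where "x \<in> S" "x \<noteq> \<one>" "\<And>u. u \<in> S \<Longrightarrow> x \<otimes> u = u \<otimes> x"
proof -
  note Sc = p_subgroupD[OF S]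
  have "{\<one>} \<subset> S"
    using Sc(4) assms(2) by auto
  then obtain a where a: "a \<in> S" "a \<notin> {\<one>}" "\<And>u. u \<in> S \<Longrightarrow> conj_elt G u a \<otimes> inv a \<in> {\<one>}"
  proof (rule fixed_coset[OF S S triv_subgroup])
    show "conj_elt G u a \<in> S" if "u \<in> S" "a \<in> S" for u a
      using subgroup_conj_closed[OF Sc(1) that] .
    show "conj_elt G u a \<in> {\<one>}" if "u \<in> S" "a \<in> {\<one>}" for u a
      using that Sc(3) by auto
  qed blast
  have "a \<otimes> u = u \<otimes> a" if u: "u \<in> S" for u
  proof -
    have c: "a \<in> carrier G" "u \<in> carrier G"
      using a(1) u Sc(3) by auto
    then have "conj_elt G u a = a"
      using a(3)[OF u] inv_solve_right'[of "\<one>" "conj_elt G u a" a] by simp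
    then show ?thesis
      using conj_elt_eq_iff c by metis
  qed
  then show thesis
    using that a by blast
qed

lemma exists_element_of_order_p:
  assumes P: "p_subgroup p G P" and x: "x \<in> P" "x \<noteq> \<one>"
  obtains k where "ord (x [^] (k::nat)) = p"
proof -
  note Pc = p_subgroupD[OF P]
  have xc: "x \<in> carrier G"
    using x Pc by auto
  obtain n where "card P = p ^ n"
    using P by (auto simp: p_subgroup_def)
  then obtain k where k: "ord x = p ^ k"
    using ord_dvd_card_subgroup[OF Pc(1,2) x(1)] prime_p by (auto simp: divides_primepow_nat)
  have "k \<noteq> 0"
    using k x(2) ord_eq_1[OF xc] by auto
  then have "ord (x [^] (p ^ (k - 1))) = p ^ k div p ^ (k - 1)"
    using ord_pow[OF xc, of "p ^ (k - 1)"] k p_gt_1 by (simp add: le_imp_power_dvd)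
  also have "\<dots> = p"
    using \<open>k \<noteq> 0\<close> p_gt_1 by (cases k) auto
  finally show thesis
    by (rule that)
qed

lemma trivial_element:
  assumes P: "p_subgroup p G P" and x: "x \<in> P" and "coprime (ord x) p"
  shows "x = \<one>"
proof -
  note Pc = p_subgroupD[OF P]
  obtain n where "card P = p ^ n"
    using P by (auto simp: p_subgroup_def)
  then have "ord x dvd p ^ n"
    using ord_dvd_card_subgroup[OF Pc(1,2) x(1)] by simp
  then have "ord x dvd 1"
    using assms(3) by (metis coprime_dvd_mult_right_iff coprime_power_right_iff dvd_refl nat_dvd_1_iff_1 coprime_absorb_left)
  then show ?thesis
    using ord_eq_1 x Pc(3) by auto
qed

text \<open>A prime other than \<open>p\<close> dividing the order would produce, by Cauchy's
  theorem, a nontrivial element of order coprime to \<open>p\<close>. This turns the question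
  whether a centralizer is a \<open>p\<close>-group into one about single elements, to which
  \<open>A_times_B\<close> applies.\<close>

lemma p_subgroupI_no_coprime:
  assumes Z: "subgroup Z G" and free: "\<And>y. y \<in> Z \<Longrightarrow> coprime (ord y) p \<Longrightarrow> y = \<one>"
  shows "p_subgroup p G Z"
proof -
  have finZ: "finite Z"
    using fin_subgroup[OF Z] .
  have pos: "card Z > 0"
    using finZ subgroup.one_closed[OF Z] by (auto simp: card_gt_0_iff)
  have only: "q = p" if q: "Factorial_Ring.prime q" "q dvd card Z" for q
  proof (rule ccontr)
    assume "q \<noteq> p"
    obtain m where "card Z = q ^ 1 * m"
      using q(2) by auto
    then obtain V where V: "subgroup V (G\<lparr>carrier := Z\<rparr>)" "card V = q ^ 1"
      using Sylow.sylow_thm[OF q(1) subgroup_imp_group[OF Z], of 1 m] finZ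
      by (auto simp: Coset.order_def)
    have VG: "subgroup V G" "V \<subseteq> Z"
      using V(1) subgroup_carrier_update_iff[OF Z] by auto
    have "V \<noteq> {\<one>}"
      using V(2) q(1) by (auto dest: prime_gt_1_nat)
    then obtain y where y: "y \<in> V" "y \<noteq> \<one>"
      using subgroup.one_closed[OF VG(1)] by auto
    have "ord y dvd q"
      using ord_dvd_card_subgroup[OF VG(1) fin_subgroup[OF VG(1)] y(1)] V(2) by simp
    moreover have "coprime q p"
      using q(1) prime_p \<open>q \<noteq> p\<close> primes_coprime by blast
    ultimately have "coprime (ord y) p"
      using coprime_divisors[of "ord y" q p p] by simp
    then show False
      using free[of y] y VG(2) by auto
  qed
  have "\<exists>k. card Z = p ^ k"
  proof -
    obtain m where m: "card Z = p ^ multiplicity p (card Z) * m" "\<not> p dvd m"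
      using multiplicity_decompose'[of "card Z" p] pos prime_p by (metis not_prime_unit neq0_conv)
    have "m = 1"
    proof (rule ccontr)
      assume "m \<noteq> 1"
      then obtain q where "Factorial_Ring.prime q" "q dvd m"
        using prime_factor_nat by blast
      then show False
        using only[of q] m by (metis dvd_mult)
    qed
    then show ?thesis
      using m by auto
  qed
  then show ?thesis
    using Z by (simp add: p_subgroup_def)
qed

section \<open>Existence and conjugacy of Sylow subgroups\<close>

lemma sylow_exists: "\<exists>S. sylow_subgroup p G S"
proof -
  have "Coset.order G \<noteq> 0"
    using order_gt_0_iff_finite fin by simp
  then obtain m where "Coset.order G = p ^ multiplicity p (Coset.order G) * m"
    using multiplicity_dvd by (metis dvdE)
  then show ?thesis
    using Sylow.sylow_thm[OF prime_p is_group _ fin] by (auto simp: sylow_subgroup_def)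
qed

lemma sylow_imp_p_subgroup: "sylow_subgroup p G S \<Longrightarrow> p_subgroup p G S"
  by (auto simp: sylow_subgroup_def p_subgroup_def)

lemma p_subgroup_card_le_sylow:
  assumes "p_subgroup p G P" "sylow_subgroup p G S"
  shows "card P \<le> card S"
proof -
  obtain n where n: "card P = p ^ n"
    using assms(1) by (auto simp: p_subgroup_def)
  have "card P dvd Coset.order G"
    using lagrange[OF p_subgroupD(1)[OF assms(1)]] by (metis dvd_triv_right)
  moreover have "Coset.order G \<noteq> 0"
    using order_gt_0_iff_finite fin by simp
  ultimately have "n \<le> multiplicity p (Coset.order G)"
    using n p_gt_1 by (intro multiplicity_geI) auto
  then show ?thesis
    using n assms(2) p_gt_1 by (simp add: sylow_subgroup_def)
qed

text \<open>\<open>P\<close> acts on the right cosets of \<open>S\<close>, whose number is prime to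
  \<open>p\<close>, so some coset Sx is fixed; this says that x conjugates \<open>P\<close> into
  \<open>S\<close>.\<close>

lemma p_subgroup_conj_into_sylow:
  assumes P: "p_subgroup p G P" and S: "sylow_subgroup p G S"
  obtains x where "x \<in> carrier G" "conj_elt G x ` P \<subseteq> S"
proof -
  note Pc = p_subgroupD[OF P]
  have Ss: "subgroup S G"
    using S by (simp add: sylow_subgroup_def)
  have Sc: "S \<subseteq> carrier G"
    using subgroup.subset[OF Ss] .
  let ?E = "rcosets S"
  obtain n where n: "card P = p ^ n"
    using P by (auto simp: p_subgroup_def)
  have sub: "R \<subseteq> carrier G" if "R \<in> ?E" for R
    using subgroup.rcosets_carrier[OF Ss is_group that] .
  \<comment> \<open>Right multiplication by the inverse, because right multiplication itself would
    reverse the order of composition.\<close>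
  have "card ?E mod p = card {R \<in> ?E. \<forall>u\<in>carrier (G\<lparr>carrier := P\<rparr>). R #> inv u = R} mod p"
  proof (rule card_fixed_points_cong[OF subgroup_imp_group[OF Pc(1)] prime_p])
    show "card (carrier (G\<lparr>carrier := P\<rparr>)) = p ^ n"
      using n by simp
    show "finite ?E"
      using fin by (simp add: RCOSETS_def)
    show "R #> inv u \<in> ?E" if u: "u \<in> carrier (G\<lparr>carrier := P\<rparr>)" and R: "R \<in> ?E" for u R
    proof -
      obtain x where "x \<in> carrier G" "R = S #> x"
        using R by (auto simp: RCOSETS_def)
      moreover have "u \<in> carrier G"
        using u Pc(3) by auto
      ultimately show ?thesis
        using Sc by (simp add: coset_mult_assoc rcosetsI)
    qed
    show "R #> inv \<one>\<^bsub>G\<lparr>carrier := P\<rparr>\<^esub> = R" if "R \<in> ?E" for R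
      using sub[OF that] by simp
    show "R #> inv (g \<otimes>\<^bsub>G\<lparr>carrier := P\<rparr>\<^esub> h) = R #> inv h #> inv g"
      if "g \<in> carrier (G\<lparr>carrier := P\<rparr>)" "h \<in> carrier (G\<lparr>carrier := P\<rparr>)" "R \<in> ?E" for g h R
      using sub[OF that(3)] that(1,2) Pc(3) by (auto simp: coset_mult_assoc inv_mult_group subset_iff)
  qed
  moreover have "\<not> p dvd card ?E"
  proof
    assume "p dvd card ?E"
    then have "p * p ^ multiplicity p (Coset.order G) dvd Coset.order G"
      using lagrange[OF Ss] S by (metis mult_dvd_mono dvd_refl sylow_subgroup_def)
    moreover have "Coset.order G \<noteq> 0"
      using order_gt_0_iff_finite fin by simp
    ultimately have "Suc (multiplicity p (Coset.order G)) \<le> multiplicity p (Coset.order G)"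
      using p_gt_1 by (intro multiplicity_geI) auto
    then show False
      by simp
  qed
  ultimately have "card {R \<in> ?E. \<forall>u\<in>P. R #> inv u = R} \<noteq> 0"
    by (intro notI) (simp add: dvd_eq_mod_eq_0)
  then have "{R \<in> ?E. \<forall>u\<in>P. R #> inv u = R} \<noteq> {}"
    by (metis card.empty)
  then obtain R where R: "R \<in> ?E" "\<And>u. u \<in> P \<Longrightarrow> R #> inv u = R"
    by auto
  then obtain x where x: "x \<in> carrier G" "R = S #> x"
    by (auto simp: RCOSETS_def)
  have "conj_elt G x u \<in> S" if u: "u \<in> P" for u
  proof -
    have uc: "u \<in> carrier G"
      using u Pc(3) by auto
    have "S #> (x \<otimes> u) = S #> x"
      using R(2)[of "inv u"] u uc x Sc subgroup.m_inv_closed[OF Pc(1)] by (simp add: coset_mult_assoc)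
    then have "x \<otimes> u \<in> S #> x"
      using rcos_self[OF _ Ss, of "x \<otimes> u"] x(1) uc by simp
    then show ?thesis
      using subgroup.rcos_module_imp[OF Ss is_group x(1)] by (simp add: conj_elt_def)
  qed
  then show thesis
    using that x(1) by blast
qed

end


lemma sylow_iso:
  assumes "group G" "group K" "\<alpha> \<in> iso G K" "sylow_subgroup p G S"
  shows "sylow_subgroup p K (\<alpha> ` S)"
proof -
  have S: "subgroup S G"
    using assms(4) by (simp add: sylow_subgroup_def)
  have "inj_on \<alpha> S"
    using assms(3) subgroup.subset[OF S] by (auto simp: iso_def bij_betw_def intro: inj_on_subset)
  moreover have "Coset.order K = Coset.order G"
    using assms(3) by (auto simp: Coset.order_def iso_def dest: bij_betw_same_card)
  ultimately show ?thesis
    using assms(4) subgroup.iso_subgroup[OF S assms(1-3)] by (simp add: sylow_subgroup_def card_image)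
qed

lemma iso_carrier_update:
  assumes "\<alpha> \<in> iso G K" "M \<subseteq> carrier G"
  shows "\<alpha> \<in> iso (G\<lparr>carrier := M\<rparr>) (K\<lparr>carrier := \<alpha> ` M\<rparr>)"
  using assms by (auto simp: iso_def hom_def bij_betw_def subset_iff intro: inj_on_subset)

context finite_group_prime
begin

lemma sylow_conj: "sylow_subgroup p G S \<Longrightarrow> g \<in> carrier G \<Longrightarrow> sylow_subgroup p G (conj_elt G g ` S)"
  by (rule sylow_iso[OF is_group is_group conj_elt_iso])

lemma p_subgroup_in_sylow:
  assumes "p_subgroup p G P"
  obtains S where "sylow_subgroup p G S" "P \<subseteq> S"
proof -
  obtain S where S: "sylow_subgroup p G S"
    using sylow_exists by auto
  obtain x where x: "x \<in> carrier G" "conj_elt G x ` P \<subseteq> S"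
    using p_subgroup_conj_into_sylow[OF assms S] .
  have "P = conj_elt G (inv x) ` conj_elt G x ` P"
    using conj_image_inv(1)[OF x(1)] p_subgroupD(3)[OF assms] by simp
  also have "\<dots> \<subseteq> conj_elt G (inv x) ` S"
    using x(2) by (rule image_mono)
  finally show thesis
    using that sylow_conj[OF S, of "inv x"] x(1) by auto
qed

lemma sylow_eqI:
  assumes "sylow_subgroup p G S" "p_subgroup p G P" "S \<subseteq> P"
  shows "P = S"
  using card_seteq[OF p_subgroupD(2)[OF assms(2)] assms(3) p_subgroup_card_le_sylow[OF assms(2,1)]]
  by simp

lemma normal_p_subgroup_subset_sylow:
  assumes N: "N \<lhd> G" "p_subgroup p G N" and S: "sylow_subgroup p G S"
  shows "N \<subseteq> S"
proof -
  obtain x where x: "x \<in> carrier G" "conj_elt G x ` N \<subseteq> S"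
    using p_subgroup_conj_into_sylow[OF N(2) S] .
  have "conj_elt G (inv x) ` N \<subseteq> N"
    using N(1) x(1) normal_inv_iff by (auto simp: conj_elt_def) (metis inv_closed inv_inv)
  then have "conj_elt G x ` conj_elt G (inv x) ` N \<subseteq> conj_elt G x ` N"
    by (rule image_mono)
  then show ?thesis
    using x conj_image_inv(2)[OF x(1) p_subgroupD(3)[OF N(2)]] by simp
qed

text \<open>A normal \<open>p\<close>-subgroup lies in every Sylow subgroup, and the intersection of
  all of them is itself normal. This shows that the greatest element in the definition exists, and
  it makes the core easy to transport along isomorphisms.\<close>

lemma p_core_eq_Inter_sylow: "p_core p G = \<Inter>{S. sylow_subgroup p G S}"
  and p_core_normal: "p_core p G \<lhd> G"
  and p_core_p_subgroup: "p_subgroup p G (p_core p G)"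
  and p_core_greatest: "\<And>N. N \<lhd> G \<Longrightarrow> p_subgroup p G N \<Longrightarrow> N \<subseteq> p_core p G"
proof -
  let ?K = "\<Inter>{S. sylow_subgroup p G S}"
  obtain S where S: "sylow_subgroup p G S"
    using sylow_exists by auto
  have sub: "subgroup ?K G"
    using S by (intro subgroups_Inter) (auto simp: sylow_subgroup_def)
  have pK: "p_subgroup p G ?K"
    using S by (intro p_subgroup_mono[OF sylow_imp_p_subgroup[OF S] sub]) auto
  have "conj_elt G g x \<in> ?K" if g: "g \<in> carrier G" and x: "x \<in> ?K" for g x
  proof (intro InterI, clarify)
    fix R assume R: "sylow_subgroup p G R"
    then have "x \<in> conj_elt G (inv g) ` R"
      using x sylow_conj[OF R, of "inv g"] g by auto
    then show "conj_elt G g x \<in> R"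
      using g p_subgroupD(3)[OF sylow_imp_p_subgroup[OF R]] by auto
  qed
  then have nK: "?K \<lhd> G"
    using sub normal_inv_iff by (simp add: conj_elt_def)
  have le: "N \<subseteq> ?K" if "N \<lhd> G" "p_subgroup p G N" for N
    using normal_p_subgroup_subset_sylow[OF that] by auto
  have eq: "p_core p G = ?K"
    unfolding p_core_def using nK pK le by (intro Greatest_equality) auto
  show "p_core p G = ?K" "p_core p G \<lhd> G" "p_subgroup p G (p_core p G)"
    using eq nK pK by auto
  show "\<And>N. N \<lhd> G \<Longrightarrow> p_subgroup p G N \<Longrightarrow> N \<subseteq> p_core p G"
    using eq le by auto
qed

end

text \<open>Isomorphisms match up the Sylow subgroups, and an injective map commutes with their
  intersection.\<close>

lemma p_core_iso:
  assumes G: "finite_group_prime G p" and K: "finite_group_prime K p" and \<alpha>: "\<alpha> \<in> iso G K"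
  shows "\<alpha> ` p_core p G = p_core p K"
proof -
  interpret G: finite_group_prime G p by fact
  interpret K: finite_group_prime K p by fact
  have inj: "inj_on \<alpha> (carrier G)" and im: "\<alpha> ` carrier G = carrier K"
    using \<alpha> by (auto simp: iso_def bij_betw_def)
  have inv: "inv_into (carrier G) \<alpha> \<in> iso K G"
    using G.iso_set_sym[OF \<alpha>] .
  have eq: "{S. sylow_subgroup p K S} = (`) \<alpha> ` {S. sylow_subgroup p G S}"
  proof (intro equalityI subsetI)
    fix S assume "S \<in> {S. sylow_subgroup p K S}"
    then have S: "sylow_subgroup p K S"
      by simp
    then have "S \<subseteq> \<alpha> ` carrier G"
      using K.p_subgroupD(3)[OF K.sylow_imp_p_subgroup[OF S]] im by simp
    then have "S = \<alpha> ` inv_into (carrier G) \<alpha> ` S"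
      by (simp add: image_inv_into_cancel[OF refl])
    then show "S \<in> (`) \<alpha> ` {S. sylow_subgroup p G S}"
      using sylow_iso[OF K.is_group G.is_group inv S] by blast
  qed (use sylow_iso[OF G.is_group K.is_group \<alpha>] in auto)
  obtain S where "sylow_subgroup p G S"
    using G.sylow_exists by auto
  then have "\<alpha> ` \<Inter>{S. sylow_subgroup p G S} = (\<Inter>S\<in>{S. sylow_subgroup p G S}. \<alpha> ` S)"
    using image_INT[OF inj, of "{S. sylow_subgroup p G S}" "\<lambda>S. S"]
      G.p_subgroupD(3)[OF G.sylow_imp_p_subgroup] by auto
  then show ?thesis
    unfolding G.p_core_eq_Inter_sylow K.p_core_eq_Inter_sylow eq by simp
qed

context finite_group_prime
begin

lemma p_core_subgroup:
  assumes M: "subgroup M G"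
  shows "p_subgroup p G (p_core p (G\<lparr>carrier := M\<rparr>))"
    and "p_core p (G\<lparr>carrier := M\<rparr>) \<subseteq> M"
    and "g \<in> M \<Longrightarrow> a \<in> p_core p (G\<lparr>carrier := M\<rparr>) \<Longrightarrow> conj_elt G g a \<in> p_core p (G\<lparr>carrier := M\<rparr>)"
    and "p_subgroup p G A \<Longrightarrow> A \<subseteq> M \<Longrightarrow> (\<And>g a. g \<in> M \<Longrightarrow> a \<in> A \<Longrightarrow> conj_elt G g a \<in> A) \<Longrightarrow>
      A \<subseteq> p_core p (G\<lparr>carrier := M\<rparr>)"
proof -
  interpret M: finite_group_prime "G\<lparr>carrier := M\<rparr>" p
    using subgroup_locale[OF M] .
  show "p_subgroup p G (p_core p (G\<lparr>carrier := M\<rparr>))" "p_core p (G\<lparr>carrier := M\<rparr>) \<subseteq> M"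
    using M.p_core_p_subgroup p_subgroup_carrier_update_iff[OF M] by auto
  show "g \<in> M \<Longrightarrow> a \<in> p_core p (G\<lparr>carrier := M\<rparr>) \<Longrightarrow> conj_elt G g a \<in> p_core p (G\<lparr>carrier := M\<rparr>)"
    using M.p_core_normal normal_carrier_update_iff[OF M] by auto
  show "p_subgroup p G A \<Longrightarrow> A \<subseteq> M \<Longrightarrow> (\<And>g a. g \<in> M \<Longrightarrow> a \<in> A \<Longrightarrow> conj_elt G g a \<in> A) \<Longrightarrow>
      A \<subseteq> p_core p (G\<lparr>carrier := M\<rparr>)"
    using M.p_core_greatest normal_carrier_update_iff[OF M] p_subgroup_carrier_update_iff[OF M]
    by (meson p_subgroupD(1))
qed

lemma p_core_conj:
  assumes "subgroup M G" "\<alpha> \<in> iso G G"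
  shows "\<alpha> ` p_core p (G\<lparr>carrier := M\<rparr>) = p_core p (G\<lparr>carrier := \<alpha> ` M\<rparr>)"
  by (rule p_core_iso[OF subgroup_locale subgroup_locale iso_carrier_update[OF assms(2)]])
     (use assms subgroup.iso_subgroup[OF assms(1) is_group is_group assms(2)] subgroup.subset in auto)

text \<open>Inside the normalizer of \<open>W\<close>, a Sylow subgroup chosen to contain
  \<open>P\<close> contains the normal subgroup \<open>W\<close> as well, and so contains the
  product; no order of WP has to be computed.\<close>

lemma p_subgroup_product:
  assumes W: "p_subgroup p G W" and P: "p_subgroup p G P"
    and n: "\<And>u w. u \<in> P \<Longrightarrow> w \<in> W \<Longrightarrow> conj_elt G u w \<in> W"
  shows "p_subgroup p G (W <#> P)" "W \<subseteq> W <#> P" "P \<subseteq> W <#> P"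
proof -
  note Wc = p_subgroupD[OF W] and Pc = p_subgroupD[OF P]
  let ?M = "normalizer G W"
  have M: "subgroup ?M G"
    using normalizer_imp_subgroup[OF Wc(3)] .
  interpret M: finite_group_prime "G\<lparr>carrier := ?M\<rparr>" p
    using subgroup_locale[OF M] .
  have PM: "P \<subseteq> ?M"
    using n Pc(3) by (auto intro!: normalizerI Wc)
  have nW: "W \<lhd> G\<lparr>carrier := ?M\<rparr>"
    using subgroup_in_normalizer[OF Wc(1)] .
  have WM: "W \<subseteq> ?M"
    using subgroup_subset_normalizer[OF Wc(1)] .
  have PM': "p_subgroup p (G\<lparr>carrier := ?M\<rparr>) P" and WM': "p_subgroup p (G\<lparr>carrier := ?M\<rparr>) W"
    using p_subgroup_carrier_update_iff[OF M] P W PM WM by auto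
  obtain S where S: "sylow_subgroup p (G\<lparr>carrier := ?M\<rparr>) S" "P \<subseteq> S"
    using M.p_subgroup_in_sylow[OF PM'] .
  have WS: "W \<subseteq> S"
    using M.normal_p_subgroup_subset_sylow[OF nW WM' S(1)] .
  have pS: "p_subgroup p G S"
    using M.sylow_imp_p_subgroup[OF S(1)] p_subgroup_carrier_update_iff[OF M] by simp
  have "subgroup (W <#>\<^bsub>G\<lparr>carrier := ?M\<rparr>\<^esub> P) (G\<lparr>carrier := ?M\<rparr>)"
    using M.mult_norm_subgroup[OF nW] p_subgroupD(1) subgroup_carrier_update_iff[OF M] Pc(1) PM by simp
  then have sub: "subgroup (W <#> P) G"
    using subgroup_carrier_update_iff[OF M] by (simp add: mult_carrier_update)
  have "W <#> P \<subseteq> S"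
    using WS S(2) subgroup.m_closed[OF p_subgroupD(1)[OF pS]] by (auto simp: set_mult_def)
  then show "p_subgroup p G (W <#> P)"
    using p_subgroup_mono[OF pS sub] by simp
  show "W \<subseteq> W <#> P"
  proof
    fix w assume w: "w \<in> W"
    then have "w = w \<otimes> \<one>"
      using Wc(3) by auto
    then show "w \<in> W <#> P"
      using w Pc(4) by (auto simp: set_mult_def)
  qed
  show "P \<subseteq> W <#> P"
  proof
    fix w assume w: "w \<in> P"
    then have "w = \<one> \<otimes> w"
      using Pc(3) by auto
    then show "w \<in> W <#> P"
      using w Wc(4) by (auto simp: set_mult_def)
  qed
qed

text \<open>Thompson's \<open>A \<times> B\<close>-lemma, for \<open>A = P\<close> and \<open>B\<close> generated by \<open>y\<close>.\<close>

lemma A_times_B: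
  assumes P: "p_subgroup p G P" and F: "p_subgroup p G F" and y: "y \<in> carrier G" "coprime (ord y) p"
    and nF: "\<And>u a. u \<in> P \<Longrightarrow> a \<in> F \<Longrightarrow> conj_elt G u a \<in> F" "\<And>a. a \<in> F \<Longrightarrow> conj_elt G y a \<in> F"
    and yP: "\<And>u. u \<in> P \<Longrightarrow> y \<otimes> u = u \<otimes> y"
    and yC: "\<And>a. a \<in> F \<Longrightarrow> a \<in> centralizer G P \<Longrightarrow> conj_elt G y a = a"
    and a: "a \<in> F"
  shows "conj_elt G y a = a"
proof -
  note Pc = p_subgroupD[OF P] and Fc = p_subgroupD[OF F]
  \<comment> \<open>The fixed points of \<open>y\<close> in \<open>F\<close>. They are invariant
    under \<open>P\<close> because \<open>y\<close> commutes with \<open>P\<close>, so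
    \<open>fixed_coset\<close> applies as soon as they are not all of \<open>F\<close>.\<close>
  define D where "D = {a \<in> F. conj_elt G y a = a}"
  have D: "subgroup D G"
  proof (rule subgroupI)
    show "D \<subseteq> carrier G" "D \<noteq> {}"
      using Fc(3,4) y(1) by (auto simp: D_def)
    show "inv a \<in> D" if "a \<in> D" for a
      using that Fc(1,3) y(1) by (auto simp: D_def conj_elt_inv subgroup.m_inv_closed subset_iff)
    show "a \<otimes> b \<in> D" if "a \<in> D" "b \<in> D" for a b
      using that Fc(1,3) y(1) by (auto simp: D_def conj_elt_mult subgroup.m_closed subset_iff)
  qed
  have swap: "conj_elt G y (conj_elt G u b) = conj_elt G u (conj_elt G y b)" if "u \<in> P" "b \<in> F" for u b
    using that Pc(3) Fc(3) y(1) yP[OF that(1)] by (auto simp: subset_iff simp flip: conj_elt_comp)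
  have "D = F"
  proof (rule ccontr)
    assume "D \<noteq> F"
    then have "D \<subset> F"
      by (auto simp: D_def)
    then obtain b where b: "b \<in> F" "b \<notin> D" "\<And>u. u \<in> P \<Longrightarrow> conj_elt G u b \<otimes> inv b \<in> D"
    proof (rule fixed_coset[OF P F D])
      show "conj_elt G u a \<in> F" if "u \<in> P" "a \<in> F" for u a
        using nF(1)[OF that] .
      show "conj_elt G u a \<in> D" if "u \<in> P" "a \<in> D" for u a
        using that nF(1) swap by (auto simp: D_def)
    qed blast
    have bc: "b \<in> carrier G"
      using b(1) Fc(3) by auto
    \<comment> \<open>\<open>e\<close> measures how far \<open>y\<close> is from fixing
      \<open>b\<close>; the aim is to show that it is trivial.\<close>
    define e where "e = inv b \<otimes> conj_elt G y b"
    have e: "e \<in> F" "e \<in> carrier G"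
      using b(1) nF(2)[OF b(1)] Fc(1,3) by (auto simp: e_def subgroup.m_closed subgroup.m_inv_closed)
    \<comment> \<open>\<open>u\<close> sends \<open>b\<close> to \<open>d \<otimes> b\<close> with
      \<open>d\<close> fixed by \<open>y\<close>, so \<open>d\<close> cancels. Thus \<open>e\<close>
      centralizes \<open>P\<close>, and \<open>y\<close> fixes it by hypothesis.\<close>
    have "conj_elt G u e = e" if u: "u \<in> P" for u
    proof -
      have uc: "u \<in> carrier G"
        using u Pc(3) by auto
      define d where "d = conj_elt G u b \<otimes> inv b"
      have d: "d \<in> D" "d \<in> carrier G" "conj_elt G y d = d"
        using b(3)[OF u] uc bc by (auto simp: d_def D_def)
      have ub: "conj_elt G u b = d \<otimes> b"
        using uc bc by (simp add: d_def m_assoc)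
      have "conj_elt G u e = inv (conj_elt G u b) \<otimes> conj_elt G y (conj_elt G u b)"
        using uc bc y(1) swap[OF u b(1)] by (simp add: e_def conj_elt_mult conj_elt_inv)
      also have "\<dots> = inv b \<otimes> inv d \<otimes> (d \<otimes> conj_elt G y b)"
        using d bc y(1) by (simp add: ub conj_elt_mult inv_mult_group)
      also have "\<dots> = e"
        using d bc y(1) by (simp add: e_def m_assoc) (simp flip: m_assoc)
      finally show ?thesis .
    qed
    then have "e \<in> centralizer G P"
      using e Pc(3) conj_elt_eq_iff by (auto simp: centralizer_def subset_iff)
    then have ye: "conj_elt G y e = e"
      using yC e by auto
    have yb: "conj_elt G y b = b \<otimes> e"
      using bc y(1) by (simp add: e_def flip: m_assoc)
    \<comment> \<open>As \<open>y\<close> fixes \<open>e\<close>, each further application of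
      \<open>y\<close> contributes one more factor \<open>e\<close>. After \<open>ord y\<close>
      steps \<open>b\<close> is back, so the order of \<open>e\<close> divides \<open>ord y\<close>,
      which is impossible for a nontrivial \<open>p\<close>-element.\<close>
    have pow: "conj_elt G (y [^] k) b = b \<otimes> e [^] k" for k :: nat
    proof (induction k)
      case (Suc k)
      have ek: "conj_elt G y (e [^] k) = e [^] k"
        by (induction k) (use y(1) e ye in \<open>auto simp: conj_elt_mult\<close>)
      have "conj_elt G (y [^] Suc k) b = conj_elt G y (conj_elt G (y [^] k) b)"
        unfolding nat_pow_Suc2[OF y(1)] using conj_elt_comp[OF y(1) _ bc, of "y [^] k"] y(1) by simp
      also have "\<dots> = b \<otimes> e \<otimes> e [^] k"
        using Suc.IH y(1) bc e ek yb by (simp add: conj_elt_mult)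
      also have "\<dots> = b \<otimes> e [^] Suc k"
        using bc e nat_pow_Suc2[OF e(2), of k] by (simp add: m_assoc)
      finally show ?case .
    qed (use bc in simp)
    have "b \<otimes> e [^] ord y = b"
      using pow[of "ord y"] y(1) bc by simp
    then have "e [^] ord y = \<one>"
      using bc e by (metis l_cancel_one nat_pow_closed)
    then have "ord e dvd ord y"
      using pow_eq_id e(2) by simp
    then have "coprime (ord e) p"
      using y(2) coprime_divisors[of "ord e" "ord y" p p] by simp
    then have "e = \<one>"
      using trivial_element[OF F e(1)] by simp
    then have "b \<in> D"
      using yb b(1) bc by (simp add: D_def)
    then show False
      using b(2) by simp
  qed
  then show ?thesis
    using a by (auto simp: D_def)
qed

text \<open>The set \<open>Z\<close> is a parameter because two are needed: all
  \<open>p\<close>-central elements, and later the smaller set of those compatible with C.\<close>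

definition marked :: "'a set \<Rightarrow> 'a set \<Rightarrow> bool" where
  "marked Z Q \<longleftrightarrow> p_subgroup p G Q \<and> (\<exists>x\<in>Q. x \<in> Z \<and> x \<in> centralizer G Q)"

abbreviation distinguished :: "'a set \<Rightarrow> bool" where
  "distinguished \<equiv> marked (Collect (p_central p G))"

text \<open>Let x be \<open>p\<close>-central in Z(Q), and let F be the \<open>p\<close>-core of the
  normalizer of \<langle>x\<rangle>, which has characteristic \<open>p\<close>. An element y of
  order prime to \<open>p\<close> that centralizes \<open>W\<close> also centralizes F \<inter>
  C(Q), which lies in \<open>W\<close>; by the A \<times> B-lemma it centralizes F, so it lies in
  the \<open>p\<close>-group F and is trivial. Hence C(W) is a \<open>p\<close>-group, and being
  normal in N_M(Q) it lies in \<open>W\<close>. The subgroup \<open>M\<close> allows the same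
  argument inside G, C and H.\<close>

lemma distinguished_p_core_centric:
  assumes pc: "parabolic_characteristic_p p G" and Q: "distinguished Q"
    and M: "subgroup M G" "Q \<subseteq> M" "centralizer G Q \<subseteq> M"
  defines "W \<equiv> p_core p (G\<lparr>carrier := M \<inter> normalizer G Q\<rparr>)"
  shows "Q \<subseteq> W" "centralizer G W \<subseteq> W"
proof -
  have pQ: "p_subgroup p G Q"
    using Q by (simp add: marked_def)
  note Qc = p_subgroupD[OF pQ]
  obtain x where x: "x \<in> Q" "p_central p G x" "x \<in> centralizer G Q"
    using Q by (auto simp: marked_def)
  then obtain S where S: "sylow_subgroup p G S" "x \<in> S" "x \<in> centralizer G S" and ordx: "ord x = p"
    using group_center_carrier_update p_subgroupD(3)[OF sylow_imp_p_subgroup]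
    by (fastforce simp: p_central_def)
  have xc: "x \<in> carrier G"
    using x(1) Qc(3) by auto
  \<comment> \<open>The normalizer of \<open>R\<close> contains the centralizer of \<open>x\<close>,
    hence a Sylow subgroup in whose centre \<open>x\<close> lies; so it is \<open>p\<close>-local
    and parabolic.\<close>
  define R where "R = generate G {x}"
  have R: "subgroup R G"
    using generate_is_subgroup[of "{x}"] xc by (simp add: R_def)
  have cardR: "card R = p"
    using generate_pow_card[OF xc] ordx by (simp add: R_def)
  then have R1: "R \<noteq> {\<one>}"
    using p_gt_1 by auto
  have pR: "p_subgroup p G R"
    using R cardR by (auto simp: p_subgroup_def intro: exI[of _ 1])
  let ?N = "normalizer G R"
  have N: "subgroup ?N G"
    using normalizer_imp_subgroup[OF subgroup.subset[OF R]] .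
  have comm_N: "g \<in> ?N" if g: "g \<in> carrier G" "g \<otimes> x = x \<otimes> g" for g
  proof -
    have "R \<subseteq> centralizer G {g}"
      unfolding R_def
      by (rule generate_subgroup_incl[OF _ subgroup_centralizer]) (use g xc in \<open>auto simp: centralizer_def\<close>)
    then have "g \<in> centralizer G R"
      using g(1) by (auto simp: centralizer_def)
    then show ?thesis
      using centralizer_subset_normalizer[OF subgroup.subset[OF R]] by auto
  qed
  have "S \<subseteq> ?N"
    using S(3) p_subgroupD(3)[OF sylow_imp_p_subgroup[OF S(1)]] by (auto simp: centralizer_def intro!: comm_N)
  then have "parabolic p G ?N" "p_local p G ?N"
    using N S(1) pR R1 by (auto simp: parabolic_def p_local_def)
  then have char: "characteristic_p p (G\<lparr>carrier := ?N\<rparr>)"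
    using pc by (simp add: parabolic_characteristic_p_def)
  define F where "F = p_core p (G\<lparr>carrier := ?N\<rparr>)"
  note F = p_core_subgroup[OF N, folded F_def]
  have cF: "centralizer G F \<inter> ?N \<subseteq> F"
    using char by (simp add: characteristic_p_def F_def centralizer_carrier_update normalizer_closed
        subgroup.subset[OF R])
  define B where "B = centralizer G Q"
  have B: "subgroup B G"
    using subgroup_centralizer[OF Qc(3)] by (simp add: B_def)
  have BN: "B \<subseteq> ?N"
    using x(1) by (auto simp: B_def centralizer_def intro!: comm_N)
  have QN: "Q \<subseteq> ?N"
    using x(3) Qc(3) by (auto simp: centralizer_def intro!: comm_N)
  define R0 where "R0 = p_core p (G\<lparr>carrier := B\<rparr>)"
  note R0 = p_core_subgroup[OF B, folded R0_def]
  \<comment> \<open>\<open>F\<close> is normal in \<open>?N\<close>, which contains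
    \<open>B\<close>; so \<open>F \<inter> B\<close> is a normal \<open>p\<close>-subgroup of
    \<open>B\<close>.\<close>
  have FB: "F \<inter> B \<subseteq> R0"
  proof (rule R0(4))
    show "p_subgroup p G (F \<inter> B)"
      using p_subgroup_mono[OF F(1)] subgroups_Inter_pair[OF p_subgroupD(1)[OF F(1)] B] by simp
    show "conj_elt G g a \<in> F \<inter> B" if "g \<in> B" "a \<in> F \<inter> B" for g a
      using that F(3) BN subgroup_conj_closed[OF B] by auto
  qed simp
  let ?Nm = "M \<inter> normalizer G Q"
  have Nm: "subgroup ?Nm G"
    using subgroups_Inter_pair[OF M(1) normalizer_imp_subgroup[OF Qc(3)]] .
  note W = p_core_subgroup[OF Nm, folded W_def]
  have BNm: "B \<subseteq> ?Nm"
    using M(3) centralizer_subset_normalizer[OF Qc(3)] by (auto simp: B_def)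
  have conjB: "conj_elt G g a \<in> B" if "g \<in> normalizer G Q" "a \<in> B" for g a
  proof -
    have g: "g \<in> carrier G" "conj_elt G g ` Q = Q"
      using normalizerD[OF Qc(3) that(1)] by auto
    have a: "a \<in> carrier G" "\<And>u. u \<in> Q \<Longrightarrow> a \<otimes> u = u \<otimes> a"
      using that(2) by (auto simp: B_def centralizer_def)
    have "conj_elt G g a \<otimes> v = v \<otimes> conj_elt G g a" if v: "v \<in> Q" for v
    proof -
      obtain u where u: "u \<in> Q" "v = conj_elt G g u"
        using g(2) v by auto
      then have "u \<in> carrier G"
        using Qc(3) by auto
      then show ?thesis
        using a(2)[OF u(1)] u(2) g(1) a(1) by (simp flip: conj_elt_mult)
    qed
    then show ?thesis
      using g a by (simp add: B_def centralizer_def)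
  qed
  \<comment> \<open>The normalizer of \<open>Q\<close> normalizes \<open>B\<close>, hence also its
    characteristic subgroup \<open>R0\<close>.\<close>
  have "R0 \<subseteq> W"
  proof (rule W(4)[OF R0(1)])
    show "R0 \<subseteq> ?Nm"
      using R0(2) BNm by auto
    show "conj_elt G g a \<in> R0" if "g \<in> ?Nm" "a \<in> R0" for g a
    proof -
      have g: "g \<in> carrier G" "g \<in> normalizer G Q"
        using that normalizer_closed[OF Qc(3)] by auto
      have "conj_elt G g ` B = B"
        using conjB[OF g(2)] fin_subgroup[OF B] inj_on_subset[OF inj_on_conj_elt[OF g(1)] subgroup.subset[OF B]]
        by (intro endo_inj_surj) auto
      then show ?thesis
        using p_core_conj[OF B conj_elt_iso[OF g(1)]] that(2) by (auto simp: R0_def)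
    qed
  qed
  show QW: "Q \<subseteq> W"
    using M(2) subgroup_subset_normalizer[OF Qc(1)] normalizerD(3)[OF Qc(3)] by (intro W(4)[OF pQ]) auto
  have Wc: "W \<subseteq> carrier G"
    using p_subgroupD(3)[OF W(1)] .
  define Z where "Z = centralizer G W"
  have Z: "subgroup Z G"
    using subgroup_centralizer[OF Wc] by (simp add: Z_def)
  have ZB: "Z \<subseteq> B"
    using QW centralizer_anti_mono by (simp add: Z_def B_def)
  have "p_subgroup p G Z"
  proof (rule p_subgroupI_no_coprime[OF Z])
    fix y assume y: "y \<in> Z" "coprime (ord y) p"
    have yc: "y \<in> carrier G" and yW: "\<And>u. u \<in> W \<Longrightarrow> y \<otimes> u = u \<otimes> y"
      using y(1) by (auto simp: Z_def centralizer_def)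
    have yN: "y \<in> ?N"
      using y(1) ZB BN by auto
    have Fc: "F \<subseteq> carrier G"
      using p_subgroupD(3)[OF F(1)] .
    \<comment> \<open>The A \<times> B-lemma for \<open>Q\<close> and \<open>y\<close> acting on
      \<open>F\<close>; both lie in \<open>?N\<close> because they commute with
      \<open>x\<close>.\<close>
    have "conj_elt G y a = a" if "a \<in> F" for a
    proof (rule A_times_B[OF pQ F(1) yc y(2) _ _ _ _ that])
      show "conj_elt G u a \<in> F" if "u \<in> Q" "a \<in> F" for u a
        using F(3) QN that by auto
      show "conj_elt G y a \<in> F" if "a \<in> F" for a
        using F(3) yN that by auto
      show "y \<otimes> u = u \<otimes> y" if "u \<in> Q" for u
        using yW QW that by auto
      show "conj_elt G y a = a" if "a \<in> F" "a \<in> centralizer G Q" for a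
        using yW[of a] that FB \<open>R0 \<subseteq> W\<close> conj_elt_eq_iff[OF yc, of a] Fc by (auto simp: B_def)
    qed
    then have "y \<in> centralizer G F"
      using conj_elt_eq_iff[OF yc] Fc yc by (auto simp: centralizer_def subset_iff)
    then have "y \<in> F"
      using cF yN by auto
    then show "y = \<one>"
      using trivial_element[OF F(1) _ y(2)] by simp
  qed
  then have "Z \<subseteq> W"
  proof (rule W(4))
    show "Z \<subseteq> ?Nm"
      using ZB BNm by auto
    show "conj_elt G g a \<in> Z" if g: "g \<in> ?Nm" and a: "a \<in> Z" for g a
    proof -
      have gc: "g \<in> carrier G"
        using g normalizer_closed[OF Qc(3)] by auto
      have ac: "a \<in> carrier G"
        using a by (auto simp: Z_def centralizer_def)
      have "conj_elt G g a \<otimes> v = v \<otimes> conj_elt G g a" if v: "v \<in> W" for v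
      proof -
        have vc: "v \<in> carrier G"
          using v Wc by auto
        have "inv g \<in> ?Nm"
          using subgroup.m_inv_closed[OF Nm g] .
        then have u: "conj_elt G (inv g) v \<in> W" (is "?u \<in> W")
          using W(3) v by blast
        then have "a \<otimes> ?u = ?u \<otimes> a"
          using a by (auto simp: Z_def centralizer_def)
        then have "conj_elt G g (a \<otimes> ?u) = conj_elt G g (?u \<otimes> a)"
          by simp
        then show ?thesis
          using gc ac vc by (simp add: conj_elt_mult)
      qed
      then show ?thesis
        using gc ac by (simp add: Z_def centralizer_def)
    qed
  qed
  then show "centralizer G W \<subseteq> W"
    by (simp add: Z_def)
qed

section \<open>Invariance under automorphisms, since N_G(T) need not act on H by inner ones\<close>

context
  fixes \<alpha> assumes \<alpha>: "\<alpha> \<in> iso G G"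
begin

interpretation \<alpha>: group_hom G G \<alpha>
  using \<alpha> by unfold_locales (simp add: iso_def)

lemma aut_inj: "inj_on \<alpha> (carrier G)"
  and aut_image: "\<alpha> ` carrier G = carrier G"
  and aut_closed: "x \<in> carrier G \<Longrightarrow> \<alpha> x \<in> carrier G"
  using \<alpha> by (auto simp: iso_def bij_betw_def)

lemma aut_image_eqI:
  assumes "A \<subseteq> carrier G" "B \<subseteq> carrier G" "\<And>g. g \<in> carrier G \<Longrightarrow> \<alpha> g \<in> B \<longleftrightarrow> g \<in> A"
  shows "\<alpha> ` A = B"
proof -
  have "b \<in> \<alpha> ` A" if b: "b \<in> B" for b
  proof -
    have "b \<in> \<alpha> ` carrier G"
      using b assms(2) aut_image by blast
    then obtain g where "g \<in> carrier G" "b = \<alpha> g"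
      by blast
    then show ?thesis
      using b assms(3)[of g] by simp
  qed
  then show ?thesis
    using assms(1,3) by auto
qed

lemma aut_image_subset_iff:
  "A \<subseteq> carrier G \<Longrightarrow> B \<subseteq> carrier G \<Longrightarrow> \<alpha> ` A \<subseteq> \<alpha> ` B \<longleftrightarrow> A \<subseteq> B"
  using aut_inj by (rule inj_on_image_subset_iff)

lemma aut_image_Int:
  "A \<subseteq> carrier G \<Longrightarrow> B \<subseteq> carrier G \<Longrightarrow> \<alpha> ` (A \<inter> B) = \<alpha> ` A \<inter> \<alpha> ` B"
  using aut_inj by (rule inj_on_image_Int)

lemma aut_conj: "g \<in> carrier G \<Longrightarrow> x \<in> carrier G \<Longrightarrow> \<alpha> (conj_elt G g x) = conj_elt G (\<alpha> g) (\<alpha> x)"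
  by (simp add: conj_elt_def)

lemma aut_p_subgroup:
  assumes "p_subgroup p G P"
  shows "p_subgroup p G (\<alpha> ` P)"
  using assms subgroup.iso_subgroup[OF p_subgroupD(1)[OF assms] is_group is_group \<alpha>]
    card_image[OF inj_on_subset[OF aut_inj p_subgroupD(3)[OF assms]]]
  by (simp add: p_subgroup_def)

lemma aut_normalizer:
  assumes A: "A \<subseteq> carrier G"
  shows "\<alpha> ` normalizer G A = normalizer G (\<alpha> ` A)"
proof (rule aut_image_eqI)
  have aA: "\<alpha> ` A \<subseteq> carrier G"
    using image_mono[OF A, of \<alpha>] aut_image by simp
  show "normalizer G A \<subseteq> carrier G" "normalizer G (\<alpha> ` A) \<subseteq> carrier G"
    using normalizer_closed A aA by auto
  show "\<alpha> g \<in> normalizer G (\<alpha> ` A) \<longleftrightarrow> g \<in> normalizer G A" if g: "g \<in> carrier G" for g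
  proof -
    have "conj_elt G (\<alpha> g) ` \<alpha> ` A = \<alpha> ` conj_elt G g ` A"
      using g A unfolding image_image by (intro image_cong refl) (auto simp: aut_conj)
    moreover have "conj_elt G g ` A \<subseteq> carrier G"
      using g A by auto
    ultimately show ?thesis
      using g A inj_on_image_eq_iff[OF aut_inj, of "conj_elt G g ` A" A] aut_closed[OF g]
        aA by (simp add: normalizer_eq)
  qed
qed

lemma aut_centralizer_iff:
  assumes "A \<subseteq> carrier G" "g \<in> carrier G"
  shows "\<alpha> g \<in> centralizer G (\<alpha> ` A) \<longleftrightarrow> g \<in> centralizer G A"
proof -
  have "\<alpha> g \<otimes> \<alpha> a = \<alpha> a \<otimes> \<alpha> g \<longleftrightarrow> g \<otimes> a = a \<otimes> g" if "a \<in> A" for a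
  proof -
    have a: "a \<in> carrier G"
      using that assms(1) by auto
    then show ?thesis
      using assms(2) inj_on_eq_iff[OF aut_inj, of "g \<otimes> a" "a \<otimes> g"] by simp
  qed
  then show ?thesis
    using assms aut_closed by (auto simp: centralizer_def)
qed

lemma aut_centralizer: "A \<subseteq> carrier G \<Longrightarrow> \<alpha> ` centralizer G A = centralizer G (\<alpha> ` A)"
  using aut_centralizer_iff by (intro aut_image_eqI) (auto simp: centralizer_def)

lemma aut_ord: "x \<in> carrier G \<Longrightarrow> ord (\<alpha> x) = ord x"
proof -
  assume x: "x \<in> carrier G"
  have "\<alpha> x [^] n = \<one> \<longleftrightarrow> x [^] n = \<one>" for n :: nat
    using x \<alpha>.hom_nat_pow[OF x, of n] inj_on_eq_iff[OF aut_inj, of "x [^] n" \<one>] by simp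
  then show ?thesis
    using x aut_closed by (simp add: ord_unique pow_eq_id)
qed

lemma aut_p_central:
  assumes "p_central p G x"
  shows "p_central p G (\<alpha> x)"
proof -
  obtain S where S: "sylow_subgroup p G S" "x \<in> group_center (G\<lparr>carrier := S\<rparr>)" and x: "x \<in> carrier G" "ord x = p"
    using assms by (auto simp: p_central_def)
  note Sc = p_subgroupD(3)[OF sylow_imp_p_subgroup[OF S(1)]]
  have S': "sylow_subgroup p G (\<alpha> ` S)"
    using sylow_iso[OF is_group is_group \<alpha> S(1)] .
  have "\<alpha> x \<in> group_center (G\<lparr>carrier := \<alpha> ` S\<rparr>)"
    using S(2) x aut_centralizer_iff[OF Sc x(1)] p_subgroupD(3)[OF sylow_imp_p_subgroup[OF S']] Sc
    by (auto simp: group_center_carrier_update)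
  then show ?thesis
    using S' x aut_ord aut_closed by (auto simp: p_central_def)
qed

lemma aut_marked:
  assumes "marked Z Q" "\<And>x. x \<in> Z \<Longrightarrow> \<alpha> x \<in> Z"
  shows "marked Z (\<alpha> ` Q)"
  using assms aut_p_subgroup[of Q] aut_centralizer[OF p_subgroupD(3), of Q]
  by (fastforce simp: marked_def)

lemma aut_centric_radicals:
  assumes "Q \<in> centric_radicals p G"
  shows "\<alpha> ` Q \<in> centric_radicals p G"
proof -
  have Q: "p_subgroup p G Q" "Q \<noteq> {\<one>}" "p_centric p G Q" "Q = p_core p (G\<lparr>carrier := normalizer G Q\<rparr>)"
    using assms by (auto simp: centric_radicals_def p_radical_def)
  note Qc = p_subgroupD[OF Q(1)]
  have aQ: "p_subgroup p G (\<alpha> ` Q)"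
    using aut_p_subgroup[OF Q(1)] .
  note aQc = p_subgroupD[OF aQ]
  have C: "subgroup (centralizer G Q) G" and aC: "subgroup (centralizer G (\<alpha> ` Q)) G"
    using subgroup_centralizer Qc(3) aQc(3) by auto
  have "sylow_subgroup p (G\<lparr>carrier := \<alpha> ` centralizer G Q\<rparr>) (\<alpha> ` group_center (G\<lparr>carrier := Q\<rparr>))"
    using Q(3) aC subgroup_imp_group[OF C] subgroup_imp_group[OF aC]
    by (intro sylow_iso[OF _ _ iso_carrier_update[OF \<alpha> subgroup.subset[OF C]]])
       (auto simp: p_centric_def aut_centralizer[OF Qc(3)])
  moreover have "\<alpha> ` group_center (G\<lparr>carrier := Q\<rparr>) = group_center (G\<lparr>carrier := \<alpha> ` Q\<rparr>)"
    using aut_image_Int[OF subgroup.subset[OF C] Qc(3)]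
    by (simp add: group_center_carrier_update Qc(3) aQc(3) aut_centralizer)
  ultimately have "p_centric p G (\<alpha> ` Q)"
    using aQ by (simp add: p_centric_def aut_centralizer[OF Qc(3)])
  moreover have "\<alpha> ` Q = p_core p (G\<lparr>carrier := normalizer G (\<alpha> ` Q)\<rparr>)"
    using p_core_conj[OF normalizer_imp_subgroup[OF Qc(3)] \<alpha>] Q(4) aut_normalizer[OF Qc(3)] by metis
  moreover have "\<alpha> ` Q \<noteq> {\<one>}"
  proof
    assume "\<alpha> ` Q = {\<one>}"
    then have "\<alpha> ` Q = \<alpha> ` {\<one>}"
      by simp
    then show False
      using inj_on_image_eq_iff[OF aut_inj Qc(3), of "{\<one>}"] Q(2) by simp
  qed
  ultimately show ?thesis
    using aQ by (simp add: centric_radicals_def p_radical_def)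
qed

end

text \<open>The marking element lies in Z(R), hence in \<open>K\<close>, and it centralizes the
  smaller group \<open>K\<close> a fortiori.\<close>

lemma marked_subset:
  assumes "marked Z R" "subgroup K G" "K \<subseteq> R" "R \<inter> centralizer G R \<subseteq> K"
  shows "marked Z K"
  using assms p_subgroup_mono[OF _ assms(2,3)] centralizer_anti_mono[OF assms(3)]
  unfolding marked_def by blast

text \<open>Sylow's theorem in C(R) conjugates x into Z(R). The conjugating element centralizes
  \<open>R\<close>, so undoing the conjugation changes nothing and x was already in
  \<open>R\<close>.\<close>

lemma p_centricD:
  assumes R: "p_centric p G R" and P: "p_subgroup p G P" and x: "x \<in> P" "x \<in> centralizer G R"
  shows "x \<in> R"
proof -
  have pR: "p_subgroup p G R"
    using R by (simp add: p_centric_def)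
  note Rc = p_subgroupD[OF pR]
  let ?B = "centralizer G R"
  have B: "subgroup ?B G"
    using subgroup_centralizer[OF Rc(3)] .
  interpret B: finite_group_prime "G\<lparr>carrier := ?B\<rparr>" p
    using subgroup_locale[OF B] .
  have S: "sylow_subgroup p (G\<lparr>carrier := ?B\<rparr>) (?B \<inter> R)"
    using R by (simp add: p_centric_def group_center_carrier_update Rc(3))
  have "p_subgroup p G (P \<inter> ?B)"
    using p_subgroup_mono[OF P] subgroups_Inter_pair[OF p_subgroupD(1)[OF P] B] by simp
  then have "p_subgroup p (G\<lparr>carrier := ?B\<rparr>) (P \<inter> ?B)"
    using p_subgroup_carrier_update_iff[OF B] by simp
  then obtain g where g: "g \<in> ?B" "conj_elt (G\<lparr>carrier := ?B\<rparr>) g ` (P \<inter> ?B) \<subseteq> ?B \<inter> R"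
    using B.p_subgroup_conj_into_sylow[OF _ S] by auto
  have gc: "g \<in> carrier G" and xc: "x \<in> carrier G"
    using g(1) x(2) by (auto simp: centralizer_def)
  have "conj_elt (G\<lparr>carrier := ?B\<rparr>) g x = conj_elt G g x"
    using g(1) B by (simp add: conj_elt_def)
  then have v: "conj_elt G g x \<in> R"
    using g(2) x by auto
  have "inv g \<in> ?B"
    using subgroup.m_inv_closed[OF B g(1)] .
  then have "conj_elt G (inv g) (conj_elt G g x) = conj_elt G g x"
    using v gc xc conj_elt_eq_iff[of "inv g" "conj_elt G g x"] by (simp add: centralizer_def del: conj_elt_inv_cancel)
  then show ?thesis
    using v gc xc by simp
qed

lemma p_centricI:
  assumes R: "p_subgroup p G R" and c: "centralizer G R \<subseteq> R"
  shows "p_centric p G R"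
proof -
  note Rc = p_subgroupD[OF R]
  have B: "subgroup (centralizer G R) G"
    using subgroup_centralizer[OF Rc(3)] .
  interpret B: finite_group_prime "G\<lparr>carrier := centralizer G R\<rparr>" p
    using subgroup_locale[OF B] .
  obtain n where n: "card (centralizer G R) = p ^ n"
    using p_subgroup_mono[OF R B c] by (auto simp: p_subgroup_def)
  have "sylow_subgroup p (G\<lparr>carrier := centralizer G R\<rparr>) (centralizer G R)"
    using n B.subgroup_self prime_p p_gt_1
    by (simp add: sylow_subgroup_def Coset.order_def multiplicity_same_power)
  moreover have "group_center (G\<lparr>carrier := R\<rparr>) = centralizer G R"
    using c by (auto simp: group_center_carrier_update Rc(3))
  ultimately show ?thesis
    using R by (simp add: p_centric_def)
qed

lemma nat_pow_in_subgroup: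
  "subgroup H G \<Longrightarrow> x \<in> H \<Longrightarrow> x [^] (k::nat) \<in> H"
  by (induction k) (auto intro: subgroup.m_closed subgroup.one_closed)

text \<open>An element of order \<open>p\<close> in the centre of a Sylow subgroup containing
  \<open>V\<close> is \<open>p\<close>-central and centralizes \<open>V\<close>; the closure
  condition then puts it into \<open>V\<close>. That condition is shared by centric subgroups and by
  those containing their centralizer.\<close>

lemma distinguishedI:
  assumes dvd: "p dvd Coset.order G" and V: "p_subgroup p G V"
    and c: "\<And>P x. p_subgroup p G P \<Longrightarrow> x \<in> P \<Longrightarrow> x \<in> centralizer G V \<Longrightarrow> x \<in> V"
  shows "distinguished V"
proof -
  obtain S where S: "sylow_subgroup p G S" "V \<subseteq> S"
    using p_subgroup_in_sylow[OF V] .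
  note pS = sylow_imp_p_subgroup[OF S(1)]
  note Sc = p_subgroupD[OF pS]
  have "Coset.order G \<noteq> 0"
    using order_gt_0_iff_finite fin by simp
  then have "multiplicity p (Coset.order G) \<noteq> 0"
    using dvd p_gt_1 by (simp add: multiplicity_eq_zero_iff)
  then have "card S > 1"
    using S(1) p_gt_1 one_less_power[OF p_gt_1] by (simp add: sylow_subgroup_def)
  then have "S \<noteq> {\<one>}"
    by auto
  then obtain x where x: "x \<in> S" "x \<noteq> \<one>" "\<And>u. u \<in> S \<Longrightarrow> x \<otimes> u = u \<otimes> x"
    using center_nontrivial[OF pS] by metis
  obtain k where k: "ord (x [^] (k::nat)) = p"
    using exists_element_of_order_p[OF pS x(1,2)] .
  define z where "z = x [^] k"
  have "subgroup (centralizer G S \<inter> S) G"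
    using subgroups_Inter_pair[OF subgroup_centralizer[OF Sc(3)] Sc(1)] .
  moreover have "x \<in> centralizer G S \<inter> S"
    using x Sc(3) by (auto simp: centralizer_def)
  ultimately have z: "z \<in> centralizer G S \<inter> S"
    unfolding z_def by (rule nat_pow_in_subgroup)
  then have "p_central p G z"
    using S(1) k Sc(3) by (auto simp: p_central_def z_def group_center_carrier_update)
  moreover have "z \<in> centralizer G V"
    using z centralizer_anti_mono[OF S(2)] by auto
  ultimately show ?thesis
    using V c[OF pS] z by (auto simp: marked_def)
qed

text \<open>Enlarging a subgroup shrinks its centralizer, so containing the centralizer is inherited
  upwards. This keeps the products occurring in the cones distinguished.\<close>

lemma distinguishedI_centralizer:
  assumes "p dvd Coset.order G" "p_subgroup p G V" "W \<subseteq> V" "centralizer G W \<subseteq> W"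
  shows "distinguished V"
  using distinguishedI[OF assms(1,2)] centralizer_anti_mono[OF assms(3)] assms(3,4) by blast

lemma centric_radicals_nontrivial:
  assumes "Q \<in> centric_radicals p G"
  shows "p dvd Coset.order G"
proof -
  have Q: "p_subgroup p G Q" "Q \<noteq> {\<one>}"
    using assms by (auto simp: centric_radicals_def)
  then have "{\<one>} \<subset> Q"
    using p_subgroupD(4) by auto
  then have "p dvd card Q"
    using p_dvd_index[OF Q(1) triv_subgroup] card_subgroup_index[OF triv_subgroup p_subgroupD(1)[OF Q(1)]]
    by (simp add: psubset_eq)
  then show ?thesis
    using lagrange[OF p_subgroupD(1)[OF Q(1)]] by (metis dvd_trans dvd_triv_right)
qed

lemma centric_radicals_distinguished:
  assumes "Q \<in> centric_radicals p G"
  shows "distinguished Q"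
  using distinguishedI[OF centric_radicals_nontrivial[OF assms]] p_centricD assms
  by (auto simp: centric_radicals_def)

text \<open>Read contrapositively, together with \<open>distinguished_p_core_centric\<close>, it
  makes the cone point strict: a distinguished subgroup outside the poset is properly contained in
  the core of its normalizer.\<close>

lemma centric_radicalsI:
  assumes Q: "distinguished Q" and "centralizer G Q \<subseteq> Q" "Q = p_core p (G\<lparr>carrier := normalizer G Q\<rparr>)"
  shows "Q \<in> centric_radicals p G"
proof -
  have pQ: "p_subgroup p G Q"
    using Q by (simp add: marked_def)
  obtain x where "x \<in> Q" "ord x = p"
    using Q by (auto simp: marked_def p_central_def)
  then have "Q \<noteq> {\<one>}"
    using p_gt_1 by auto
  then show ?thesis
    using pQ p_centricI[OF pQ assms(2)] assms(3) by (simp add: centric_radicals_def p_radical_def)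
qed

lemma poset_auts_subgroups:
  assumes "\<And>n. n \<in> N \<Longrightarrow> \<Phi> n \<in> iso G G"
    and "\<And>y. y \<in> P \<Longrightarrow> p_subgroup p G y" "\<And>n y. n \<in> N \<Longrightarrow> y \<in> P \<Longrightarrow> \<Phi> n ` y \<in> P"
  shows "poset_auts N (\<lambda>n. (`) (\<Phi> n)) P"
proof -
  have sub: "P \<subseteq> Pow (carrier G)"
    using assms(2) p_subgroupD(3) by auto
  then have finP: "finite P"
    using fin by (meson finite_Pow_iff finite_subset)
  have "bij_betw ((`) (\<Phi> n)) P P" if n: "n \<in> N" for n
  proof -
    have "inj_on ((`) (\<Phi> n)) P"
      using inj_on_image_eq_iff[OF aut_inj[OF assms(1)[OF n]]] sub by (auto intro!: inj_onI)
    then show ?thesis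
      using assms(3)[OF n] finP endo_inj_surj[of P "(`) (\<Phi> n)"] by (auto simp: bij_betw_def)
  qed
  moreover have "\<Phi> n ` x \<subseteq> \<Phi> n ` y \<longleftrightarrow> x \<subseteq> y" if "n \<in> N" "x \<in> P" "y \<in> P" for n x y
    using aut_image_subset_iff[OF assms(1)[OF that(1)], of x y] that sub by auto
  ultimately show ?thesis
    using finP by (simp add: poset_auts_def)
qed

text \<open>In the applications \<open>z\<close> need not normalize \<open>W y\<close>, so it is
  first cut down to \<open>z \<inter> normalizer G y\<close>. This remains strictly above
  \<open>y\<close> because normalizers grow in \<open>p\<close>-groups, and it makes the product
  with \<open>W y\<close> a subgroup.\<close>

proposition complexes_equivalent_normalizer_growth:
  assumes \<Phi>: "\<And>n. n \<in> N \<Longrightarrow> \<Phi> n \<in> iso G G"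
    and P: "\<And>y. y \<in> P \<Longrightarrow> p_subgroup p G y" "\<And>n y. n \<in> N \<Longrightarrow> y \<in> P \<Longrightarrow> \<Phi> n ` y \<in> P"
    and Q: "Q \<subseteq> P" "\<And>n y. n \<in> N \<Longrightarrow> y \<in> Q \<Longrightarrow> \<Phi> n ` y \<in> Q"
    and W: "\<And>y. y \<in> P - Q \<Longrightarrow> W y \<in> P" "\<And>y. y \<in> P - Q \<Longrightarrow> y \<subset> W y"
      "\<And>n y. n \<in> N \<Longrightarrow> y \<in> P - Q \<Longrightarrow> W (\<Phi> n ` y) = \<Phi> n ` W y"
    and z: "\<And>y z. y \<in> P - Q \<Longrightarrow> z \<in> P \<Longrightarrow> y \<subset> z \<Longrightarrow> z \<inter> normalizer G y \<in> P"
      "\<And>y z. y \<in> P - Q \<Longrightarrow> z \<in> P \<Longrightarrow> y \<subset> z \<Longrightarrow> W y <#> (z \<inter> normalizer G y) \<in> P"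
  shows "complexes_equivalent N (\<lambda>n. (`) (\<Phi> n)) P (\<lambda>n. (`) (\<Phi> n)) Q"
proof (rule complexes_equivalent_conical[where c = W and f = "\<lambda>y z. z \<inter> normalizer G y"
      and g = "\<lambda>y z. W y <#> (z \<inter> normalizer G y)"])
  show "poset_auts N (\<lambda>n. (`) (\<Phi> n)) P"
    using poset_auts_subgroups[OF \<Phi> P] .
  show "Q \<subseteq> P" "\<And>n y. n \<in> N \<Longrightarrow> y \<in> Q \<Longrightarrow> \<Phi> n ` y \<in> Q"
    "\<And>y. y \<in> P - Q \<Longrightarrow> W y \<in> P" "\<And>y. y \<in> P - Q \<Longrightarrow> y \<subset> W y"
    "\<And>n y. n \<in> N \<Longrightarrow> y \<in> P - Q \<Longrightarrow> W (\<Phi> n ` y) = \<Phi> n ` W y"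
    by (fact Q W)+
  note c = p_subgroupD[OF P(1)]
  have nc: "normalizer G y \<subseteq> carrier G" if "y \<in> P" for y
    using normalizer_closed[OF c(3)[OF that]] .
  fix y z assume y: "y \<in> P - Q" and zP: "z \<in> P" and yz: "y \<subset> z"
  show "z \<inter> normalizer G y \<in> P" "W y <#> (z \<inter> normalizer G y) \<in> P"
    by (fact z[OF y zP yz])+
  show "y \<subset> z \<inter> normalizer G y"
    using normalizer_grows[OF P(1) P(1) yz] y zP by auto
  show "z \<inter> normalizer G y \<subseteq> z"
    by simp
  have "\<one> \<in> z \<inter> normalizer G y"
    using c(4)[OF zP] subgroup.one_closed[OF normalizer_imp_subgroup[OF c(3)]] y by auto
  moreover have "\<one> \<in> W y" "W y \<subseteq> carrier G"
    using c(3,4)[OF W(1)[OF y]] by auto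
  ultimately show "z \<inter> normalizer G y \<subseteq> W y <#> (z \<inter> normalizer G y)" "W y \<subseteq> W y <#> (z \<inter> normalizer G y)"
    using c(3)[OF zP] by (force simp: set_mult_def)+
  show "z \<inter> normalizer G y \<subseteq> w \<inter> normalizer G y" "W y <#> (z \<inter> normalizer G y) \<subseteq> W y <#> (w \<inter> normalizer G y)"
    if "z \<subseteq> w" for w
    using that by (auto simp: set_mult_def)
  fix n assume n: "n \<in> N"
  have yP: "y \<in> P"
    using y by simp
  show eq: "\<Phi> n ` z \<inter> normalizer G (\<Phi> n ` y) = \<Phi> n ` (z \<inter> normalizer G y)"
    using aut_image_Int[OF \<Phi>[OF n] c(3)[OF zP] nc[OF yP]] aut_normalizer[OF \<Phi>[OF n] c(3)[OF yP]] by simp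
  have "\<Phi> n ` (W y <#> (z \<inter> normalizer G y)) = \<Phi> n ` W y <#> \<Phi> n ` (z \<inter> normalizer G y)"
    using set_mult_hom[of "\<Phi> n" G G "W y" "z \<inter> normalizer G y"] \<Phi>[OF n] c(3)[OF W(1)[OF y]] c(3)[OF zP]
    by (auto simp: iso_def)
  then show "W (\<Phi> n ` y) <#> (\<Phi> n ` z \<inter> normalizer G (\<Phi> n ` y)) = \<Phi> n ` (W y <#> (z \<inter> normalizer G y))"
    using W(3)[OF n y] eq by simp
qed

lemma set_mult_commute:
  assumes "W \<subseteq> carrier G" "subgroup P G"
    and n: "\<And>u w. u \<in> P \<Longrightarrow> w \<in> W \<Longrightarrow> conj_elt G u w \<in> W"
  shows "W <#> P = P <#> W"
proof (intro equalityI subsetI)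
  have Pc: "P \<subseteq> carrier G"
    using subgroup.subset[OF assms(2)] .
  fix a assume "a \<in> W <#> P"
  then obtain w u where a: "w \<in> W" "u \<in> P" "a = w \<otimes> u"
    by (auto simp: set_mult_def)
  have c: "w \<in> carrier G" "u \<in> carrier G"
    using a assms(1) Pc by auto
  have "a = u \<otimes> conj_elt G (inv u) w"
    using c a(3) by (simp add: conj_elt_def m_assoc) (simp flip: m_assoc)
  moreover have "conj_elt G (inv u) w \<in> W"
    using n subgroup.m_inv_closed[OF assms(2)] a by blast
  ultimately show "a \<in> P <#> W"
    using a(2) by (auto simp: set_mult_def)
next
  have Pc: "P \<subseteq> carrier G"
    using subgroup.subset[OF assms(2)] .
  fix a assume "a \<in> P <#> W"
  then obtain w u where a: "w \<in> W" "u \<in> P" "a = u \<otimes> w"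
    by (auto simp: set_mult_def)
  have c: "w \<in> carrier G" "u \<in> carrier G"
    using a assms(1) Pc by auto
  have "a = conj_elt G u w \<otimes> u"
    using c a(3) by (simp add: conj_elt_def m_assoc)
  then show "a \<in> W <#> P"
    using n[OF a(2,1)] a(2) by (auto simp: set_mult_def)
qed

lemma normalizer_Int:
  assumes "A \<subseteq> carrier G" "B \<subseteq> carrier G" "g \<in> normalizer G A" "g \<in> normalizer G B"
  shows "g \<in> normalizer G (A \<inter> B)"
  using normalizerD[OF assms(1,3)] normalizerD[OF assms(2,4)] assms(1,2)
  by (intro normalizerI) (auto intro: finite_subset[OF _ fin])

lemma normalizer_set_mult:
  assumes "A \<subseteq> carrier G" "B \<subseteq> carrier G" "g \<in> normalizer G A" "g \<in> normalizer G B"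
  shows "g \<in> normalizer G (A <#> B)"
proof -
  have AB: "A <#> B \<subseteq> carrier G"
    using set_mult_closed[OF assms(1,2)] .
  show ?thesis
  proof (rule normalizerI[OF finite_subset[OF AB fin] AB normalizerD(1)[OF assms(1,3)]])
    fix c assume "c \<in> A <#> B"
    then obtain a b where c: "a \<in> A" "b \<in> B" "c = a \<otimes> b"
      by (auto simp: set_mult_def)
    then have "conj_elt G g c = conj_elt G g a \<otimes> conj_elt G g b"
      using conj_elt_mult[of g a b] normalizerD(1)[OF assms(1,3)] assms(1,2) by auto
    then show "conj_elt G g c \<in> A <#> B"
      using normalizerD(3)[OF assms(1,3) c(1)] normalizerD(3)[OF assms(2,4) c(2)] by (auto simp: set_mult_def)
  qed
qed

lemma aut_p_core_normalizer:
  assumes "\<alpha> \<in> iso G G" "Q \<subseteq> carrier G" "subgroup M G" "\<alpha> ` M = M"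
  shows "p_core p (G\<lparr>carrier := M \<inter> normalizer G (\<alpha> ` Q)\<rparr>) = \<alpha> ` p_core p (G\<lparr>carrier := M \<inter> normalizer G Q\<rparr>)"
proof -
  have "\<alpha> ` (M \<inter> normalizer G Q) = M \<inter> normalizer G (\<alpha> ` Q)"
    using aut_image_Int[OF assms(1) subgroup.subset[OF assms(3)] normalizer_closed[OF assms(2)]]
      aut_normalizer[OF assms(1,2)] assms(4) by simp
  then show ?thesis
    using p_core_conj[OF subgroups_Inter_pair[OF assms(3) normalizer_imp_subgroup[OF assms(2)]] assms(1)]
    by simp
qed

end

section \<open>From \<open>\<D>(G)\<^sup>T\<close> to subgroups of \<open>L\<close>\<close>

locale fixed_point_setting = finite_group_prime G p for G :: "('a, 'b) monoid_scheme" (structure) and p :: nat +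
  fixes T C O_C L :: "'a set" and H :: "'a set monoid"
  assumes pcG: "parabolic_characteristic_p p G"
    and p_dvd: "p dvd Coset.order G"
    and pT: "p_subgroup p G T"
    and C_def: "C = T <#> centralizer G T"
    and O_C_def: "O_C = p_core p (G\<lparr>carrier := C\<rparr>)"
    and N1: "\<And>x. x \<in> O_C \<Longrightarrow> \<not> p_central p G x"
    and L_normal: "L \<lhd> G\<lparr>carrier := C\<rparr>" "L \<lhd> G\<lparr>carrier := normalizer G T\<rparr>" "O_C \<subseteq> L"
    and H_def: "H = G\<lparr>carrier := L\<rparr> Mod O_C"
    and pcH: "parabolic_characteristic_p p H"
    and N3: "\<exists>S_C S. sylow_subgroup p (G\<lparr>carrier := C\<rparr>) S_C \<and> sylow_subgroup p G S \<and> S_C \<subseteq> S \<and>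
      group_center (G\<lparr>carrier := S\<rparr>) \<inter> (S_C \<inter> L) \<noteq> {\<one>}"
begin

abbreviation N where "N \<equiv> normalizer G T"

lemmas Tc = p_subgroupD[OF pT]

lemma N_subgroup: "subgroup N G"
  using normalizer_imp_subgroup[OF Tc(3)] .

lemma N_carrier: "n \<in> N \<Longrightarrow> n \<in> carrier G"
  using normalizer_closed[OF Tc(3)] by auto

lemma conj_iso: "n \<in> N \<Longrightarrow> conj_elt G n \<in> iso G G"
  using N_carrier by (rule conj_elt_iso)

lemma centralizer_subset_C: "centralizer G T \<subseteq> C" and T_subset_C: "T \<subseteq> C"
  and C_subgroup: "subgroup C G" and C_subset_N: "C \<subseteq> N"
proof -
  have Cs: "subgroup (centralizer G T) G"
    using subgroup_centralizer[OF Tc(3)] .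
  show "centralizer G T \<subseteq> C"
  proof
    fix x assume x: "x \<in> centralizer G T"
    then have "x = \<one> \<otimes> x"
      by (auto simp: centralizer_def)
    then show "x \<in> C"
      using x Tc(4) by (auto simp: C_def set_mult_def)
  qed
  show "T \<subseteq> C"
  proof
    fix x assume x: "x \<in> T"
    then have "x = x \<otimes> \<one>"
      using Tc(3) by auto
    then show "x \<in> C"
      using x subgroup.one_closed[OF Cs] by (auto simp: C_def set_mult_def)
  qed
  interpret N: group "G\<lparr>carrier := N\<rparr>"
    using subgroup_imp_group[OF N_subgroup] .
  have "subgroup C (G\<lparr>carrier := N\<rparr>)"
    using N.mult_norm_subgroup[OF subgroup_in_normalizer[OF Tc(1)], of "centralizer G T"]
      subgroup_carrier_update_iff[OF N_subgroup] Cs centralizer_subset_normalizer[OF Tc(3)]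
    by (simp add: mult_carrier_update C_def)
  then show "subgroup C G" "C \<subseteq> N"
    using subgroup_carrier_update_iff[OF N_subgroup] by auto
qed

lemmas OC = p_core_subgroup[OF C_subgroup, folded O_C_def]

lemmas OCc = p_subgroupD[OF OC(1)]

lemma conj_T: "n \<in> N \<Longrightarrow> conj_elt G n ` T = T"
  using normalizerD[OF Tc(3)] by simp

lemma conj_C:
  assumes n: "n \<in> N"
  shows "conj_elt G n ` C = C"
proof -
  have "conj_elt G n ` C = conj_elt G n ` T <#> conj_elt G n ` centralizer G T"
    unfolding C_def using conj_iso[OF n] Tc(3)
    by (intro set_mult_hom) (auto simp: iso_def centralizer_def)
  then show ?thesis
    using aut_centralizer[OF conj_iso[OF n] Tc(3)] conj_T[OF n] by (simp add: C_def)
qed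

lemma conj_O_C: "n \<in> N \<Longrightarrow> conj_elt G n ` O_C = O_C"
  using p_core_conj[OF C_subgroup conj_iso] conj_C by (simp add: O_C_def)

lemma T_subset_O_C: "T \<subseteq> O_C"
  using OC(4)[OF pT T_subset_C] C_subset_N normalizerD(3)[OF Tc(3)] by auto

lemma L: "subgroup L G" "L \<subseteq> C" "n \<in> N \<Longrightarrow> x \<in> L \<Longrightarrow> conj_elt G n x \<in> L"
  using L_normal(1,2) normal_carrier_update_iff[OF C_subgroup] normal_carrier_update_iff[OF N_subgroup]
  by auto

lemma conj_L: "n \<in> N \<Longrightarrow> conj_elt G n ` L = L"
  using L(3) fin_subgroup[OF L(1)] inj_on_subset[OF inj_on_conj_elt[OF N_carrier] subgroup.subset[OF L(1)]]
  by (intro endo_inj_surj) auto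

text \<open>The \<open>p\<close>-central elements of \<open>G\<close> in \<open>L\<close> that are central in a Sylow subgroup compatible with
  \<open>C\<close>. Unlike an arbitrary \<open>p\<close>-central element of \<open>G\<close> in \<open>L\<close>, they stay \<open>p\<close>-central in \<open>H\<close>.\<close>

definition Z where
  "Z = {x \<in> L. ord x = p \<and> (\<exists>S_C S. sylow_subgroup p (G\<lparr>carrier := C\<rparr>) S_C \<and> sylow_subgroup p G S \<and>
     S_C \<subseteq> S \<and> x \<in> S \<and> x \<in> centralizer G S)}"

lemma Z_conj:
  assumes n: "n \<in> N" and x: "x \<in> Z"
  shows "conj_elt G n x \<in> Z"
proof -
  note \<alpha> = conj_iso[OF n]
  obtain S_C S where S: "sylow_subgroup p (G\<lparr>carrier := C\<rparr>) S_C" "sylow_subgroup p G S" "S_C \<subseteq> S"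
    "x \<in> S" "x \<in> centralizer G S" and xL: "x \<in> L" "ord x = p"
    using x by (auto simp: Z_def)
  have xc: "x \<in> carrier G"
    using xL(1) subgroup.subset[OF L(1)] by auto
  have Sc: "S \<subseteq> carrier G"
    using p_subgroupD(3)[OF sylow_imp_p_subgroup[OF S(2)]] .
  have "sylow_subgroup p (G\<lparr>carrier := C\<rparr>) (conj_elt G n ` S_C)"
    using sylow_iso[OF subgroup_imp_group[OF C_subgroup] subgroup_imp_group[OF C_subgroup] _ S(1)]
      iso_carrier_update[OF \<alpha> subgroup.subset[OF C_subgroup]] conj_C[OF n] by simp
  moreover have "sylow_subgroup p G (conj_elt G n ` S)"
    using sylow_conj[OF S(2) N_carrier[OF n]] .
  moreover have "conj_elt G n x \<in> centralizer G (conj_elt G n ` S)"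
    using aut_centralizer_iff[OF \<alpha> Sc xc] S(5) by simp
  ultimately show ?thesis
    unfolding Z_def using S(3,4) L(3)[OF n xL(1)] aut_ord[OF \<alpha> xc] xL(2) by blast
qed

lemma Z_p_central: "x \<in> Z \<Longrightarrow> p_central p G x"
  using subgroup.subset[OF L(1)] p_subgroupD(3)[OF sylow_imp_p_subgroup]
  by (fastforce simp: Z_def p_central_def group_center_carrier_update)

text \<open>(N3) provides one element x of \<open>Z\<close>, central in some Sylow subgroup above
  \<open>S_C\<close>. Sylow's theorem in C conjugates \<open>V\<close> into \<open>S_C\<close>,
  where x centralizes it; conjugating x back keeps it in \<open>Z\<close>, as C \<le>
  N_G(T).\<close>

lemma Z_centralizes:
  assumes V: "p_subgroup p G V" "V \<subseteq> C"
  obtains x where "x \<in> Z" "x \<in> centralizer G V"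
proof -
  interpret C: finite_group_prime "G\<lparr>carrier := C\<rparr>" p
    using subgroup_locale[OF C_subgroup] .
  obtain S_C S where S: "sylow_subgroup p (G\<lparr>carrier := C\<rparr>) S_C" "sylow_subgroup p G S" "S_C \<subseteq> S"
    and ne: "group_center (G\<lparr>carrier := S\<rparr>) \<inter> (S_C \<inter> L) \<noteq> {\<one>}"
    using N3 by auto
  note pS = sylow_imp_p_subgroup[OF S(2)]
  note Sc = p_subgroupD[OF pS]
  have S_C: "subgroup S_C G" "S_C \<subseteq> C"
    using C.sylow_imp_p_subgroup[OF S(1)] p_subgroup_carrier_update_iff[OF C_subgroup] p_subgroupD(1) by auto
  \<comment> \<open>The intersection is a subgroup, so the power of \<open>z\<close> that has order
    \<open>p\<close> stays in it.\<close>
  let ?A = "centralizer G S \<inter> S \<inter> (S_C \<inter> L)"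
  have A: "subgroup ?A G"
    using subgroups_Inter_pair subgroup_centralizer[OF Sc(3)] Sc(1) S_C(1) L(1) by simp
  have "?A \<noteq> {\<one>}"
    using ne Sc(3) by (simp add: group_center_carrier_update)
  then obtain z where z: "z \<in> ?A" "z \<noteq> \<one>"
    using subgroup.one_closed[OF A] by blast
  obtain k where k: "ord (z [^] (k::nat)) = p"
    using exists_element_of_order_p[OF pS _ z(2)] z(1) by blast
  define x where "x = z [^] k"
  have xA: "x \<in> ?A"
    using nat_pow_in_subgroup[OF A z(1)] by (simp add: x_def)
  then have xZ: "x \<in> Z"
    using S k by (auto simp: Z_def x_def)
  have xc: "x \<in> carrier G"
    using xA Sc(3) by auto
  have "p_subgroup p (G\<lparr>carrier := C\<rparr>) V"
    using V p_subgroup_carrier_update_iff[OF C_subgroup] by simp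
  then obtain g where g: "g \<in> C" "conj_elt (G\<lparr>carrier := C\<rparr>) g ` V \<subseteq> S_C"
    using C.p_subgroup_conj_into_sylow[OF _ S(1)] by auto
  have gN: "g \<in> N" "inv g \<in> N" "g \<in> carrier G"
    using g(1) C_subset_N subgroup.m_inv_closed[OF N_subgroup] N_carrier by auto
  have "conj_elt (G\<lparr>carrier := C\<rparr>) g = conj_elt G g"
    using g(1) C_subgroup by (simp add: conj_elt_def fun_eq_iff)
  then have gV: "conj_elt G g ` V \<subseteq> S"
    using g(2) S(3) by auto
  then have "x \<in> centralizer G (conj_elt G g ` V)"
    using xA by (auto simp: centralizer_def)
  moreover have "conj_elt G g ` V \<subseteq> carrier G"
    using gV Sc(3) by auto
  ultimately have "conj_elt G (inv g) x \<in> centralizer G (conj_elt G (inv g) ` conj_elt G g ` V)"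
    using aut_centralizer_iff[OF conj_iso[OF gN(2)], of "conj_elt G g ` V" x] xc by simp
  then show thesis
    using that Z_conj[OF gN(2) xZ] conj_image_inv(1)[OF gN(3) p_subgroupD(3)[OF V(1)]] by simp
qed

section \<open>The posets of the zigzag inside \<open>G\<close>\<close>

abbreviation act where "act \<equiv> \<lambda>n. (`) (conj_elt G n)"

definition Y0 where "Y0 = {Q. distinguished Q \<and> T \<subseteq> normalizer G Q}"
definition Y1 where "Y1 = {Q. distinguished Q \<and> T \<subseteq> Q}"
definition Y2 where "Y2 = {Q. distinguished Q \<and> T \<subseteq> Q \<and> Q \<subseteq> C}"
definition Y3 where "Y3 = {Q. marked Z Q \<and> O_C \<subseteq> Q \<and> Q \<subseteq> C}"
definition Y4 where "Y4 = {Q. marked Z Q \<and> O_C \<subseteq> Q \<and> Q \<subseteq> L}"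

lemma markedD: "marked A Q \<Longrightarrow> p_subgroup p G Q" "marked A Q \<Longrightarrow> subgroup Q G" "marked A Q \<Longrightarrow> Q \<subseteq> carrier G"
  using p_subgroupD by (auto simp: marked_def)

lemma conj_subset: "n \<in> N \<Longrightarrow> conj_elt G n ` A = A \<Longrightarrow> A \<subseteq> Q \<Longrightarrow> A \<subseteq> conj_elt G n ` Q"
  by (metis image_mono)

lemma conj_supset: "n \<in> N \<Longrightarrow> conj_elt G n ` A = A \<Longrightarrow> Q \<subseteq> A \<Longrightarrow> conj_elt G n ` Q \<subseteq> A"
  by (metis image_mono)

lemma distinguished_conj: "n \<in> N \<Longrightarrow> distinguished Q \<Longrightarrow> distinguished (conj_elt G n ` Q)"
  using aut_marked[OF conj_iso] aut_p_central[OF conj_iso] by blast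

lemma T_normalizes_conj:
  assumes n: "n \<in> N" and "Q \<subseteq> carrier G" "T \<subseteq> normalizer G Q"
  shows "T \<subseteq> normalizer G (conj_elt G n ` Q)"
  using conj_subset[OF n conj_T[OF n] assms(3)] aut_normalizer[OF conj_iso[OF n] assms(2)] by simp

lemma Y_stable:
  assumes n: "n \<in> N"
  shows "Q \<in> Y0 \<Longrightarrow> conj_elt G n ` Q \<in> Y0" "Q \<in> Y1 \<Longrightarrow> conj_elt G n ` Q \<in> Y1"
    "Q \<in> Y2 \<Longrightarrow> conj_elt G n ` Q \<in> Y2" "Q \<in> Y3 \<Longrightarrow> conj_elt G n ` Q \<in> Y3"
    "Q \<in> Y4 \<Longrightarrow> conj_elt G n ` Q \<in> Y4"
    "Q \<in> centric_radicals_fixed p G T \<Longrightarrow> conj_elt G n ` Q \<in> centric_radicals_fixed p G T"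
proof -
  show "Q \<in> Y0 \<Longrightarrow> conj_elt G n ` Q \<in> Y0"
    using distinguished_conj[OF n] T_normalizes_conj[OF n markedD(3)] unfolding Y0_def by blast
  show "Q \<in> Y1 \<Longrightarrow> conj_elt G n ` Q \<in> Y1"
    using distinguished_conj[OF n] conj_subset[OF n conj_T[OF n]] by (simp add: Y1_def)
  show "Q \<in> Y2 \<Longrightarrow> conj_elt G n ` Q \<in> Y2"
    using distinguished_conj[OF n] conj_subset[OF n conj_T[OF n]] conj_supset[OF n conj_C[OF n]]
    by (simp add: Y2_def)
  have Z: "marked Z Q \<Longrightarrow> marked Z (conj_elt G n ` Q)" for Q
    using aut_marked[OF conj_iso[OF n]] Z_conj[OF n] by blast
  show "Q \<in> Y3 \<Longrightarrow> conj_elt G n ` Q \<in> Y3"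
    using Z conj_subset[OF n conj_O_C[OF n]] conj_supset[OF n conj_C[OF n]] by (simp add: Y3_def)
  show "Q \<in> Y4 \<Longrightarrow> conj_elt G n ` Q \<in> Y4"
    using Z conj_subset[OF n conj_O_C[OF n]] conj_supset[OF n conj_L[OF n]] by (simp add: Y4_def)
  show "Q \<in> centric_radicals_fixed p G T \<Longrightarrow> conj_elt G n ` Q \<in> centric_radicals_fixed p G T"
    using aut_centric_radicals[OF conj_iso[OF n]] T_normalizes_conj[OF n] p_subgroupD(3)
    by (auto simp: centric_radicals_fixed_def centric_radicals_def)
qed

lemma Y_p_subgroup: "Q \<in> Y0 \<Longrightarrow> p_subgroup p G Q" "Q \<in> Y1 \<Longrightarrow> p_subgroup p G Q"
  "Q \<in> Y2 \<Longrightarrow> p_subgroup p G Q" "Q \<in> Y3 \<Longrightarrow> p_subgroup p G Q" "Q \<in> Y4 \<Longrightarrow> p_subgroup p G Q"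
  using markedD(1) by (auto simp: Y0_def Y1_def Y2_def Y3_def Y4_def)

abbreviation core_N where "core_N Q \<equiv> p_core p (G\<lparr>carrier := normalizer G Q\<rparr>)"

lemma core_N:
  assumes Q: "distinguished Q"
  shows "p_subgroup p G (core_N Q)" "Q \<subseteq> core_N Q" "centralizer G (core_N Q) \<subseteq> core_N Q" "distinguished (core_N Q)"
    "normalizer G Q \<subseteq> normalizer G (core_N Q)"
    "n \<in> N \<Longrightarrow> core_N (conj_elt G n ` Q) = conj_elt G n ` core_N Q"
proof -
  note Qc = markedD[OF Q]
  have eq: "carrier G \<inter> normalizer G A = normalizer G A" if "A \<subseteq> carrier G" for A
    using normalizer_closed[OF that] by auto
  note nQ = normalizer_imp_subgroup[OF Qc(3)]
  note KQ = p_core_subgroup[OF nQ]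
  show "p_subgroup p G (core_N Q)"
    by (rule KQ(1))
  show "Q \<subseteq> core_N Q" and c: "centralizer G (core_N Q) \<subseteq> core_N Q"
    using distinguished_p_core_centric[OF pcG Q subgroup_self] Qc(3) eq[OF Qc(3)] by (auto simp: centralizer_def)
  show "distinguished (core_N Q)"
    using distinguishedI_centralizer[OF p_dvd KQ(1) order_refl c] .
  show "normalizer G Q \<subseteq> normalizer G (core_N Q)"
    using KQ(3) normalizer_closed[OF Qc(3)] p_subgroupD(2,3)[OF KQ(1)] by (auto intro: normalizerI)
  show "core_N (conj_elt G n ` Q) = conj_elt G n ` core_N Q" if "n \<in> N"
    using p_core_conj[OF nQ conj_iso[OF that]] aut_normalizer[OF conj_iso[OF that] Qc(3)] by simp
qed

text \<open>The centre of \<open>R\<close> centralizes the subgroup \<open>Q\<close>, hence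
  normalizes it and survives in the intersection.\<close>

lemma marked_growth:
  assumes R: "marked A R" and "Q \<subseteq> R" "Q \<subseteq> carrier G"
  shows "marked A (R \<inter> normalizer G Q)"
  using marked_subset[OF R] subgroups_Inter_pair[OF markedD(2)[OF R] normalizer_imp_subgroup[OF assms(3)]]
    centralizer_anti_mono[OF assms(2)] centralizer_subset_normalizer[OF assms(3)] by blast

lemma T_normalizes_growth:
  assumes "Q \<in> Y0" "R \<in> Y0"
  shows "T \<subseteq> normalizer G (R \<inter> normalizer G Q)"
proof
  fix t assume t: "t \<in> T"
  have Q: "Q \<subseteq> carrier G" and R: "R \<subseteq> carrier G"
    using p_subgroupD(3) Y_p_subgroup(1) assms by auto
  have "t \<in> normalizer G (normalizer G Q)"
    using subgroup_subset_normalizer[OF normalizer_imp_subgroup[OF Q]] t assms(1) by (auto simp: Y0_def)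
  then show "t \<in> normalizer G (R \<inter> normalizer G Q)"
    using normalizer_Int[OF R normalizer_closed[OF Q]] t assms(2) by (auto simp: Y0_def)
qed

lemma D_equiv_Y0: "complexes_equivalent N act Y0 act (centric_radicals_fixed p G T)"
proof (rule complexes_equivalent_normalizer_growth[where W = core_N])
  show "centric_radicals_fixed p G T \<subseteq> Y0"
    using centric_radicals_distinguished by (auto simp: centric_radicals_fixed_def Y0_def)
  fix Q assume Q: "Q \<in> Y0 - centric_radicals_fixed p G T"
  then have dQ: "distinguished Q" and TQ: "T \<subseteq> normalizer G Q" and Q0: "Q \<in> Y0"
    by (auto simp: Y0_def)
  note KQ = core_N[OF dQ]
  have "T \<subseteq> normalizer G (core_N Q)"
    using TQ KQ(5) by auto
  then show "core_N Q \<in> Y0"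
    using KQ(4) by (simp add: Y0_def)
  show "Q \<subset> core_N Q"
    using Q centric_radicalsI[OF dQ] KQ(2,3) TQ by (auto simp: centric_radicals_fixed_def)
  show "core_N (conj_elt G n ` Q) = conj_elt G n ` core_N Q" if "n \<in> N" for n
    using KQ(6)[OF that] .
  fix R assume R: "R \<in> Y0" "Q \<subset> R"
  let ?R = "R \<inter> normalizer G Q"
  have R': "marked (Collect (p_central p G)) ?R" "T \<subseteq> normalizer G ?R"
    using marked_growth[of _ R Q] R markedD(3)[OF dQ] T_normalizes_growth[OF Q0 R(1)] by (auto simp: Y0_def)
  then show "?R \<in> Y0"
    by (simp add: Y0_def)
  have "conj_elt G u w \<in> core_N Q" if "u \<in> ?R" "w \<in> core_N Q" for u w
    using that p_core_subgroup(3)[OF normalizer_imp_subgroup[OF markedD(3)[OF dQ]]] by auto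
  note prod = p_subgroup_product[OF KQ(1) markedD(1)[OF R'(1)] this]
  have "distinguished (core_N Q <#> ?R)"
    using distinguishedI_centralizer[OF p_dvd prod(1,2) KQ(3)] .
  moreover have "T \<subseteq> normalizer G (core_N Q <#> ?R)"
    using normalizer_set_mult[OF p_subgroupD(3)[OF KQ(1)] markedD(3)[OF R'(1)]]
      \<open>T \<subseteq> normalizer G (core_N Q)\<close> R'(2) by auto
  ultimately show "core_N Q <#> ?R \<in> Y0"
    by (simp add: Y0_def)
qed (use conj_iso Y_p_subgroup Y_stable in auto)

text \<open>Here \<open>Q\<close> may well coincide with the core of its normalizer. The cone point
  is enlarged by \<open>T\<close>, and strictness comes from \<open>T\<close> not being contained in
  \<open>Q\<close>.\<close>

lemma Y1_equiv_Y0: "complexes_equivalent N act Y0 act Y1"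
proof (rule complexes_equivalent_normalizer_growth[where W = "\<lambda>Q. core_N Q <#> T"])
  show "Y1 \<subseteq> Y0"
    using subgroup_subset_normalizer markedD(2) by (fastforce simp: Y1_def Y0_def)
  fix Q assume Q: "Q \<in> Y0 - Y1"
  then have dQ: "distinguished Q" and TQ: "T \<subseteq> normalizer G Q" "\<not> T \<subseteq> Q" and Q0: "Q \<in> Y0"
    by (auto simp: Y0_def Y1_def)
  note KQ = core_N[OF dQ]
  have nK: "conj_elt G u w \<in> core_N Q" if "u \<in> normalizer G Q" "w \<in> core_N Q" for u w
    using that p_core_subgroup(3)[OF normalizer_imp_subgroup[OF markedD(3)[OF dQ]]] by auto
  then have "conj_elt G u w \<in> core_N Q" if "u \<in> T" "w \<in> core_N Q" for u w
    using that TQ(1) by auto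
  note prod = p_subgroup_product[OF KQ(1) pT this]
  have "distinguished (core_N Q <#> T)"
    using distinguishedI_centralizer[OF p_dvd prod(1,2) KQ(3)] .
  then show "core_N Q <#> T \<in> Y0"
    using prod(3) subgroup_subset_normalizer[OF p_subgroupD(1)[OF prod(1)]] by (auto simp: Y0_def)
  show "Q \<subset> core_N Q <#> T"
    using KQ(2) prod(2,3) TQ(2) by blast
  show "core_N (conj_elt G n ` Q) <#> T = conj_elt G n ` (core_N Q <#> T)" if n: "n \<in> N" for n
    using set_mult_hom[of "conj_elt G n" G G "core_N Q" T] conj_iso[OF n] p_subgroupD(3)[OF KQ(1)] Tc(3)
      conj_T[OF n] KQ(6)[OF n] by (simp add: iso_def)
  fix R assume R: "R \<in> Y0" "Q \<subset> R"
  let ?R = "R \<inter> normalizer G Q"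
  have R': "marked (Collect (p_central p G)) ?R" "T \<subseteq> normalizer G ?R"
    using marked_growth[of _ R Q] R markedD(3)[OF dQ] T_normalizes_growth[OF Q0 R(1)] by (auto simp: Y0_def)
  then show "?R \<in> Y0"
    by (simp add: Y0_def)
  note Rc = markedD[OF R'(1)]
  have TR: "conj_elt G t u \<in> ?R" if "t \<in> T" "u \<in> ?R" for t u
    using normalizerD(3)[OF Rc(3) _ that(2)] R'(2) that(1) by blast
  \<comment> \<open>\<open>p_subgroup_product\<close> puts the normalized factor \<open>?R\<close>
    on the left, whereas in the cone \<open>T\<close> stands between the core and
    \<open>?R\<close>.\<close>
  have "?R <#> T = T <#> ?R"
    using set_mult_commute[OF Rc(3) Tc(1) TR] .
  then have pTR: "p_subgroup p G (T <#> ?R)"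
    using p_subgroup_product(1)[OF Rc(1) pT TR] by simp
  have "conj_elt G v w \<in> core_N Q" if v: "v \<in> T <#> ?R" and w: "w \<in> core_N Q" for v w
  proof -
    obtain t u where "t \<in> T" "u \<in> ?R" "v = t \<otimes> u"
      using v by (auto simp: set_mult_def)
    moreover have "w \<in> carrier G"
      using w p_subgroupD(3)[OF KQ(1)] by auto
    ultimately show ?thesis
      using nK w TQ(1) Tc(3) Rc(3) by (auto simp: conj_elt_comp subset_iff)
  qed
  note prod' = p_subgroup_product[OF KQ(1) pTR this]
  have assoc: "core_N Q <#> T <#> ?R = core_N Q <#> (T <#> ?R)"
    using set_mult_assoc[OF p_subgroupD(3)[OF KQ(1)] Tc(3) Rc(3)] .
  have "distinguished (core_N Q <#> (T <#> ?R))"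
    using distinguishedI_centralizer[OF p_dvd prod'(1,2) KQ(3)] .
  moreover have "T \<subseteq> T <#> ?R"
    using p_subgroup_product(3)[OF Rc(1) pT TR] \<open>?R <#> T = T <#> ?R\<close> by simp
  ultimately show "core_N Q <#> T <#> ?R \<in> Y0"
    using prod'(3) subgroup_subset_normalizer[OF p_subgroupD(1)[OF prod'(1)]] by (auto simp: Y0_def assoc)
qed (use conj_iso Y_p_subgroup Y_stable in auto)

text \<open>As T \<le> Q, the centre of Q lies in C_G(T) and so in C; intersecting with C does not
  lose the \<open>p\<close>-central element.\<close>

lemma Y2_equiv_Y1: "complexes_equivalent N act Y1 act Y2"
proof (rule complexes_equivalent_retract[where r = "\<lambda>Q. Q \<inter> C"])
  show "poset_auts N act Y1"
    using poset_auts_subgroups[of N "conj_elt G" Y1] conj_iso Y_p_subgroup(2) Y_stable(2) by blast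
  show "conj_elt G n ` Q \<inter> C = conj_elt G n ` (Q \<inter> C)" if "n \<in> N" "Q \<in> Y1" for n Q
    using aut_image_Int[OF conj_iso[OF that(1)] p_subgroupD(3)[OF Y_p_subgroup(2)[OF that(2)]]
        subgroup.subset[OF C_subgroup]] conj_C[OF that(1)] by simp
  show "Q \<inter> C \<in> Y2" if Q: "Q \<in> Y1" for Q
  proof -
    have dQ: "distinguished Q" and TQ: "T \<subseteq> Q"
      using Q by (auto simp: Y1_def)
    have "Q \<inter> centralizer G Q \<subseteq> Q \<inter> C"
      using centralizer_anti_mono[OF TQ] centralizer_subset_C by auto
    then have "distinguished (Q \<inter> C)"
      using marked_subset[OF dQ subgroups_Inter_pair[OF markedD(2)[OF dQ] C_subgroup]] by auto
    then show ?thesis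
      using TQ T_subset_C by (simp add: Y2_def)
  qed
qed (use Y_stable in \<open>auto simp: Y1_def Y2_def\<close>)

text \<open>The core is taken in N_C(Q) so that the cone stays inside C. If it equals Q, then Q
  contains \<open>O_C\<close>, and also the element of \<open>Z\<close> that centralizes it, so Q is
  in \<open>Y3\<close>; outside \<open>Y3\<close> the cone point is therefore strictly
  larger.\<close>

lemma Y3_equiv_Y2: "complexes_equivalent N act Y2 act Y3"
proof (rule complexes_equivalent_normalizer_growth[where W = "\<lambda>Q. p_core p (G\<lparr>carrier := C \<inter> normalizer G Q\<rparr>)"])
  have "marked Z Q \<Longrightarrow> distinguished Q" for Q
    using Z_p_central by (auto simp: marked_def)
  then show "Y3 \<subseteq> Y2"
    using T_subset_O_C by (auto simp: Y2_def Y3_def)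
  fix Q assume Q: "Q \<in> Y2 - Y3"
  then have dQ: "distinguished Q" and TQ: "T \<subseteq> Q" and QC: "Q \<subseteq> C"
    by (auto simp: Y2_def)
  note Qc = markedD[OF dQ]
  have CQ: "centralizer G Q \<subseteq> C"
    using centralizer_anti_mono[OF TQ] centralizer_subset_C by auto
  let ?M = "C \<inter> normalizer G Q"
  have M: "subgroup ?M G"
    using subgroups_Inter_pair[OF C_subgroup normalizer_imp_subgroup[OF Qc(3)]] .
  let ?W = "p_core p (G\<lparr>carrier := ?M\<rparr>)"
  note W = p_core_subgroup[OF M]
  have QW: "Q \<subseteq> ?W" and cW: "centralizer G ?W \<subseteq> ?W"
    using distinguished_p_core_centric[OF pcG dQ C_subgroup QC CQ] by auto
  show "?W \<in> Y2"
    using distinguishedI_centralizer[OF p_dvd W(1) order_refl cW] TQ QW W(2) by (auto simp: Y2_def)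
  show "Q \<subset> ?W"
  proof -
    have "Q \<noteq> ?W"
    proof
      assume eq: "Q = ?W"
      have "O_C \<subseteq> Q"
      proof (rule ccontr)
        assume "\<not> O_C \<subseteq> Q"
        have nO: "conj_elt G u w \<in> O_C" if "u \<in> Q" "w \<in> O_C" for u w
          using OC(3) QC that by auto
        note prod = p_subgroup_product[OF OC(1) Qc(1) nO]
        have "Q \<subset> O_C <#> Q"
          using prod(2,3) \<open>\<not> O_C \<subseteq> Q\<close> by blast
        \<comment> \<open>Growth of normalizers in the \<open>p\<close>-group
          \<open>O_C <#> Q\<close> produces an element of \<open>O_C\<close> that normalizes
          \<open>Q\<close> without lying in it, although \<open>O_C \<inter> normalizer G Q\<close>
          is a normal \<open>p\<close>-subgroup of \<open>?M\<close>.\<close>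
        then obtain g where g: "g \<in> O_C <#> Q" "g \<in> normalizer G Q" "g \<notin> Q"
          using normalizer_grows[OF Qc(1) prod(1)] by blast
        then obtain v q where vq: "v \<in> O_C" "q \<in> Q" "g = v \<otimes> q"
          by (auto simp: set_mult_def)
        have vqc: "v \<in> carrier G" "q \<in> carrier G"
          using vq OCc(3) Qc(3) by auto
        have "q \<in> normalizer G Q"
          using vq(2) subgroup_subset_normalizer[OF Qc(2)] by auto
        moreover have "v = g \<otimes> inv q"
          using vqc vq(3) by (simp add: m_assoc)
        ultimately have vN: "v \<in> normalizer G Q"
          using g(2) normalizer_imp_subgroup[OF Qc(3)] subgroup.m_closed subgroup.m_inv_closed by metis
        have "O_C \<inter> normalizer G Q \<subseteq> ?W"
        proof (rule W(4))
          show "p_subgroup p G (O_C \<inter> normalizer G Q)"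
            using p_subgroup_mono[OF OC(1)] subgroups_Inter_pair[OF OCc(1) normalizer_imp_subgroup[OF Qc(3)]]
            by simp
          show "O_C \<inter> normalizer G Q \<subseteq> ?M"
            using OC(2) by auto
          show "conj_elt G g a \<in> O_C \<inter> normalizer G Q" if "g \<in> ?M" "a \<in> O_C \<inter> normalizer G Q" for g a
            using that OC(3) subgroup_conj_closed[OF normalizer_imp_subgroup[OF Qc(3)]] by auto
        qed
        then have "v \<in> Q"
          using eq vq(1) vN by auto
        then show False
          using g(3) vq subgroup.m_closed[OF Qc(2)] by auto
      qed
      moreover have "marked Z Q"
      proof -
        obtain x where "x \<in> Z" "x \<in> centralizer G Q"
          using Z_centralizes[OF Qc(1) QC] .
        then show ?thesis
          using cW eq Qc(1) by (auto simp: marked_def)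
      qed
      ultimately show False
        using Q QC by (auto simp: Y3_def)
    qed
    then show ?thesis
      using QW by blast
  qed
  show "p_core p (G\<lparr>carrier := C \<inter> normalizer G (conj_elt G n ` Q)\<rparr>) = conj_elt G n ` ?W" if "n \<in> N" for n
    using aut_p_core_normalizer[OF conj_iso[OF that] Qc(3) C_subgroup conj_C[OF that]] .
  fix R assume R: "R \<in> Y2" "Q \<subset> R"
  let ?R = "R \<inter> normalizer G Q"
  have R': "distinguished ?R" "T \<subseteq> ?R" "?R \<subseteq> C"
    using marked_growth[of _ R Q] R Qc(3) TQ subgroup_subset_normalizer[OF Qc(2)] by (auto simp: Y2_def)
  then show "?R \<in> Y2"
    by (simp add: Y2_def)
  have "conj_elt G u w \<in> ?W" if "u \<in> ?R" "w \<in> ?W" for u w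
    using that W(3) R'(3) by auto
  note prod = p_subgroup_product[OF W(1) markedD(1)[OF R'(1)] this]
  have "distinguished (?W <#> ?R)"
    using distinguishedI_centralizer[OF p_dvd prod(1,2) cW] .
  moreover have "?W <#> ?R \<subseteq> C"
    using W(2) R'(3) subgroup.m_closed[OF C_subgroup] by (force simp: set_mult_def)
  ultimately show "?W <#> ?R \<in> Y2"
    using R'(2) prod(3) by (auto simp: Y2_def)
qed (use conj_iso Y_p_subgroup Y_stable in auto)

text \<open>Elements of \<open>Z\<close> lie in \<open>L\<close> by definition, so intersecting with
  \<open>L\<close> keeps the mark; an arbitrary \<open>p\<close>-central element might be lost
  here.\<close>

lemma Y4_equiv_Y3: "complexes_equivalent N act Y3 act Y4"
proof (rule complexes_equivalent_retract[where r = "\<lambda>Q. Q \<inter> L"])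
  show "poset_auts N act Y3"
    using poset_auts_subgroups[of N "conj_elt G" Y3] conj_iso Y_p_subgroup(4) Y_stable(4) by blast
  show "conj_elt G n ` Q \<inter> L = conj_elt G n ` (Q \<inter> L)" if "n \<in> N" "Q \<in> Y3" for n Q
    using aut_image_Int[OF conj_iso[OF that(1)] p_subgroupD(3)[OF Y_p_subgroup(4)[OF that(2)]]
        subgroup.subset[OF L(1)]] conj_L[OF that(1)] by simp
  show "Q \<inter> L \<in> Y4" if Q: "Q \<in> Y3" for Q
  proof -
    have mQ: "marked Z Q" and OQ: "O_C \<subseteq> Q"
      using Q by (auto simp: Y3_def)
    obtain x where "x \<in> Q" "x \<in> Z" "x \<in> centralizer G Q"
      using mQ by (auto simp: marked_def)
    moreover have "Z \<subseteq> L"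
      by (auto simp: Z_def)
    ultimately have "marked Z (Q \<inter> L)"
      using p_subgroup_mono[OF markedD(1)[OF mQ] subgroups_Inter_pair[OF markedD(2)[OF mQ] L(1)]]
        centralizer_anti_mono[of "Q \<inter> L" Q] by (auto simp: marked_def)
    then show ?thesis
      using OQ L_normal(3) by (simp add: Y4_def)
  qed
qed (use Y_stable L(2) in \<open>auto simp: Y3_def Y4_def\<close>)

section \<open>Passing to the quotient \<open>H\<close>\<close>

abbreviation \<pi> where "\<pi> \<equiv> \<lambda>x. O_C #> x"

lemma O_C_normal_L: "O_C \<lhd> G\<lparr>carrier := L\<rparr>"
  using normal_carrier_update_iff[OF L(1)] OCc(1) L_normal(3) OC(3) L(2) by auto

lemma L_group: "group (G\<lparr>carrier := L\<rparr>)"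
  using subgroup_imp_group[OF L(1)] .

lemma L_carrier: "x \<in> L \<Longrightarrow> x \<in> carrier G"
  using subgroup.subset[OF L(1)] by auto

lemma carrier_H: "carrier H = \<pi> ` L"
  by (simp add: H_def carrier_FactGroup r_coset_def)

lemma one_H: "\<one>\<^bsub>H\<^esub> = O_C"
  by (simp add: H_def)

lemma H_group: "group H"
  unfolding H_def using normal.factorgroup_is_group[OF O_C_normal_L] .

sublocale H: finite_group_prime H p
proof -
  have "finite (carrier H)"
    unfolding carrier_H using fin_subgroup[OF L(1)] by simp
  then show "finite_group_prime H p"
    using H_group prime_p by (simp add: finite_group_prime_def finite_group_prime_axioms_def)
qed

lemma \<pi>_hom: "\<pi> \<in> hom (G\<lparr>carrier := L\<rparr>) H"
  using normal.r_coset_hom_Mod[OF O_C_normal_L] by (simp add: H_def r_coset_def)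

sublocale \<pi>: group_hom "G\<lparr>carrier := L\<rparr>" H \<pi>
  using \<pi>_hom L_group H_group by (simp add: group_hom_def group_hom_axioms_def)

lemma \<pi>_mult: "x \<in> L \<Longrightarrow> y \<in> L \<Longrightarrow> \<pi> (x \<otimes> y) = \<pi> x \<otimes>\<^bsub>H\<^esub> \<pi> y"
  using \<pi>.hom_mult by simp

lemma \<pi>_closed: "x \<in> L \<Longrightarrow> \<pi> x \<in> carrier H"
  using \<pi>.hom_closed by simp

lemma \<pi>_eq_one_iff: "x \<in> L \<Longrightarrow> \<pi> x = \<one>\<^bsub>H\<^esub> \<longleftrightarrow> x \<in> O_C"
  using coset_join1[OF _ L_carrier OCc(1)] coset_join2[OF L_carrier OCc(1)] by (auto simp: one_H)

lemma \<pi>_mem_iff: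
  assumes "subgroup Q G" "O_C \<subseteq> Q" "Q \<subseteq> L" "x \<in> L"
  shows "\<pi> x \<in> \<pi> ` Q \<longleftrightarrow> x \<in> Q"
proof
  assume "\<pi> x \<in> \<pi> ` Q"
  then obtain q where q: "q \<in> Q" "\<pi> x = \<pi> q"
    by auto
  then have "x \<in> O_C #> q"
    using rcos_self[OF L_carrier[OF assms(4)] OCc(1)] by simp
  then obtain v where "v \<in> O_C" "x = v \<otimes> q"
    by (auto simp: r_coset_def)
  then show "x \<in> Q"
    using assms(1,2) q(1) by (auto intro: subgroup.m_closed)
qed auto

lemma subgroup_image:
  assumes "subgroup Q G" "Q \<subseteq> L"
  shows "subgroup (\<pi> ` Q) H"
  using \<pi>.subgroup_img_is_subgroup subgroup_incl[OF assms(1) L(1) assms(2)] by simp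

lemma card_image_mult: "subgroup Q G \<Longrightarrow> O_C \<subseteq> Q \<Longrightarrow> card (\<pi> ` Q) * card O_C = card Q"
  using card_subgroup_index[OF OCc(1)] .

lemma p_subgroup_image:
  assumes "p_subgroup p G Q" "O_C \<subseteq> Q" "Q \<subseteq> L"
  shows "p_subgroup p H (\<pi> ` Q)"
proof -
  obtain n where "card Q = p ^ n"
    using assms(1) by (auto simp: p_subgroup_def)
  then obtain k where "card (\<pi> ` Q) = p ^ k"
    using card_image_mult[OF p_subgroupD(1)[OF assms(1)] assms(2)] prime_p
    by (metis divides_primepow_nat dvd_triv_left)
  then show ?thesis
    using subgroup_image[OF p_subgroupD(1)[OF assms(1)] assms(3)] by (auto simp: p_subgroup_def)
qed

definition lift where "lift V = {x \<in> L. \<pi> x \<in> V}"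

lemma lift:
  assumes V: "subgroup V H"
  shows "subgroup (lift V) G" "O_C \<subseteq> lift V" "lift V \<subseteq> L" "\<pi> ` lift V = V"
    "p_subgroup p H V \<Longrightarrow> p_subgroup p G (lift V)"
proof -
  show sub: "subgroup (lift V) G"
  proof (rule subgroupI)
    show "lift V \<subseteq> carrier G"
      using L_carrier by (auto simp: lift_def)
    have "\<pi> \<one> \<in> V"
      using \<pi>.hom_one subgroup.one_closed[OF V] by simp
    then show "lift V \<noteq> {}"
      using subgroup.one_closed[OF L(1)] by (auto simp: lift_def)
    show "inv a \<in> lift V" if "a \<in> lift V" for a
    proof -
      have a: "a \<in> L" "\<pi> a \<in> V"
        using that by (auto simp: lift_def)
      have "\<pi> (inv a) = inv\<^bsub>H\<^esub> \<pi> a"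
        using \<pi>.hom_inv[of a] a(1) m_inv_consistent[OF L(1) a(1)] by simp
      then show ?thesis
        using a subgroup.m_inv_closed[OF V] subgroup.m_inv_closed[OF L(1)] by (simp add: lift_def)
    qed
    show "a \<otimes> b \<in> lift V" if "a \<in> lift V" "b \<in> lift V" for a b
      using that \<pi>_mult subgroup.m_closed[OF V] subgroup.m_closed[OF L(1)] by (simp add: lift_def)
  qed
  show O: "O_C \<subseteq> lift V"
  proof
    fix x assume x: "x \<in> O_C"
    then have "x \<in> L" "\<pi> x = \<one>\<^bsub>H\<^esub>"
      using L_normal(3) \<pi>_eq_one_iff by auto
    then show "x \<in> lift V"
      using subgroup.one_closed[OF V] by (simp add: lift_def)
  qed
  show "lift V \<subseteq> L"
    by (auto simp: lift_def)
  show im: "\<pi> ` lift V = V"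
    using subgroup.subset[OF V] by (auto simp: lift_def carrier_H)
  show "p_subgroup p G (lift V)" if pV: "p_subgroup p H V"
  proof -
    obtain n where "card V = p ^ n"
      using pV by (auto simp: p_subgroup_def)
    moreover obtain m where "card O_C = p ^ m"
      using OC(1) by (auto simp: p_subgroup_def)
    ultimately have "card (lift V) = p ^ (n + m)"
      using card_image_mult[OF sub O] im by (simp add: power_add)
    then show ?thesis
      using sub by (auto simp: p_subgroup_def)
  qed
qed

lemma \<pi>_centralizer:
  assumes "x \<in> L" "Q \<subseteq> L" "x \<in> centralizer G Q"
  shows "\<pi> x \<in> centralizer H (\<pi> ` Q)"
  using assms \<pi>_closed by (auto simp: centralizer_def subset_iff simp flip: \<pi>_mult)

text \<open>\<open>x\<close> is central in \<open>S_C \<inter> L\<close>, and the image of that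
  group turns out to be a Sylow subgroup of \<open>H\<close>; it remains to see that the order of
  \<open>x\<close> does not drop.\<close>

lemma Z_p_central_quotient:
  assumes x: "x \<in> Z"
  shows "p_central p H (\<pi> x)"
proof -
  interpret C: finite_group_prime "G\<lparr>carrier := C\<rparr>" p
    using subgroup_locale[OF C_subgroup] .
  obtain S_C S where S: "sylow_subgroup p (G\<lparr>carrier := C\<rparr>) S_C" "sylow_subgroup p G S" "S_C \<subseteq> S"
    "x \<in> S" "x \<in> centralizer G S" and xL: "x \<in> L" "ord x = p"
    using x by (auto simp: Z_def)
  note pS = sylow_imp_p_subgroup[OF S(2)]
  have pS_C: "p_subgroup p G S_C" "S_C \<subseteq> C"
    using C.sylow_imp_p_subgroup[OF S(1)] p_subgroup_carrier_update_iff[OF C_subgroup] by auto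
  have "p_subgroup p G (S \<inter> C)"
    using p_subgroup_mono[OF pS] subgroups_Inter_pair[OF p_subgroupD(1)[OF pS] C_subgroup] by simp
  \<comment> \<open>A Sylow subgroup of C is not properly contained in a \<open>p\<close>-subgroup
    of C. Hence \<open>x\<close>, lying in \<open>S\<close> and in \<open>L\<close>, belongs to
    \<open>S_C\<close>.\<close>
  then have "S \<inter> C = S_C"
    using C.sylow_eqI[OF S(1)] p_subgroup_carrier_update_iff[OF C_subgroup] S(3) pS_C(2) by simp
  then have xS: "x \<in> S_C"
    using S(4) xL(1) L(2) by auto
  let ?R = "S_C \<inter> L"
  have O_S: "O_C \<subseteq> S_C"
    using C.normal_p_subgroup_subset_sylow[OF C.p_core_normal C.p_core_p_subgroup S(1)] by (simp add: O_C_def)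
  have R: "p_subgroup p G ?R" "O_C \<subseteq> ?R" "?R \<subseteq> L"
    using p_subgroup_mono[OF pS_C(1)] subgroups_Inter_pair[OF p_subgroupD(1)[OF pS_C(1)] L(1)] O_S L_normal(3)
    by auto
  have pR: "p_subgroup p H (\<pi> ` ?R)"
    using p_subgroup_image[OF R] .
  \<comment> \<open>\<open>P\<close> is there for comparing orders: its preimage is a
    \<open>p\<close>-subgroup of \<open>L\<close>, conjugate under C into \<open>?R\<close>, so the
    image of \<open>?R\<close> is at least as large as \<open>P\<close>.\<close>
  obtain P where P: "sylow_subgroup p H P"
    using H.sylow_exists by auto
  have subP: "subgroup P H"
    using P by (simp add: sylow_subgroup_def)
  note lP = lift[OF subP]
  have pP: "p_subgroup p G (lift P)"
    using lP(5)[OF H.sylow_imp_p_subgroup[OF P]] .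
  have "p_subgroup p (G\<lparr>carrier := C\<rparr>) (lift P)"
    using pP p_subgroup_carrier_update_iff[OF C_subgroup] lP(3) L(2) by auto
  then obtain g where g: "g \<in> C" "conj_elt (G\<lparr>carrier := C\<rparr>) g ` lift P \<subseteq> S_C"
    using C.p_subgroup_conj_into_sylow[OF _ S(1)] by auto
  have gN: "g \<in> N" "g \<in> carrier G"
    using g(1) C_subset_N N_carrier by auto
  have "conj_elt (G\<lparr>carrier := C\<rparr>) g = conj_elt G g"
    using g(1) C_subgroup by (simp add: conj_elt_def fun_eq_iff)
  then have "conj_elt G g ` lift P \<subseteq> ?R"
    using g(2) L(3)[OF gN(1)] lP(3) by auto
  moreover have "card (conj_elt G g ` lift P) = card (lift P)"
    using inj_on_subset[OF inj_on_conj_elt[OF gN(2)] p_subgroupD(3)[OF pP]] by (rule card_image)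
  ultimately have "card (lift P) \<le> card ?R"
    using card_mono[OF p_subgroupD(2)[OF R(1)]] by metis
  then have "card P * card O_C \<le> card (\<pi> ` ?R) * card O_C"
    using card_image_mult[OF lP(1,2)] card_image_mult[OF p_subgroupD(1)[OF R(1)] R(2)] lP(4) by simp
  moreover have "card O_C > 0"
    using OCc(2,4) card_gt_0_iff by blast
  ultimately have "card P \<le> card (\<pi> ` ?R)"
    by simp
  then have "card (\<pi> ` ?R) = card P"
    using H.p_subgroup_card_le_sylow[OF pR P] by simp
  then have sylR: "sylow_subgroup p H (\<pi> ` ?R)"
    using P H.p_subgroupD(1)[OF pR] by (simp add: sylow_subgroup_def)
  have "x \<in> centralizer G ?R"
    using S(5) centralizer_anti_mono[of ?R S] S(3) by auto
  then have "\<pi> x \<in> centralizer H (\<pi> ` ?R)"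
    using \<pi>_centralizer[OF xL(1) R(3)] by simp
  moreover have "\<pi> x \<in> \<pi> ` ?R"
    using xS xL(1) by auto
  ultimately have c: "\<pi> x \<in> group_center (H\<lparr>carrier := \<pi> ` ?R\<rparr>)"
    using H.p_subgroupD(3)[OF pR] by (simp add: H.group_center_carrier_update)
  have "x [^]\<^bsub>G\<lparr>carrier := L\<rparr>\<^esub> p = \<one>"
    using pow_ord_eq_1[OF L_carrier[OF xL(1)]] xL(2) by (simp flip: nat_pow_consistent)
  then have "\<pi> x [^]\<^bsub>H\<^esub> p = \<one>\<^bsub>H\<^esub>"
    using \<pi>.hom_nat_pow[of x p] xL(1) \<pi>.hom_one by simp
  then have "group.ord H (\<pi> x) dvd p"
    using H.pow_eq_id[OF \<pi>_closed[OF xL(1)]] by simp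
  \<comment> \<open>(N1) enters here: a \<open>p\<close>-central element is outside
    \<open>O_C\<close>, the kernel of \<pi>.\<close>
  moreover have "group.ord H (\<pi> x) \<noteq> 1"
    using H.ord_eq_1[OF \<pi>_closed[OF xL(1)]] \<pi>_eq_one_iff[OF xL(1)] N1 Z_p_central[OF x] by blast
  ultimately have "group.ord H (\<pi> x) = p"
    using prime_p by (auto simp: prime_nat_iff)
  then show ?thesis
    using sylR c \<pi>_closed[OF xL(1)] unfolding p_central_def by blast
qed

section \<open>The image poset in \<open>H\<close>\<close>

definition Y5 where "Y5 = (\<lambda>Q. \<pi> ` Q) ` Y4"

lemma Y5E:
  assumes "V \<in> Y5"
  obtains Q where "marked Z Q" "O_C \<subseteq> Q" "Q \<subseteq> L" "V = \<pi> ` Q"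
  using assms by (auto simp: Y5_def Y4_def)

lemma Y5I_lift:
  assumes "subgroup V H" "marked Z (lift V)"
  shows "V \<in> Y5"
  using lift[OF assms(1)] assms(2) by (auto simp: Y5_def Y4_def intro!: image_eqI[of _ _ "lift V"])

lemma Y5_p_subgroup: "V \<in> Y5 \<Longrightarrow> p_subgroup p H V"
  using p_subgroup_image markedD(1) by (auto elim!: Y5E)

lemma Y5_distinguished:
  assumes "V \<in> Y5"
  shows "H.distinguished V"
proof -
  obtain Q where Q: "marked Z Q" "O_C \<subseteq> Q" "Q \<subseteq> L" "V = \<pi> ` Q"
    using Y5E[OF assms] .
  obtain x where "x \<in> Q" "x \<in> Z" "x \<in> centralizer G Q"
    using Q(1) by (auto simp: marked_def)
  then show ?thesis
    using Z_p_central_quotient \<pi>_centralizer[of x Q] Q Y5_p_subgroup[OF assms]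
    by (auto simp: H.marked_def)
qed

text \<open>The preimage of \<open>V\<close> is a \<open>p\<close>-subgroup of C, so some x in
  \<open>Z\<close> centralizes it. Its image is a \<open>p\<close>-element centralizing
  \<open>V\<close>, hence lies in \<open>V\<close>; thus x lies in the preimage and marks
  it.\<close>

lemma Y5I:
  assumes V: "p_subgroup p H V"
    and c: "\<And>P x. p_subgroup p H P \<Longrightarrow> x \<in> P \<Longrightarrow> x \<in> centralizer H V \<Longrightarrow> x \<in> V"
  shows "V \<in> Y5"
proof -
  note Vs = H.p_subgroupD(1)[OF V]
  note l = lift[OF Vs]
  obtain x where x: "x \<in> Z" "x \<in> centralizer G (lift V)"
    using Z_centralizes[OF l(5)[OF V]] l(3) L(2) by blast
  have xL: "x \<in> L"
    using x(1) by (simp add: Z_def)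
  have "\<pi> x \<in> centralizer H V"
    using \<pi>_centralizer[OF xL l(3) x(2)] l(4) by simp
  moreover obtain S where "sylow_subgroup p H S" "\<pi> x \<in> S"
    using Z_p_central_quotient[OF x(1)] H.p_subgroupD(3)[OF H.sylow_imp_p_subgroup]
    by (auto simp: p_central_def H.group_center_carrier_update)
  ultimately have "\<pi> x \<in> V"
    using c H.sylow_imp_p_subgroup by blast
  then have "marked Z (lift V)"
    using x xL l(5)[OF V] by (auto simp: marked_def lift_def)
  then show ?thesis
    using Y5I_lift[OF Vs] by simp
qed

text \<open>\<open>marked_subset\<close> has to be applied in \<open>G\<close> to the preimages,
  since membership in \<open>Y5\<close> refers to marks by \<open>Z\<close> and not just to
  \<open>p\<close>-central elements of \<open>H\<close>.\<close>

lemma Y5_subgroup: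
  assumes R: "R \<in> Y5" and V: "subgroup V H" "V \<subseteq> R" "R \<inter> centralizer H R \<subseteq> V"
  shows "V \<in> Y5"
proof -
  obtain Q where Q: "marked Z Q" "O_C \<subseteq> Q" "Q \<subseteq> L" "R = \<pi> ` Q"
    using Y5E[OF R] .
  have "lift V \<subseteq> Q"
  proof
    fix x assume "x \<in> lift V"
    then have "x \<in> L" "\<pi> x \<in> \<pi> ` Q"
      using V(2) Q(4) by (auto simp: lift_def)
    then show "x \<in> Q"
      using \<pi>_mem_iff[OF markedD(2)[OF Q(1)] Q(2,3)] by simp
  qed
  moreover have "Q \<inter> centralizer G Q \<subseteq> lift V"
    using V(3) \<pi>_centralizer[OF _ Q(3)] Q(3,4) by (auto simp: lift_def)
  ultimately have "marked Z (lift V)"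
    using marked_subset[OF Q(1) lift(1)[OF V(1)]] by simp
  then show ?thesis
    using Y5I_lift[OF V(1)] by simp
qed

lemma conj_\<pi>:
  assumes n: "n \<in> N" and x: "x \<in> L"
  shows "conj_set G n (\<pi> x) = \<pi> (conj_elt G n x)"
proof -
  have "conj_set G n (\<pi> x) = (\<lambda>v. v \<otimes> conj_elt G n x) ` conj_elt G n ` O_C"
    using N_carrier[OF n] L_carrier[OF x] OCc(3) 
    by (force simp: conj_set_eq r_coset_def image_image conj_elt_mult subset_iff)
  then show ?thesis
    using conj_O_C[OF n] by (auto simp: r_coset_def)
qed

lemma conj_set_iso:
  assumes n: "n \<in> N"
  shows "conj_set G n \<in> iso H H"
proof -
  have i: "inv n \<in> N"
    using subgroup.m_inv_closed[OF N_subgroup n] .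
  have closed: "conj_set G m X' \<in> carrier H" if "m \<in> N" "X' \<in> carrier H" for m X'
    using that conj_\<pi>[OF that(1)] L(3)[OF that(1)] by (auto simp: carrier_H)
  have "conj_set G n (X' \<otimes>\<^bsub>H\<^esub> Y') = conj_set G n X' \<otimes>\<^bsub>H\<^esub> conj_set G n Y'"
    if XY: "X' \<in> carrier H" "Y' \<in> carrier H" for X' Y'
  proof -
    obtain x y where xy: "x \<in> L" "y \<in> L" "X' = \<pi> x" "Y' = \<pi> y"
      using XY by (auto simp: carrier_H)
    have "conj_set G n (\<pi> (x \<otimes> y)) = \<pi> (conj_elt G n x \<otimes> conj_elt G n y)"
      using conj_\<pi>[OF n, of "x \<otimes> y"] subgroup.m_closed[OF L(1)] xy N_carrier[OF n] L_carrier
      by (simp add: conj_elt_mult)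
    then show ?thesis
      using xy conj_\<pi>[OF n] L(3)[OF n] by (simp add: \<pi>_mult)
  qed
  moreover have "bij_betw (conj_set G n) (carrier H) (carrier H)"
  proof (rule bij_betw_byWitness[where f' = "conj_set G (inv n)"])
    show "\<forall>X'\<in>carrier H. conj_set G (inv n) (conj_set G n X') = X'"
      using conj_\<pi>[OF n] conj_\<pi>[OF i] L(3)[OF n] N_carrier[OF n] L_carrier by (auto simp: carrier_H)
    show "\<forall>X'\<in>carrier H. conj_set G n (conj_set G (inv n) X') = X'"
      using conj_\<pi>[OF n] conj_\<pi>[OF i] L(3)[OF i] N_carrier[OF n] L_carrier by (auto simp: carrier_H)
  qed (use closed n i in auto)
  ultimately show ?thesis
    using closed[OF n] by (auto simp: iso_def hom_def)
qed

lemma conj_cosets_image: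
  "n \<in> N \<Longrightarrow> Q \<subseteq> L \<Longrightarrow> conj_cosets G n (\<pi> ` Q) = \<pi> ` conj_elt G n ` Q"
  unfolding conj_cosets_def image_image using conj_\<pi> by (intro image_cong) auto

lemma Y4_equiv_Y5: "complexes_equivalent N act Y4 (conj_cosets G) Y5"
proof (rule complexes_equivalent_iso[where \<phi> = "\<lambda>Q. \<pi> ` Q"])
  show "poset_auts N act Y4"
    using poset_auts_subgroups[of N "conj_elt G" Y4] conj_iso Y_p_subgroup(5) Y_stable(5) by blast
  show sub: "\<pi> ` Q \<subseteq> \<pi> ` R \<longleftrightarrow> Q \<subseteq> R" if "Q \<in> Y4" "R \<in> Y4" for Q R
  proof
    assume QR: "\<pi> ` Q \<subseteq> \<pi> ` R"
    have R: "subgroup R G" "O_C \<subseteq> R" "R \<subseteq> L" and Q: "Q \<subseteq> L"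
      using that markedD(2) by (auto simp: Y4_def)
    show "Q \<subseteq> R"
      using QR \<pi>_mem_iff[OF R] Q by blast
  qed auto
  show "bij_betw (\<lambda>Q. \<pi> ` Q) Y4 Y5"
    unfolding bij_betw_def
  proof
    show "inj_on (\<lambda>Q. \<pi> ` Q) Y4"
      using sub by (intro inj_onI) (metis subset_antisym order_refl)
  qed (simp add: Y5_def)
  show "\<pi> ` conj_elt G n ` Q = conj_cosets G n (\<pi> ` Q)" if "n \<in> N" "Q \<in> Y4" for n Q
    using conj_cosets_image[OF that(1)] that(2) by (simp add: Y4_def)
qed

text \<open>The contraction used for \<open>Y0\<close>, now in \<open>H\<close>. Parabolic
  characteristic \<open>p\<close> of \<open>H\<close> makes the cores contain their centralizers,
  and \<open>Y5I\<close> then returns the cones to \<open>Y5\<close>.\<close>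

lemma Y5_equiv_D: "complexes_equivalent N (conj_cosets G) Y5 (conj_cosets G) (centric_radicals p H)"
proof -
  have cc: "conj_cosets G = (\<lambda>n. (`) (conj_set G n))"
    by (simp add: conj_cosets_def fun_eq_iff)
  let ?W = "\<lambda>V. p_core p (H\<lparr>carrier := normalizer H V\<rparr>)"
  show ?thesis
    unfolding cc
  proof (rule H.complexes_equivalent_normalizer_growth[where W = ?W])
    show "conj_set G n \<in> iso H H" if "n \<in> N" for n
      using conj_set_iso[OF that] .
    show "p_subgroup p H V" if "V \<in> Y5" for V
      using Y5_p_subgroup[OF that] .
    show "conj_set G n ` V \<in> Y5" if n: "n \<in> N" and V: "V \<in> Y5" for n V
    proof -
      obtain Q where Q: "Q \<in> Y4" "V = \<pi> ` Q"
        using V by (auto simp: Y5_def)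
      then have "conj_set G n ` V = \<pi> ` conj_elt G n ` Q"
        using conj_cosets_image[OF n] by (simp add: Y4_def conj_cosets_def)
      then show ?thesis
        using Y_stable(5)[OF n Q(1)] by (simp add: Y5_def)
    qed
    show "centric_radicals p H \<subseteq> Y5"
      using Y5I H.p_centricD by (auto simp: centric_radicals_def)
    show "conj_set G n ` V \<in> centric_radicals p H" if "n \<in> N" "V \<in> centric_radicals p H" for n V
      using H.aut_centric_radicals[OF conj_set_iso[OF that(1)] that(2)] .
    fix V assume V: "V \<in> Y5 - centric_radicals p H"
    then have dV: "H.distinguished V"
      using Y5_distinguished by simp
    note Vc = H.p_subgroupD[OF Y5_p_subgroup]
    have VY: "V \<in> Y5"
      using V by simp
    note nV = H.normalizer_imp_subgroup[OF Vc(3)[OF VY]]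
    note W = H.p_core_subgroup[OF nV]
    have "carrier H \<inter> normalizer H V = normalizer H V"
      using H.normalizer_closed[OF Vc(3)[OF VY]] by auto
    then have VW: "V \<subseteq> ?W V" and cW: "centralizer H (?W V) \<subseteq> ?W V"
      using H.distinguished_p_core_centric[OF pcH dV H.subgroup_self] Vc(3)[OF VY] by (auto simp: centralizer_def)
    show "?W V \<in> Y5"
      using Y5I[OF W(1)] cW by auto
    show "V \<subset> ?W V"
      using V H.centric_radicalsI[OF dV] VW cW by auto
    show "?W (conj_set G n ` V) = conj_set G n ` ?W V" if "n \<in> N" for n
      using H.p_core_conj[OF nV conj_set_iso[OF that]] H.aut_normalizer[OF conj_set_iso[OF that] Vc(3)[OF VY]]
      by simp
    fix R assume R: "R \<in> Y5" "V \<subset> R"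
    let ?R = "R \<inter> normalizer H V"
    have sub: "subgroup ?R H"
      using H.subgroups_Inter_pair[OF Vc(1)[OF R(1)] nV] .
    show RY: "?R \<in> Y5"
      using H.centralizer_anti_mono[of V R] R(2) H.centralizer_subset_normalizer[OF Vc(3)[OF VY]]
      by (intro Y5_subgroup[OF R(1) sub]) auto
    have "conj_elt H u w \<in> ?W V" if "u \<in> ?R" "w \<in> ?W V" for u w
      using that W(3) by auto
    note prod = H.p_subgroup_product[OF W(1) Y5_p_subgroup[OF RY] this]
    have "centralizer H (?W V <#>\<^bsub>H\<^esub> ?R) \<subseteq> ?W V <#>\<^bsub>H\<^esub> ?R"
      using H.centralizer_anti_mono[OF prod(2)] cW prod(2) by blast
    then show "?W V <#>\<^bsub>H\<^esub> ?R \<in> Y5"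
      using Y5I[OF prod(1)] by auto
  qed
qed

theorem D_fixed_equiv_D_quotient:
  "complexes_equivalent N act (centric_radicals_fixed p G T) (conj_cosets G) (centric_radicals p H)"
  using D_equiv_Y0[THEN equivariant_homotopy_equivalent_sym] Y1_equiv_Y0 Y2_equiv_Y1 Y3_equiv_Y2
    Y4_equiv_Y3 Y4_equiv_Y5 Y5_equiv_D
  by (meson equivariant_homotopy_equivalent_trans)

end

theorem theorem3p6:
  fixes G :: "('a, 'b) monoid_scheme"
    and p :: nat
    and T C O_C L :: "'a set"
    and H :: "'a set monoid"
  assumes "Factorial_Ring.prime p"
    and "group G" and "finite (carrier G)"
    and "parabolic_characteristic_p p G"
    and "p dvd Coset.order G"
    and "p_subgroup p G T"
    and C_def: "C = T <#>\<^bsub>G\<^esub> centralizer G T"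
    and O_C_def: "O_C = p_core p (G\<lparr>carrier := C\<rparr>)"
    and N1: "\<forall>x\<in>O_C. \<not> p_central p G x"
    and N2: "L \<lhd> G\<lparr>carrier := C\<rparr>" "O_C \<subseteq> L"
      "H = G\<lparr>carrier := L\<rparr> Mod O_C"
      "parabolic_characteristic_p p H"
      "L \<lhd> G\<lparr>carrier := normalizer G T\<rparr>"
    and N3: "\<exists>S_C S. sylow_subgroup p (G\<lparr>carrier := C\<rparr>) S_C \<and> sylow_subgroup p G S \<and> S_C \<subseteq> S \<and>
      group_center (G\<lparr>carrier := S\<rparr>) \<inter> (S_C \<inter> L) \<noteq> {\<one>\<^bsub>G\<^esub>}"
  shows "equivariant_homotopy_equivalent (normalizer G T)
    (\<lambda>n. realization_map (conj_set G n)) (realization (order_complex (centric_radicals_fixed p G T)))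
    (\<lambda>n. realization_map (conj_cosets G n)) (realization (order_complex (centric_radicals p H)))"
proof -
  interpret group G by fact
  interpret fixed_point_setting G p T C O_C L H
    unfolding fixed_point_setting_def fixed_point_setting_axioms_def
      finite_group_prime_def finite_group_prime_axioms_def
    by (intro conjI allI impI) (rule N1[rule_format] assms; assumption?)+
  show ?thesis
    using D_fixed_equiv_D_quotient by (simp add: conj_set_eq)
qed

end
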